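(* Let $0<\alpha<\pi$, let $u_0\in\mathbb{C}$ with $|u_0|<1$, and put $\lambda=\lambda(u)$, $\lambda_0=\lambda(u_0)$. Let $P_{n,u_0}$ be the polynomial of degree at most $n$, bounded by one in modulus on $A_\alpha$, which has maximal modulus at $u_0$, normalized as in the context. Then there exists $\phi\in\mathbb{R}$ such that $$\lim_{n\to\infty} b_{\Omega_\alpha}(u,\infty)^n P_{n,u_0}(u)=e^{i\phi}\,\frac12\left(1+\frac{h(\lambda,\lambda_0)}{h(\lambda_0,\lambda_0)}\right)\frac{\lambda^2-|\lambda_0|^2}{\lambda^2+|\lambda_0|^2}\cdot\frac{\lambda^2+\lambda_0^2}{\lambda^2-\overline{\lambda_0}^{\,2}}$$ uniformly (in $u$) on compact subsets of $\Omega_\alpha$, where $$h(\lambda,\lambda_0)=\frac{\lambda^2}{(\lambda^2-|\lambda_0|^2)(\lambda^2+|\lambda_0|^2)}.$$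
   Context: $A_\alpha=\{u\in\mathbb{C}: |u|=1,\ -\alpha\le\arg u\le\alpha\}$ and $\Omega_\alpha=\overline{\mathbb{C}}\setminus A_\alpha$ (a domain in the Riemann sphere). $\lambda:\Omega_\alpha\to\{\lambda\in\mathbb{C}:-\pi/4\le\arg\lambda\le\pi/4\}$ is the function $\lambda(u)=\left(\frac{ue^{i\alpha}-1}{u-e^{i\alpha}}\right)^{1/4}$, the branch of the fourth root being the one with values in this sector. For a domain $\Omega$ with Green's function $g_\Omega(z,z_0)$ with pole at $z_0$, the complex Green's function is $b_\Omega(z,z_0)=e^{-(g_\Omega(z,z_0)+i*g_\Omega(z,z_0))}$, where $*g_\Omega$ is a harmonic conjugate of $g_\Omega$. The function $b_{\Omega_\alpha}(u,\infty)$ is normalized by $\lim_{u\to\infty}u\,b_{\Omega_\alpha}(u,\infty)>0$. $\mathcal{P}_{n,\alpha}$ is the set of complex polynomials $P$ of degree at most $n$ with $\sup_{u\in A_\alpha}|P(u)|\le1$. $P_{n,u_0}\in\mathcal{P}_{n,\alpha}$ is the maximizer of $|P(u_0)|$ over $P\in\mathcal{P}_{n,\alpha}$, normalized by $b_{\Omega_\alpha}(u_0,\infty)^nP_{n,u_0}(u_0)>0$. The right-hand side is understood as an analytic function on $\Omega_\alpha$ (its singularities where $\lambda^2=|\lambda_0|^2$ or $\lambda^2=\overline{\lambda_0}^{\,2}$ are removable), and the left-hand functions $b_{\Omega_\alpha}(u,\infty)^nP_{n,u_0}(u)$ are understood as extended analytically to $u=\infty$. *)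

theory Defs
  imports "HOL-Complex_Analysis.Complex_Analysis"
begin

section \<open>The Riemann sphere\<close>

text \<open>The Riemann sphere is the one-point compactification of \<^typ>\<open>complex\<close>: \<^term>\<open>Some z\<close> is the
  finite point \<open>z\<close>, and \<^term>\<open>None\<close> is the point at infinity.\<close>

abbreviation riemann_sphere :: "complex option topology" where
  "riemann_sphere \<equiv> Alexandroff_compactification euclidean"

text \<open>The chart \<open>w \<mapsto> 1/w\<close> around infinity. Together with \<^term>\<open>Some\<close> it is an atlas of the sphere.\<close>

definition inf_chart :: "complex \<Rightarrow> complex option" where
  "inf_chart w = (if w = 0 then None else Some (inverse w))"

definition sphere_holomorphic_on ::
    "(complex option \<Rightarrow> complex) \<Rightarrow> complex option set \<Rightarrow> bool" where
  "sphere_holomorphic_on f S \<longleftrightarrow>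
     (f \<circ> Some) holomorphic_on (Some -` S) \<and>
     (f \<circ> inf_chart) holomorphic_on (inf_chart -` S)"

text \<open>Twice continuously differentiable functions with vanishing Laplacian, meant for open \<open>S\<close>. Here
  \<open>fx\<close>, \<open>fy\<close>, \<open>fxx\<close>, \<open>fxy\<close>, \<open>fyy\<close> are the partial derivatives of \<open>f\<close> (the mixed ones agree as \<open>f\<close> is
  of class \<open>C\<^sup>2\<close>).\<close>

definition harmonic_on :: "(complex \<Rightarrow> real) \<Rightarrow> complex set \<Rightarrow> bool" where
  "harmonic_on f S \<longleftrightarrow>
     (\<exists>fx fy fxx fxy fyy :: complex \<Rightarrow> real.
        continuous_on S fxx \<and> continuous_on S fxy \<and> continuous_on S fyy \<and>
        (\<forall>z\<in>S. (f has_derivative (\<lambda>h. fx z * Re h + fy z * Im h)) (at z) \<and>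
               (fx has_derivative (\<lambda>h. fxx z * Re h + fxy z * Im h)) (at z) \<and>
               (fy has_derivative (\<lambda>h. fxy z * Re h + fyy z * Im h)) (at z) \<and>
               fxx z + fyy z = 0))"

definition sphere_harmonic_on ::
    "(complex option \<Rightarrow> real) \<Rightarrow> complex option set \<Rightarrow> bool" where
  "sphere_harmonic_on g S \<longleftrightarrow>
     harmonic_on (g \<circ> Some) (Some -` S) \<and> harmonic_on (g \<circ> inf_chart) (inf_chart -` S)"

text \<open>The extension of a function to the sphere by its limits at removable singularities, including
  the point at infinity.\<close>

definition sphere_extension :: "(complex \<Rightarrow> complex) \<Rightarrow> complex option \<Rightarrow> complex" where
  "sphere_extension f p =
     (case p of None \<Rightarrow> Lim at_infinity f | Some z \<Rightarrow> remove_sings f z)"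

section \<open>Green's functions\<close>

text \<open>Existence of the limit is equivalent to harmonicity of \<open>g(z) + ln |z - a|\<close> (of
  \<open>g(z) - ln |z|\<close> for the pole at infinity) across the pole when \<open>g\<close> is harmonic in a punctured
  neighbourhood of it.\<close>

definition has_log_pole :: "(complex option \<Rightarrow> real) \<Rightarrow> complex option \<Rightarrow> bool" where
  "has_log_pole g p =
     (case p of
        None \<Rightarrow> (\<exists>c. ((\<lambda>z. g (Some z) - ln (cmod z)) \<longlongrightarrow> c) at_infinity)
      | Some a \<Rightarrow> (\<exists>c. ((\<lambda>z. g (Some z) + ln (cmod (z - a))) \<longlongrightarrow> c) (at a)))"

definition positive_harmonic_with_log_pole ::
    "complex option set \<Rightarrow> complex option \<Rightarrow> (complex option \<Rightarrow> real) \<Rightarrow> bool" where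
  "positive_harmonic_with_log_pole \<Omega> p g \<longleftrightarrow>
     sphere_harmonic_on g (\<Omega> - {p}) \<and> (\<forall>z\<in>\<Omega> - {p}. 0 < g z) \<and> has_log_pole g p"

text \<open>The Green's function of \<open>\<Omega>\<close> with pole \<open>p\<close> is the least positive harmonic function with a
  logarithmic pole at \<open>p\<close>; the value of \<open>g\<close> at \<open>p\<close> itself is irrelevant.\<close>

definition is_green_function ::
    "complex option set \<Rightarrow> complex option \<Rightarrow> (complex option \<Rightarrow> real) \<Rightarrow> bool" where
  "is_green_function \<Omega> p g \<longleftrightarrow>
     p \<in> \<Omega> \<and> positive_harmonic_with_log_pole \<Omega> p g \<and>
     (\<forall>k. positive_harmonic_with_log_pole \<Omega> p k \<longrightarrow> (\<forall>z\<in>\<Omega> - {p}. g z \<le> k z))"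

definition harmonic_conjugate_on ::
    "(complex option \<Rightarrow> real) \<Rightarrow> (complex option \<Rightarrow> real) \<Rightarrow> complex option set \<Rightarrow> bool" where
  "harmonic_conjugate_on v g U \<longleftrightarrow>
     sphere_harmonic_on v U \<and> sphere_holomorphic_on (\<lambda>z. Complex (g z) (v z)) U"

text \<open>\<open>b = exp (-(g + i *g))\<close>. The conjugate \<open>*g\<close> is only locally single-valued on \<open>\<Omega> - {p}\<close>: it
  changes by a multiple of \<open>2\<pi>\<close> around \<open>p\<close>, which does not affect \<open>b\<close>. So \<open>*g\<close> is chosen locally, and
  \<open>b\<close> is one single-valued function (as is the case for simply connected \<open>\<Omega>\<close>), holomorphic with a
  zero at \<open>p\<close>. It is determined up to a unimodular constant if \<open>\<Omega>\<close> is connected.\<close>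

definition is_complex_green_function ::
    "complex option set \<Rightarrow> complex option \<Rightarrow> (complex option \<Rightarrow> complex) \<Rightarrow> bool" where
  "is_complex_green_function \<Omega> p b \<longleftrightarrow>
     (\<exists>g. is_green_function \<Omega> p g \<and> b p = 0 \<and>
        (\<forall>z\<in>\<Omega> - {p}. \<exists>U v. openin riemann_sphere U \<and> z \<in> U \<and> U \<subseteq> \<Omega> - {p} \<and>
           harmonic_conjugate_on v g U \<and>
           (\<forall>x\<in>U. b x = exp (- (of_real (g x) + \<i> * of_real (v x))))))"

section \<open>The circular arc and its complement\<close>

definition arc_set :: "real \<Rightarrow> complex set" where
  "arc_set \<alpha> = {u. cmod u = 1 \<and> - \<alpha> \<le> Arg u \<and> Arg u \<le> \<alpha>}"

definition arc_domain :: "real \<Rightarrow> complex option set" where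
  "arc_domain \<alpha> = UNIV - Some ` arc_set \<alpha>"

text \<open>\<open>powr\<close> is the principal power, so on the complement of the arc, where the base is not in \<open>(-\<infinity>, 0]\<close>,
  the values lie in the sector \<open>|arg| < \<pi>/4\<close>. The value at infinity is not needed: it is recovered by
  \<^const>\<open>sphere_extension\<close>.\<close>

definition lam :: "real \<Rightarrow> complex \<Rightarrow> complex" where
  "lam \<alpha> u =
     ((u * exp (\<i> * of_real \<alpha>) - 1) / (u - exp (\<i> * of_real \<alpha>))) powr (1 / 4)"

section \<open>Extremal polynomials\<close>

definition bounded_polys :: "nat \<Rightarrow> real \<Rightarrow> complex poly set" where
  "bounded_polys n \<alpha> = {P. degree P \<le> n \<and> (\<forall>u\<in>arc_set \<alpha>. cmod (poly P u) \<le> 1)}"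

definition is_extremal_poly :: "nat \<Rightarrow> real \<Rightarrow> complex \<Rightarrow> complex poly \<Rightarrow> bool" where
  "is_extremal_poly n \<alpha> u0 P \<longleftrightarrow>
     P \<in> bounded_polys n \<alpha> \<and>
     (\<forall>Q\<in>bounded_polys n \<alpha>. cmod (poly Q u0) \<le> cmod (poly P u0))"

section \<open>The limit function\<close>

definition h_fun :: "complex \<Rightarrow> complex \<Rightarrow> complex" where
  "h_fun l l0 =
     l^2 / ((l^2 - of_real ((cmod l0)^2)) * (l^2 + of_real ((cmod l0)^2)))"

definition limit_expr :: "complex \<Rightarrow> complex \<Rightarrow> complex" where
  "limit_expr l l0 =
     1 / 2 * (1 + h_fun l l0 / h_fun l0 l0)
       * ((l^2 - of_real ((cmod l0)^2)) / (l^2 + of_real ((cmod l0)^2)))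
       * ((l^2 + l0^2) / (l^2 - (cnj l0)^2))"

end

theory Submission
  imports Defs
begin

text \<open>The substitution \<open>s = \<lambda>\<^sup>2\<close>, \<open>z = (s - |s\<^sub>0|) / (s + |s\<^sub>0|)\<close> maps the domain onto the unit disc and
  \<open>u\<^sub>0\<close> to a point \<open>-\<i>\<tau>\<close> with \<open>0 < \<tau> < 1\<close>; the two sides of the arc become conjugate points of the circle,
  \<open>b\<close> becomes a Blaschke factor, and the limit becomes a unimodular multiple of
  \<open>F(z) = (1 + \<i>\<tau>z)\<^sup>2 / (2(1 + \<tau>\<^sup>2))\<close>. On the circle \<open>|F(z)| + |F(cnj z)| = 1\<close>, so the symmetrization of
  \<open>F b\<^sup>-\<^sup>n\<close>, corrected by exponentially small terms, is a polynomial in \<open>u\<close> that is nearly admissible: this bounds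
  the extremal value at \<open>u\<^sub>0\<close> from below by \<open>F(-\<i>\<tau>) - o(1)\<close>.

  For the upper bound write \<open>X\<close> for the boundary values of \<open>b\<^sup>n P\<close> times the phase of \<open>cnj F\<close>, and
  \<open>\<eta> = X(z) / X(cnj z)\<close>, which does not depend on \<open>P\<close>. Every moment of \<open>X \<eta>\<^sup>k\<close> or of \<open>\<eta>\<^sup>k\<close>, \<open>k \<ge> 1\<close>, is
  exponentially small, as one sees by shrinking the circle. Integrating \<open>(X(z) + X(cnj z)) / 2\<close>, which is
  at most one in modulus, against a Fejer kernel in \<open>\<eta>\<close> therefore bounds the value at \<open>-\<i>\<tau>\<close> by
  \<open>F(-\<i>\<tau>) + o(1)\<close>. Near equality forces \<open>(X(z) + X(cnj z)) / 2\<close> to be close to \<open>1\<close> in mean where the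
  kernel is concentrated, and testing this against suitable even functions yields convergence to \<open>F\<close> at every point of the disc.\<close>

section \<open>Means over circles\<close>

text \<open>The trivial upper bound is off by a factor of two. Cauchy's formula gives the value of
  \<open>f = b^n P\<close> at \<open>-\<i>\<tau>\<close> as a mean of \<open>X\<close> against a
  positive weight, and \<open>|X| \<le> 1\<close> then yields only twice
  \<open>F(-\<i>\<tau>)\<close>: it ignores that both sides of the arc carry the same values of
  \<open>P\<close>. This coupling is the relation \<open>X(z) = \<eta>(z) X(1/z)\<close>. Up to a
  common factor, a kernel of order \<open>N\<close> in \<open>\<eta>\<close> has mean about
  \<open>2N F(-\<i>\<tau>)\<close>, its product with \<open>X\<close> about
  \<open>(2N - 1) f(-\<i>\<tau>)\<close>; the defect stays bounded while the mass grows like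
  \<open>N\<close>. So \<open>n\<close> tends to infinity for fixed \<open>N\<close>, and only then
  is \<open>N\<close> enlarged. The obstacle in the lower bound is the double pole of
  \<open>F\<close> at \<open>z = \<infinity>\<close>, where \<open>u\<close> is finite:
  \<open>F b^-n\<close> plus its reflection is not a polynomial in \<open>u\<close>. Since
  \<open>1/b\<close> has there a value of modulus \<open>|c| < 1\<close>, the part to be removed is
  only of size \<open>n |c|^(n-1)\<close>. No phase has to be found in the disc: the normalization
  makes \<open>f\<close> positive at \<open>-\<i>\<tau>\<close>, where \<open>F\<close> is positive
  too.\<close>

definition circle_mean :: "real \<Rightarrow> (complex \<Rightarrow> 'a::banach) \<Rightarrow> 'a" where
  "circle_mean r h = integral {0..1} (\<lambda>t. h (circlepath 0 r t))"

lemma circlepath_in_sphere: "0 \<le> r \<Longrightarrow> circlepath 0 r t \<in> sphere 0 r"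
  by (simp add: circlepath norm_mult)

lemma circle_mean_integrable:
  fixes h :: "complex \<Rightarrow> 'a::banach"
  assumes "0 \<le> r" "continuous_on (sphere 0 r) h"
  shows "(\<lambda>t. h (circlepath 0 r t)) integrable_on {0..1}"
proof -
  have "continuous_on {0..1} (circlepath 0 r)"
    using path_circlepath[of 0 r] by (simp add: path_def)
  hence "continuous_on {0..1} (\<lambda>t. h (circlepath 0 r t))"
    using circlepath_in_sphere[OF assms(1)] by (intro continuous_on_compose2[OF assms(2)]) auto
  thus ?thesis by (rule integrable_continuous_real)
qed

lemma circle_mean_cong:
  assumes "0 \<le> r" "\<And>z. cmod z = r \<Longrightarrow> g z = h z"
  shows "circle_mean r g = circle_mean r h"
  using assms circlepath_in_sphere[of r] unfolding circle_mean_def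
  by (auto intro!: Henstock_Kurzweil_Integration.integral_cong)

lemma circle_mean_add:
  assumes "0 \<le> r" "continuous_on (sphere 0 r) g" "continuous_on (sphere 0 r) h"
  shows "circle_mean r (\<lambda>z. g z + h z) = circle_mean r g + circle_mean r h"
  unfolding circle_mean_def
  using assms by (intro Henstock_Kurzweil_Integration.integral_add circle_mean_integrable)

lemma circle_mean_diff:
  assumes "0 \<le> r" "continuous_on (sphere 0 r) g" "continuous_on (sphere 0 r) h"
  shows "circle_mean r (\<lambda>z. g z - h z) = circle_mean r g - circle_mean r h"
  unfolding circle_mean_def
  using assms by (intro Henstock_Kurzweil_Integration.integral_diff circle_mean_integrable)

lemma circle_mean_sum:
  assumes "0 \<le> r" "finite I" "\<And>i. i \<in> I \<Longrightarrow> continuous_on (sphere 0 r) (g i)"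
  shows "circle_mean r (\<lambda>z. \<Sum>i\<in>I. g i z) = (\<Sum>i\<in>I. circle_mean r (g i))"
  unfolding circle_mean_def
  using assms by (intro Henstock_Kurzweil_Integration.integral_sum circle_mean_integrable)

lemma circle_mean_cmult:
  fixes c :: "'a::{real_normed_field, banach}"
  shows "circle_mean r (\<lambda>z. c * h z) = c * circle_mean r h"
  unfolding circle_mean_def by simp

lemma circle_mean_const: "circle_mean r (\<lambda>z. c) = c"
  unfolding circle_mean_def by simp

lemma Re_circle_mean:
  assumes "0 \<le> r" "continuous_on (sphere 0 r) h"
  shows "Re (circle_mean r h) = circle_mean r (\<lambda>z. Re (h z))"
  unfolding circle_mean_def
  using integral_linear[OF circle_mean_integrable[OF assms] bounded_linear_Re]
  by (simp add: o_def)

lemma circle_mean_norm_le: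
  assumes "0 \<le> r" "continuous_on (sphere 0 r) h" "continuous_on (sphere 0 r) g"
    and "\<And>z. cmod z = r \<Longrightarrow> norm (h z) \<le> g z"
  shows "norm (circle_mean r h) \<le> circle_mean r g"
  unfolding circle_mean_def
  using assms circlepath_in_sphere[of r]
  by (intro integral_norm_bound_integral circle_mean_integrable) auto

text \<open>On the unit circle inversion is \<open>t \<mapsto> 1 - t\<close> in the parameter. Every
  reflection argument below rests on this.\<close>

lemma circle_mean_inverse: "circle_mean 1 (\<lambda>z. h (inverse z)) = circle_mean 1 h"
proof -
  have eq: "inverse (circlepath 0 1 t) = circlepath 0 1 (1 - t)" for t
  proof -
    have "circlepath 0 1 t * circlepath 0 1 (1 - t) = exp (2 * of_real pi * \<i>)"
      by (simp add: circlepath algebra_simps flip: exp_add)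
    also have "\<dots> = 1" by (rule exp_two_pi_i)
    finally show ?thesis by (metis inverse_unique)
  qed
  have "circle_mean 1 (\<lambda>z. h (inverse z)) = integral {0..1} (\<lambda>t. h (circlepath 0 1 (1 - t)))"
    unfolding circle_mean_def eq ..
  also have "\<dots> = integral {-1..0} (\<lambda>t. h (circlepath 0 1 (1 + t)))"
    using Henstock_Kurzweil_Integration.integral_reflect_real[of 0 "-1" "\<lambda>t. h (circlepath 0 1 (1 + t))"] by simp
  also have "\<dots> = integral {0..1} (\<lambda>t. h (circlepath 0 1 t))"
    using integral_shift_Icc_real[of "-1" 0 "\<lambda>t. h (circlepath 0 1 t)" 1]
    by (simp add: o_def)
  finally show ?thesis unfolding circle_mean_def .
qed

lemma contour_integral_circlepath_conv_mean:
  assumes "0 < r"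
  shows "contour_integral (circlepath 0 r) (\<lambda>z. h z / z) = 2 * pi * \<i> * circle_mean r h"
proof -
  have "contour_integral (circlepath 0 r) (\<lambda>z. h z / z)
      = integral {0..1} (\<lambda>t. h (circlepath 0 r t) / circlepath 0 r t
          * vector_derivative (circlepath 0 r) (at t within {0..1}))"
    unfolding contour_integral_def has_contour_integral_def integral_def contour_integrable_on_def integrable_on_def by simp
  also have "\<dots> = integral {0..1} (\<lambda>t. (2 * pi * \<i>) * h (circlepath 0 r t))"
  proof (rule Henstock_Kurzweil_Integration.integral_cong)
    fix t :: real assume "t \<in> {0..1}"
    hence d: "vector_derivative (circlepath 0 r) (at t within {0..1})
        = 2 * pi * \<i> * r * exp (2 * of_real pi * \<i> * t)"
      by (intro vector_derivative_circlepath01) auto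
    show "h (circlepath 0 r t) / circlepath 0 r t
          * vector_derivative (circlepath 0 r) (at t within {0..1})
        = (2 * pi * \<i>) * h (circlepath 0 r t)"
      unfolding d using assms by (simp add: circlepath)
  qed
  finally show ?thesis
    unfolding circle_mean_def by simp
qed

lemma circle_mean_Cauchy:
  assumes "f analytic_on cball 0 1" "cmod a < 1"
  shows "circle_mean 1 (\<lambda>z. f z * z / (z - a)) = f a"
proof -
  have "((\<lambda>u. f u / (u - a)) has_contour_integral 2 * of_real pi * \<i> * f a) (circlepath 0 1)"
    using assms by (intro Cauchy_integral_circlepath_simple)
       (auto simp: analytic_imp_holomorphic)
  hence "2 * pi * \<i> * f a = contour_integral (circlepath 0 1) (\<lambda>u. f u / (u - a))"
    by (simp add: contour_integral_unique)
  also have "\<dots> = contour_integral (circlepath 0 1) (\<lambda>z. (f z * z / (z - a)) / z)"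
    by (intro contour_integral_cong) auto
  also have "\<dots> = 2 * pi * \<i> * circle_mean 1 (\<lambda>z. f z * z / (z - a))"
    by (rule contour_integral_circlepath_conv_mean) simp
  finally show ?thesis by simp
qed

text \<open>Cauchy's theorem for \<open>h z / z\<close>: radial segments give a homotopy of the two
  circles inside the annulus, hence inside an open set on which \<open>h\<close> is still
  holomorphic.\<close>

lemma circle_mean_shrink:
  assumes "h analytic_on {z. r \<le> cmod z \<and> cmod z \<le> R}" "0 < r" "r \<le> R"
  shows "circle_mean R h = circle_mean r h"
proof -
  let ?A = "{z. r \<le> cmod z \<and> cmod z \<le> R}"
  have "(\<lambda>z. h z / z) analytic_on ?A"
    using assms by (intro analytic_intros) auto
  then obtain S where S: "open S" "?A \<subseteq> S" "(\<lambda>z. h z / z) holomorphic_on S"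
    by (auto simp: analytic_on_holomorphic)
  have "homotopic_loops S (circlepath 0 R) (circlepath 0 r)"
  proof (rule homotopic_loops_linear)
    fix t :: real assume "t \<in> {0..1}"
    have "closed_segment (circlepath 0 R t) (circlepath 0 r t) \<subseteq> ?A"
    proof
      fix x assume "x \<in> closed_segment (circlepath 0 R t) (circlepath 0 r t)"
      then obtain u where u: "0 \<le> u" "u \<le> 1"
        "x = (1 - u) *\<^sub>R circlepath 0 R t + u *\<^sub>R circlepath 0 r t"
        by (auto simp: in_segment)
      have "x = of_real ((1 - u) * R + u * r) * exp (2 * of_real pi * \<i> * of_real t)"
        unfolding u(3) by (simp add: circlepath scaleR_conv_of_real algebra_simps)
      hence "cmod x = \<bar>(1 - u) * R + u * r\<bar>"
        by (simp only: norm_mult norm_of_real) simp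
      moreover have "0 \<le> (1 - u) * (R - r)" "0 \<le> u * (R - r)" using u assms by auto
      ultimately show "x \<in> ?A" using assms(2) by (auto simp: algebra_simps)
    qed
    thus "closed_segment (circlepath 0 R t) (circlepath 0 r t) \<subseteq> S" using S(2) by blast
  qed auto
  hence "contour_integral (circlepath 0 R) (\<lambda>z. h z / z)
       = contour_integral (circlepath 0 r) (\<lambda>z. h z / z)"
    using S by (intro Cauchy_theorem_homotopic_loops) auto
  thus ?thesis
    using contour_integral_circlepath_conv_mean[of R h]
      contour_integral_circlepath_conv_mean[of r h] assms by simp
qed

section \<open>The extremal problem in the disc\<close>

lemma norm_diff_eq_on_circle:
  assumes "cmod z = 1"
  shows "cmod (z - x) = cmod (1 - cnj x * z)"
proof -
  have "z * cnj z = 1" using assms by (simp add: complex_norm_square[symmetric])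
  hence "1 - cnj x * z = z * cnj (z - x)" by (simp add: algebra_simps)
  thus ?thesis using assms by (simp add: norm_mult del: complex_cnj_diff)
qed

lemma one_minus_mult_nonzero:
  fixes x z :: complex
  assumes "cmod x < 1" "cmod z \<le> 1"
  shows "1 - x * z \<noteq> 0"
proof
  assume "1 - x * z = 0"
  hence "cmod x * cmod z = 1" by (metis eq_iff_diff_eq_0 norm_mult norm_one)
  moreover have "cmod x * cmod z \<le> cmod x" using assms by (simp add: mult_left_le)
  ultimately show False using assms by simp
qed

lemma one_minus_square_nonzero: "cmod a < 1 \<Longrightarrow> 1 - a\<^sup>2 \<noteq> 0"
  using one_minus_mult_nonzero[of a a] by (simp add: power2_eq_square)

lemma inverse_eq_cnj: "cmod z = 1 \<Longrightarrow> inverse z = cnj z"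
  by (metis complex_norm_square inverse_unique mult.commute of_real_1 power_one)

definition blaschke :: "complex \<Rightarrow> complex \<Rightarrow> complex" where
  "blaschke c z = (z - c) / (1 - cnj c * z)"

lemma norm_blaschke_eq_1:
  assumes "cmod c < 1" "cmod z = 1"
  shows "cmod (blaschke c z) = 1"
  using norm_diff_eq_on_circle[OF assms(2), of c] one_minus_mult_nonzero[of "cnj c" z] assms
  by (simp add: blaschke_def norm_divide)

lemma blaschke_Moebius: "blaschke c z = Moebius_function 0 c z"
  by (simp add: blaschke_def Moebius_function_simple)

lemma norm_blaschke_less_1: "cmod c < 1 \<Longrightarrow> cmod z < 1 \<Longrightarrow> cmod (blaschke c z) < 1"
  by (simp add: blaschke_Moebius Moebius_function_norm_lt_1)

text \<open>In the application \<open>- (\<i> * \<tau>)\<close> is the disc coordinate of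
  \<open>u0\<close> and \<open>c\<close> that of the point at infinity.\<close>

locale disc_data =
  fixes \<tau> :: real and c :: complex
  assumes tau: "\<bar>\<tau>\<bar> < 1" and c: "cmod c < 1"
begin

text \<open>On the circle this is \<open>|F| / F\<close> for the function \<open>F\<close> = \<open>lim_fun\<close>.\<close>

definition phase :: "complex \<Rightarrow> complex" where
  "phase z = (z - \<i> * \<tau>) / (z * (1 + \<i> * \<tau> * z))"

text \<open>On the circle this is the positive function \<open>real_weight\<close>. The rational
  form continues it into the disc, where \<open>weight * phase\<close> has no pole other than
  \<open>- (\<i> * \<tau>)\<close>; so means against it evaluate an analytic function at the point
  of interest.\<close>

definition weight :: "complex \<Rightarrow> complex" where
  "weight z = z\<^sup>2 / ((1 + (of_real \<tau>)\<^sup>2 * z\<^sup>2) * (z\<^sup>2 + (of_real \<tau>)\<^sup>2))"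

definition real_weight :: "complex \<Rightarrow> real" where
  "real_weight z = 1 / (cmod (1 + (of_real \<tau>)\<^sup>2 * z\<^sup>2))\<^sup>2"

text \<open>The function \<open>\<eta>\<close> of the introduction; see \<open>phase_rot\<close> for the quotient it represents.\<close>

definition rot :: "nat \<Rightarrow> complex \<Rightarrow> complex" where
  "rot n z = (blaschke c z * blaschke (cnj c) z) ^ n * ((z\<^sup>2 + (of_real \<tau>)\<^sup>2) / (z\<^sup>2 * (1 + (of_real \<tau>)\<^sup>2 * z\<^sup>2)))"

text \<open>Even (invariant under \<open>z \<mapsto> 1/z\<close>), with a zero that cancels the pole of \<open>weight * phase\<close> at \<open>-\<i>\<tau>\<close>,
  so that only the pole at \<open>a\<close> contributes to \<open>mean_test\<close>.\<close>

definition test :: "complex \<Rightarrow> complex \<Rightarrow> complex" where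
  "test a z = (z + \<i> * \<tau>) * (1 + \<i> * \<tau> * z) / ((z - a) * (1 - a * z))"

definition lim_fun :: "complex \<Rightarrow> complex" where
  "lim_fun z = (1 + \<i> * \<tau> * z)\<^sup>2 / (2 * (1 + (of_real \<tau>)\<^sup>2))"

text \<open>The factor that Cauchy's formula leaves behind at the point \<open>a\<close> in
  \<open>mean_test\<close>.\<close>

definition jac :: "complex \<Rightarrow> complex" where
  "jac a = 1 / ((1 - a\<^sup>2) * (1 + (of_real \<tau>)\<^sup>2 * a\<^sup>2))"

lemma norm_i_tau: "cmod (\<i> * \<tau>) < 1" "cmod (- (\<i> * \<tau>)) < 1"
  using tau by (simp_all add: norm_mult)

lemma factor_nonzero:
  assumes "cmod z \<le> 1"
  shows "1 + \<i> * \<tau> * z \<noteq> 0" "1 - \<i> * \<tau> * z \<noteq> 0" "1 + (of_real \<tau>)\<^sup>2 * z\<^sup>2 \<noteq> 0"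
proof -
  show a: "1 + \<i> * \<tau> * z \<noteq> 0"
    using one_minus_mult_nonzero[OF norm_i_tau(2) assms] by simp
  show b: "1 - \<i> * \<tau> * z \<noteq> 0"
    using one_minus_mult_nonzero[OF norm_i_tau(1) assms] by simp
  have "1 + (of_real \<tau>)\<^sup>2 * z\<^sup>2 = (1 + \<i> * \<tau> * z) * (1 - \<i> * \<tau> * z)"
    by (simp add: algebra_simps power2_eq_square)
  thus "1 + (of_real \<tau>)\<^sup>2 * z\<^sup>2 \<noteq> 0" using a b by simp
qed

lemma circle_nonzero:
  assumes "cmod z = 1"
  shows "z \<noteq> 0" "z + \<i> * \<tau> \<noteq> 0" "z - \<i> * \<tau> \<noteq> 0" "z\<^sup>2 + (of_real \<tau>)\<^sup>2 \<noteq> 0"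
proof -
  show "z \<noteq> 0" using assms by auto
  show a: "z + \<i> * \<tau> \<noteq> 0"
    using norm_i_tau assms by (metis add_eq_0_iff norm_minus_cancel less_irrefl)
  show b: "z - \<i> * \<tau> \<noteq> 0" using norm_i_tau assms by auto
  have "z\<^sup>2 + (of_real \<tau>)\<^sup>2 = (z + \<i> * \<tau>) * (z - \<i> * \<tau>)"
    by (simp add: algebra_simps power2_eq_square)
  thus "z\<^sup>2 + (of_real \<tau>)\<^sup>2 \<noteq> 0" using a b by simp
qed

lemma blaschke_nonzero:
  assumes "cmod z = 1" 
  shows "1 - c * z \<noteq> 0" "1 - cnj c * z \<noteq> 0" "z - c \<noteq> 0" "z - cnj c \<noteq> 0"
  using one_minus_mult_nonzero[of c z] one_minus_mult_nonzero[of "cnj c" z] c assms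
  by auto

lemma test_nonzero:
  assumes "cmod a < 1" "cmod z = 1"
  shows "z - a \<noteq> 0" "1 - a * z \<noteq> 0"
  using one_minus_mult_nonzero[of a z] assms by auto

lemmas circle_nonzeros = factor_nonzero[OF eq_refl] circle_nonzero blaschke_nonzero

lemma norm_phase:
  assumes "cmod z = 1"
  shows "cmod (phase z) = 1"
  using norm_diff_eq_on_circle[OF assms, of "\<i> * \<tau>"] circle_nonzeros[OF assms] assms
  by (simp add: phase_def norm_divide norm_mult)

lemma norm_rot:
  assumes "cmod z = 1"
  shows "cmod (rot n z) = 1"
proof -
  have "cmod (z\<^sup>2 - (-((of_real \<tau>)\<^sup>2))) = cmod (1 - cnj (-((of_real \<tau>)\<^sup>2)) * z\<^sup>2)"
    by (rule norm_diff_eq_on_circle) (use assms in \<open>simp add: norm_power\<close>)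
  hence "cmod (z\<^sup>2 + (of_real \<tau>)\<^sup>2) = cmod (1 + (of_real \<tau>)\<^sup>2 * z\<^sup>2)" by simp
  thus ?thesis
    using assms c circle_nonzeros[OF assms] norm_blaschke_eq_1[of c z] norm_blaschke_eq_1[of "cnj c" z]
    by (simp add: rot_def norm_mult norm_power norm_divide)
qed

lemma rot_cnj: "rot n (cnj z) = cnj (rot n z)"
  by (simp add: rot_def blaschke_def mult.commute)

lemma rot_inverse:
  assumes "cmod z = 1"
  shows "rot n (inverse z) = cnj (rot n z)"
  using assms by (simp add: inverse_eq_cnj rot_cnj)

lemma weight_eq:
  assumes "cmod z = 1"
  shows "weight z = of_real (real_weight z)"
proof -
  have zz: "z * cnj z = 1" using assms by (simp add: complex_norm_square[symmetric])
  have "z\<^sup>2 * cnj (1 + (of_real \<tau>)\<^sup>2 * z\<^sup>2) = z\<^sup>2 + (of_real \<tau>)\<^sup>2 * (z * cnj z)\<^sup>2"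
    by (simp add: algebra_simps power2_eq_square)
  hence *: "z\<^sup>2 + (of_real \<tau>)\<^sup>2 = z\<^sup>2 * cnj (1 + (of_real \<tau>)\<^sup>2 * z\<^sup>2)" unfolding zz by simp
  have cancel: "p / (q * (p * r)) = 1 / (q * r)" if "p \<noteq> 0" for p q r :: complex
    using that by simp
  show ?thesis
    unfolding weight_def real_weight_def * of_real_divide complex_norm_square of_real_1
    using circle_nonzeros[OF assms] by (intro cancel) simp
qed

lemma real_weight_pos: "cmod z = 1 \<Longrightarrow> 0 < real_weight z"
  using factor_nonzero(3)[of z] by (simp add: real_weight_def)

lemma real_weight_inverse:
  assumes "cmod z = 1"
  shows "real_weight (inverse z) = real_weight z"
proof -
  have "1 + (of_real \<tau>)\<^sup>2 * (cnj z)\<^sup>2 = cnj (1 + (of_real \<tau>)\<^sup>2 * z\<^sup>2)" by simp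
  thus ?thesis using assms unfolding real_weight_def inverse_eq_cnj[OF assms]
    by (metis complex_mod_cnj)
qed

lemma weight_inverse: "cmod z = 1 \<Longrightarrow> weight (inverse z) = weight z"
  by (simp add: weight_eq real_weight_inverse norm_inverse)

lemma test_inverse:
  assumes "cmod z = 1" "cmod a < 1"
  shows "test a (inverse z) = test a z"
proof -
  have z: "z \<noteq> 0" using assms by auto
  have 1: "(inverse z + \<i> * \<tau>) * (1 + \<i> * \<tau> * inverse z) = (z + \<i> * \<tau>) * (1 + \<i> * \<tau> * z) / z\<^sup>2"
    "(inverse z - a) * (1 - a * inverse z) = ((z - a) * (1 - a * z)) / z\<^sup>2"
    using z by (simp_all add: field_simps power2_eq_square)
  show ?thesis unfolding test_def 1 using z by simp
qed

lemma test_pole: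
  assumes "cmod z = 1"
  shows "test (- (\<i> * \<tau>)) z = 1"
  using circle_nonzeros[OF assms] by (simp add: test_def)

lemma phase_inverse:
  assumes "cmod z = 1"
  shows "phase (inverse z) = z * (1 - \<i> * \<tau> * z) / (z + \<i> * \<tau>)"
proof -
  note nz = circle_nonzeros[OF assms]
  have "inverse z - \<i> * \<tau> = (1 - \<i> * \<tau> * z) / z" "1 + \<i> * \<tau> * inverse z = (z + \<i> * \<tau>) / z"
    using nz by (simp_all add: field_simps)
  moreover have "(A / z) / (inverse z * (B / z)) = z * A / B" for A B
    using nz(4) by (cases "B = 0") (auto simp: field_simps)
  ultimately show ?thesis unfolding phase_def by simp
qed

text \<open>Reflection turns \<open>blaschke c\<close> into the reciprocal of
  \<open>blaschke (cnj c)\<close>, so the quotient of the two sides without \<open>rot\<close> is a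
  product of two Blaschke powers and a quotient of phases, which is how \<open>rot\<close> is
  built.\<close>

lemma phase_rot:
  assumes "cmod z = 1"
  shows "blaschke c z ^ n * phase z
    = rot n z * (blaschke c (inverse z) ^ n * phase (inverse z))"
proof -
  note nz = circle_nonzeros[OF assms]
  have bl: "blaschke (cnj c) z * blaschke c (inverse z) = 1"
    using nz unfolding blaschke_def by (simp add: divide_simps)
  have fac: "z\<^sup>2 + (of_real \<tau>)\<^sup>2 = (z + \<i> * \<tau>) * (z - \<i> * \<tau>)"
    "1 + (of_real \<tau>)\<^sup>2 * z\<^sup>2 = (1 + \<i> * \<tau> * z) * (1 - \<i> * \<tau> * z)"
    by (simp_all add: algebra_simps power2_eq_square)
  note phi = phase_inverse[OF assms]
  have ph: "phase z = (z\<^sup>2 + (of_real \<tau>)\<^sup>2) / (z\<^sup>2 * (1 + (of_real \<tau>)\<^sup>2 * z\<^sup>2)) * phase (inverse z)"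
    unfolding phi fac unfolding phase_def using nz by (simp add: divide_simps power2_eq_square)
  have "rot n z * (blaschke c (inverse z) ^ n * phase (inverse z))
     = blaschke c z ^ n * (blaschke (cnj c) z * blaschke c (inverse z)) ^ n
       * ((z\<^sup>2 + (of_real \<tau>)\<^sup>2) / (z\<^sup>2 * (1 + (of_real \<tau>)\<^sup>2 * z\<^sup>2)) * phase (inverse z))"
    unfolding rot_def by (simp add: power_mult_distrib)
  thus ?thesis unfolding bl ph[symmetric] by simp
qed

text \<open>Each summand is the modulus of \<open>lim_fun\<close> at the respective point. Written
  with \<open>phase\<close>, this partition of unity becomes a rational identity that can be
  integrated by Cauchy's formula.\<close>

lemma phase_lim_fun:
  assumes "cmod z = 1"
  shows "lim_fun z * phase z + lim_fun (inverse z) * phase (inverse z) = 1"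
proof -
  note nz = circle_nonzeros[OF assms]
  have t: "1 + (complex_of_real \<tau>)\<^sup>2 \<noteq> 0"
    using factor_nonzero(3)[of 1] by simp
  note phi = phase_inverse[OF assms]
  have Fi: "lim_fun (inverse z) = (z + \<i> * \<tau>)\<^sup>2 / (z\<^sup>2 * (2 * (1 + (of_real \<tau>)\<^sup>2)))"
    unfolding lim_fun_def using nz by (simp add: field_simps power2_eq_square)
  have cancel: "w\<^sup>2 / (z\<^sup>2 * k) * (z * v / w) = w * v / (z * k)" if "w \<noteq> 0" "z \<noteq> 0" for w z k v :: complex
    using that by (simp add: power2_eq_square)
  have cancel': "w\<^sup>2 / k * (v / (z * w)) = w * v / (z * k)" if "w \<noteq> 0" for w z k v :: complex
    using that by (simp add: power2_eq_square)
  have 1: "lim_fun (inverse z) * phase (inverse z)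
      = (z + \<i> * \<tau>) * (1 - \<i> * \<tau> * z) / (z * (2 * (1 + (of_real \<tau>)\<^sup>2)))"
    unfolding Fi phi by (rule cancel) (use nz in auto)
  have 2: "lim_fun z * phase z = (1 + \<i> * \<tau> * z) * (z - \<i> * \<tau>) / (z * (2 * (1 + (of_real \<tau>)\<^sup>2)))"
    unfolding lim_fun_def phase_def by (rule cancel') (use nz in auto)
  have "(1 + \<i> * \<tau> * z) * (z - \<i> * \<tau>) + (z + \<i> * \<tau>) * (1 - \<i> * \<tau> * z) = z * (2 * (1 + (of_real \<tau>)\<^sup>2))"
    by (simp add: algebra_simps power2_eq_square)
  moreover have "z * (2 * (1 + (complex_of_real \<tau>)\<^sup>2)) \<noteq> 0"
    using nz(4) t mult_eq_0_iff zero_neq_numeral by metis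
  ultimately show ?thesis unfolding 1 2 add_divide_distrib[symmetric] by simp
qed

lemma continuous_circle:
  "continuous_on (sphere 0 1) phase" "continuous_on (sphere 0 1) weight"
  "continuous_on (sphere 0 1) real_weight" "continuous_on (sphere 0 1) (rot n)"
  "cmod a < 1 \<Longrightarrow> continuous_on (sphere 0 1) (test a)"
  unfolding phase_def weight_def real_weight_def rot_def test_def blaschke_def
  by (intro continuous_intros; use circle_nonzeros test_nonzero in force)+

lemma continuous_circle_inverse:
  assumes "continuous_on (sphere 0 1) (g :: complex \<Rightarrow> 'a::topological_space)"
  shows "continuous_on (sphere 0 1) (\<lambda>z. g (inverse z))"
proof (rule continuous_on_compose2[OF assms])
  show "continuous_on (sphere 0 1) (inverse :: complex \<Rightarrow> complex)"
    by (intro continuous_intros) auto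
qed (auto simp: norm_inverse)

text \<open>After cancellation \<open>test a * weight * phase\<close> is \<open>z / (z - a)\<close>
  times a function analytic on the closed disc, so this is Cauchy's formula at
  \<open>a\<close>.\<close>

lemma mean_test:
  assumes f: "f analytic_on cball 0 1" and a: "cmod a < 1"
  shows "circle_mean 1 (\<lambda>z. test a z * weight z * (f z * phase z)) = jac a * f a"
proof -
  have "circle_mean 1 (\<lambda>z. test a z * weight z * (f z * phase z))
      = circle_mean 1 (\<lambda>z. (f z / ((1 - a * z) * (1 + (of_real \<tau>)\<^sup>2 * z\<^sup>2))) * z / (z - a))"
  proof (rule circle_mean_cong)
    fix z :: complex assume z: "cmod z = 1"
    note nz = circle_nonzeros[OF z] test_nonzero[OF a z]
    have fac: "z\<^sup>2 + (of_real \<tau>)\<^sup>2 = (z + \<i> * \<tau>) * (z - \<i> * \<tau>)"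
      by (simp add: algebra_simps power2_eq_square)
    have "test a z * weight z * phase z = z / ((z - a) * (1 - a * z) * (1 + (of_real \<tau>)\<^sup>2 * z\<^sup>2))"
      unfolding test_def weight_def phase_def fac using nz
      by (simp add: divide_simps power2_eq_square)
    thus "test a z * weight z * (f z * phase z)
       = (f z / ((1 - a * z) * (1 + (of_real \<tau>)\<^sup>2 * z\<^sup>2))) * z / (z - a)"
      using nz by (simp add: field_simps)
  qed simp
  also have "\<dots> = f a / ((1 - a * a) * (1 + (of_real \<tau>)\<^sup>2 * a\<^sup>2))"
    using one_minus_mult_nonzero[OF a] factor_nonzero a
    by (intro circle_mean_Cauchy[where f = "\<lambda>z. f z / ((1 - a * z) * (1 + (of_real \<tau>)\<^sup>2 * z\<^sup>2))"]
          analytic_intros f) auto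
  finally show ?thesis by (simp add: jac_def power2_eq_square)
qed

lemma lim_fun_analytic: "lim_fun analytic_on S"
proof -
  have "(\<lambda>z. 2 * (1 + (complex_of_real \<tau>)\<^sup>2)) analytic_on S" by (intro analytic_intros)
  moreover have "1 + (complex_of_real \<tau>)\<^sup>2 \<noteq> 0"
    using factor_nonzero(3)[of 1] by simp
  hence "2 * (1 + (complex_of_real \<tau>)\<^sup>2) \<noteq> 0" by (metis mult_eq_0_iff zero_neq_numeral)
  ultimately show ?thesis
    unfolding lim_fun_def[abs_def] by (intro analytic_intros)
qed

text \<open>Inserting the partition of unity \<open>phase_lim_fun\<close> splits the mean into two
  mirror images, each given by \<open>mean_test\<close> for \<open>lim_fun\<close>; hence the factor
  2.\<close>

lemma mean_test_weight:
  assumes a: "cmod a < 1"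
  shows "circle_mean 1 (\<lambda>z. test a z * weight z) = 2 * jac a * lim_fun a"
proof -
  let ?h = "\<lambda>z. test a z * weight z * (lim_fun z * phase z)"
  have cl: "continuous_on (sphere 0 1) lim_fun"
    using lim_fun_analytic by (simp add: analytic_imp_holomorphic holomorphic_on_imp_continuous_on)
  have ch: "continuous_on (sphere 0 1) ?h"
    using a by (intro continuous_intros continuous_circle cl)
  have "circle_mean 1 (\<lambda>z. test a z * weight z) = circle_mean 1 (\<lambda>z. ?h z + ?h (inverse z))"
  proof (rule circle_mean_cong)
    fix z :: complex assume z: "cmod z = 1"
    have "?h z + ?h (inverse z) = test a z * weight z *
            (lim_fun z * phase z + lim_fun (inverse z) * phase (inverse z))"
      using z a by (simp add: test_inverse weight_inverse algebra_simps)
    thus "test a z * weight z = ?h z + ?h (inverse z)"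
      using phase_lim_fun[OF z] by simp
  qed simp
  also have "\<dots> = circle_mean 1 ?h + circle_mean 1 (\<lambda>z. ?h (inverse z))"
    by (intro circle_mean_add ch continuous_circle_inverse) simp
  also have "circle_mean 1 (\<lambda>z. ?h (inverse z)) = circle_mean 1 ?h"
    by (rule circle_mean_inverse)
  finally show ?thesis using mean_test[OF lim_fun_analytic a] by simp
qed

end

section \<open>Exponentially small moments of \<open>rot\<close>\<close>

lemma bounded_on_circle:
  fixes h :: "complex \<Rightarrow> 'a::real_normed_vector"
  assumes "continuous_on (sphere 0 r) h"
  shows "\<exists>C>0. \<forall>z. cmod z = r \<longrightarrow> norm (h z) \<le> C"
proof -
  have "bounded (h ` sphere 0 r)"
    by (intro compact_imp_bounded compact_continuous_image assms compact_sphere)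
  thus ?thesis unfolding bounded_pos by auto
qed

context disc_data
begin

lemma annulus_nonzero:
  assumes "cmod a < r" "r \<le> cmod z" "cmod z \<le> 1" "0 < r" "cmod a < 1"
  shows "z \<noteq> 0" "z - a \<noteq> 0" "1 - a * z \<noteq> 0" "1 - c * z \<noteq> 0" "1 - cnj c * z \<noteq> 0"
  using assms one_minus_mult_nonzero[of a z] one_minus_mult_nonzero[of c z]
    one_minus_mult_nonzero[of "cnj c" z] c by auto

text \<open>The circle is shrunk to radius \<open>r\<close>. There the two Blaschke factors in
  \<open>rot\<close> have modulus below one, and their \<open>n\<close>-th powers decay
  geometrically while everything else stays bounded.\<close>

lemma mean_test_rot_tendsto_0:
  fixes g :: "nat \<Rightarrow> complex \<Rightarrow> complex"
  assumes a: "cmod a < r" and r: "0 < r" "r < 1" and k: "0 < k"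
    and g: "\<And>n. g n analytic_on {z. r \<le> cmod z \<and> cmod z \<le> 1}"
    and bound: "\<And>n z. cmod z = r \<Longrightarrow> cmod (g n z) \<le> C"
  shows "(\<lambda>n. circle_mean 1 (\<lambda>z. test a z * weight z * (rot n z ^ k * g n z))) \<longlonglongrightarrow> 0"
proof -
  let ?A = "{z. r \<le> cmod z \<and> cmod z \<le> 1}"
  have a1: "cmod a < 1" using a r by simp
  \<comment> \<open>The part of \<open>test * weight * rot ^ k\<close> that does not depend on
    \<open>n\<close>. One of the \<open>k\<close> factors \<open>z^2 + \<tau>^2\<close> of
    \<open>rot ^ k\<close> cancels the one in the denominator of \<open>weight\<close>; this uses
    \<open>0 < k\<close> and leaves only the poles at \<open>0\<close> and \<open>a\<close> in the
    disc, so the annulus only has to avoid these.\<close>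
  define m where "m z = test a z * (z\<^sup>2 * (z\<^sup>2 + (of_real \<tau>)\<^sup>2) ^ (k - 1)
      / (z ^ (2 * k) * (1 + (of_real \<tau>)\<^sup>2 * z\<^sup>2) ^ (k + 1)))" for z :: complex
  define B where "B z = (blaschke c z * blaschke (cnj c) z) ^ k" for z
  note nz = annulus_nonzero[OF a _ _ r(1) a1]
  have m_an: "m analytic_on ?A"
    unfolding m_def[abs_def] test_def using nz factor_nonzero(3)
    by (intro analytic_intros) auto
  have B_an: "B analytic_on ?A"
    unfolding B_def[abs_def] blaschke_def using nz
    by (intro analytic_intros) auto
  have sub: "sphere 0 r \<subseteq> ?A" using r by auto
  have cont: "continuous_on (sphere 0 r) h" if "h analytic_on ?A" for h :: "complex \<Rightarrow> complex"
    using that sub by (meson analytic_on_subset analytic_imp_holomorphic holomorphic_on_imp_continuous_on)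
  have "compact ((\<lambda>z. cmod (B z)) ` sphere 0 r)"
    by (intro compact_continuous_image continuous_intros cont B_an) simp
  moreover have ne: "(of_real r :: complex) \<in> sphere 0 r" using r by simp
  ultimately obtain z0 where z0: "cmod z0 = r" "\<And>z. cmod z = r \<Longrightarrow> cmod (B z) \<le> cmod (B z0)"
    using compact_attains_sup[of "(\<lambda>z. cmod (B z)) ` sphere 0 r"] by fastforce
  define q where "q = cmod (B z0)"
  have q: "0 \<le> q" "q < 1"
  proof -
    have "cmod (blaschke c z0 * blaschke (cnj c) z0) < 1"
      using norm_blaschke_less_1[of c z0] norm_blaschke_less_1[of "cnj c" z0] c z0 r
        norm_mult_less[of "blaschke c z0" 1 "blaschke (cnj c) z0" 1]
      by simp
    thus "q < 1" using k power_strict_mono[of "cmod (blaschke c z0 * blaschke (cnj c) z0)" 1 k]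
      unfolding q_def B_def norm_power by simp
  qed (simp add: q_def)
  from bounded_on_circle[OF cont[OF m_an]]
  obtain Cm where Cm: "0 < Cm" "\<forall>z. cmod z = r \<longrightarrow> cmod (m z) \<le> Cm" by (elim exE conjE)
  have "0 \<le> C" using bound[of "of_real r" 0] r order_trans[OF norm_ge_zero] by simp
  have main: "cmod (circle_mean 1 (\<lambda>z. test a z * weight z * (rot n z ^ k * g n z)))
      \<le> Cm * C * q ^ n" for n
  proof -
    let ?h = "\<lambda>z. m z * (B z ^ n * g n z)"
    have h_an: "?h analytic_on ?A" by (intro analytic_intros m_an B_an g)
    have "circle_mean 1 (\<lambda>z. test a z * weight z * (rot n z ^ k * g n z)) = circle_mean 1 ?h"
    proof (rule circle_mean_cong)
      fix z :: complex assume z: "cmod z = 1"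
      define x y where "x = z\<^sup>2 + (of_real \<tau>)\<^sup>2" and "y = 1 + (of_real \<tau>)\<^sup>2 * z\<^sup>2"
      have xy: "x \<noteq> 0" "y \<noteq> 0" using circle_nonzeros[OF z] by (auto simp: x_def y_def)
      have [simp]: "x ^ k = x * x ^ (k - 1)" using k by (simp add: power_eq_if)
      have swap: "(b ^ n * s) ^ k = (b ^ k) ^ n * s ^ k" for b s :: complex
        by (simp add: power_mult_distrib mult.commute flip: power_mult)
      have "weight z * rot n z ^ k
         = B z ^ n * (z\<^sup>2 / (y * x) * (x / (z\<^sup>2 * y)) ^ k)"
        unfolding weight_def rot_def B_def x_def[symmetric] y_def[symmetric]
        by (simp only: swap mult.left_commute)
      also have "z\<^sup>2 / (y * x) * (x / (z\<^sup>2 * y)) ^ k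
         = z\<^sup>2 * x ^ (k - 1) / (z ^ (2 * k) * y ^ (k + 1))"
        using xy by (simp add: power_divide power_mult_distrib power_mult)
      finally have eq: "weight z * rot n z ^ k
        = B z ^ n * (z\<^sup>2 * x ^ (k - 1) / (z ^ (2 * k) * y ^ (k + 1)))" .
      have "test a z * weight z * (rot n z ^ k * g n z)
        = test a z * (weight z * rot n z ^ k) * g n z" by (simp only: mult_ac)
      thus "test a z * weight z * (rot n z ^ k * g n z) = ?h z"
        unfolding eq m_def x_def[symmetric] y_def[symmetric] by (simp only: mult_ac)
    qed simp
    also have "\<dots> = circle_mean r ?h"
      by (rule circle_mean_shrink[OF h_an]) (use r in auto)
    also have "cmod \<dots> \<le> circle_mean r (\<lambda>z. Cm * C * q ^ n)"
    proof (rule circle_mean_norm_le)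
      fix z :: complex assume z: "cmod z = r"
      have "cmod (?h z) = cmod (m z) * (cmod (B z) ^ n * cmod (g n z))"
        by (simp add: norm_mult norm_power)
      also have "\<dots> \<le> Cm * (q ^ n * C)"
        using Cm z0 z bound q by (intro mult_mono power_mono) (auto simp: q_def)
      finally show "cmod (?h z) \<le> Cm * C * q ^ n" by (simp add: mult_ac)
    qed (use r cont[OF h_an] in auto)
    finally show ?thesis by (simp add: circle_mean_const)
  qed
  have "(\<lambda>n. Cm * C * q ^ n) \<longlonglongrightarrow> 0"
    by (intro tendsto_mult_right_zero LIMSEQ_realpow_zero q)
  show ?thesis
    by (rule Lim_null_comparison[OF _ \<open>(\<lambda>n. Cm * C * q ^ n) \<longlonglongrightarrow> 0\<close>]) (simp add: main)
qed

lemma phase_analytic: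
  assumes "S \<subseteq> cball 0 1 - {0}"
  shows "phase analytic_on S"
  unfolding phase_def[abs_def] using assms factor_nonzero by (intro analytic_intros) auto

end

text \<open>\<open>p n\<close> stands for the polynomial seen as a function of \<open>z\<close>,
  even because \<open>u\<close> is; \<open>f n\<close> is its product with the \<open>n\<close>-th
  power of \<open>b\<close>, with the singularity at infinity removed.\<close>

locale disc_sequence = disc_data +
  fixes f p :: "nat \<Rightarrow> complex \<Rightarrow> complex" and w :: "nat \<Rightarrow> complex"
  assumes f_analytic: "\<And>n. f n analytic_on cball 0 1"
    and p_even: "\<And>n z. cmod z = 1 \<Longrightarrow> p n (inverse z) = p n z"
    and p_bound: "\<And>n z. cmod z = 1 \<Longrightarrow> cmod (p n z) \<le> 1"
    and w: "\<And>n. cmod (w n) = 1"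
    and f_boundary: "\<And>n z. cmod z = 1 \<Longrightarrow> f n z = w n * blaschke c z ^ n * p n z"
begin

text \<open>The function \<open>X\<close> of the introduction, up to the factor
  \<open>w n\<close>-independent normalization already contained in \<open>f n\<close>.\<close>

definition rotated :: "nat \<Rightarrow> complex \<Rightarrow> complex" where
  "rotated n z = f n z * phase z"

lemma f_norm_le: 
  assumes "cmod z \<le> 1"
  shows "cmod (f n z) \<le> 1"
proof (rule maximum_modulus_frontier[where S = "cball 0 1" and f = "f n"])
  have "f n holomorphic_on cball 0 1" using f_analytic analytic_imp_holomorphic by blast
  thus "f n holomorphic_on interior (cball 0 1)" "continuous_on (closure (cball 0 1)) (f n)"
    by (auto intro: holomorphic_on_subset holomorphic_on_imp_continuous_on)
  fix z assume "z \<in> frontier (cball (0::complex) 1)"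
  hence "cmod z = 1" by simp
  thus "cmod (f n z) \<le> 1"
    using p_bound[of z] c norm_blaschke_eq_1[of c z] w
    by (simp add: f_boundary norm_mult norm_power)
qed (use assms in auto)

lemma continuous_rotated: "continuous_on (sphere 0 1) (rotated n)"
proof -
  have "f n holomorphic_on cball 0 1" using f_analytic analytic_imp_holomorphic by blast
  hence "continuous_on (sphere 0 1) (f n)"
    by (meson continuous_on_subset holomorphic_on_imp_continuous_on sphere_cball)
  thus ?thesis unfolding rotated_def by (intro continuous_intros continuous_circle)
qed

lemma norm_rotated: "cmod z = 1 \<Longrightarrow> cmod (rotated n z) \<le> 1"
  using f_norm_le[of z n] by (simp add: rotated_def norm_mult norm_phase)

text \<open>In the quotient of the two boundary values \<open>w n\<close> and, by evenness,
  \<open>p n\<close> cancel; what remains is the same for all admissible polynomials.\<close>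

lemma rotated_rot:
  assumes "cmod z = 1"
  shows "rotated n z = rot n z * rotated n (inverse z)"
  using phase_rot[OF assms, of n] assms
  by (simp add: rotated_def f_boundary norm_inverse p_even mult_ac)

lemma rotated_inverse:
  assumes "cmod z = 1"
  shows "rotated n (inverse z) = cnj (rot n z) * rotated n z"
proof -
  have "cnj (rot n z) * rot n z = 1"
    using complex_norm_square[of "rot n z"] norm_rot[OF assms, of n] by (simp add: mult.commute)
  thus ?thesis unfolding rotated_rot[OF assms, of n] mult.assoc[symmetric] by simp
qed

lemma mean_rotated_rot_tendsto_0:
  assumes a: "cmod a < 1" and k: "0 < k"
  shows "(\<lambda>n. circle_mean 1 (\<lambda>z. test a z * weight z * (rot n z ^ k * rotated n z))) \<longlonglongrightarrow> 0"
proof -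
  define r where "r = (1 + cmod a) / 2"
  have r: "cmod a < r" "0 < r" "r < 1" using a by (auto simp: r_def add_pos_nonneg)
  have an: "phase analytic_on {z. r \<le> cmod z \<and> cmod z \<le> 1}"
    by (rule phase_analytic) (use r in auto)
  have "continuous_on (sphere 0 r) phase"
    using r an by (intro holomorphic_on_imp_continuous_on analytic_imp_holomorphic)
       (auto elim: analytic_on_subset)
  from bounded_on_circle[OF this]
  obtain C where C: "\<forall>z. cmod z = r \<longrightarrow> cmod (phase z) \<le> C" by (elim exE conjE)
  show ?thesis
  proof (rule mean_test_rot_tendsto_0[OF r k])
    show "rotated n analytic_on {z. r \<le> cmod z \<and> cmod z \<le> 1}" for n
      unfolding rotated_def[abs_def]
      by (intro analytic_intros an analytic_on_subset[OF f_analytic]) auto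
    show "cmod (rotated n z) \<le> C" if "cmod z = r" for n z
      using f_norm_le[of z n] C that r mult_mono[of "cmod (f n z)" 1 "cmod (phase z)" C]
      by (simp add: rotated_def norm_mult)
  qed
qed

end

section \<open>The Fejer kernel in \<open>rot\<close>\<close>

lemma unimodular_power_cnj:
  assumes "cmod x = 1"
  shows "l \<le> j \<Longrightarrow> x ^ j * cnj x ^ l = x ^ (j - l)"
    and "j \<le> l \<Longrightarrow> x ^ j * cnj x ^ l = cnj x ^ (l - j)"
proof -
  have xx: "x * cnj x = 1" using assms complex_norm_square[of x] by simp
  have 1: "x ^ m * cnj x ^ m = 1" for m
    using xx by (simp flip: power_mult_distrib)
  show "x ^ j * cnj x ^ l = x ^ (j - l)" if "l \<le> j"
  proof -
    have "x ^ j = x ^ (j - l) * x ^ l" using that by (simp flip: power_add)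
    thus ?thesis by (simp only: mult.assoc 1 mult_1_right)
  qed
  show "x ^ j * cnj x ^ l = cnj x ^ (l - j)" if "j \<le> l"
  proof -
    have "cnj x ^ l = cnj x ^ j * cnj x ^ (l - j)" using that by (simp flip: power_add)
    thus ?thesis by (simp only: mult.assoc[symmetric] 1 mult_1_left)
  qed
qed

text \<open>The main diagonal of the square has \<open>N\<close> entries, the adjacent one
  \<open>N - 1\<close>.\<close>

lemma sum_two_diagonals:
  fixes x :: "'a::comm_ring_1"
  assumes "0 < N"
  shows "(\<Sum>j<N. \<Sum>l<N. if l = j \<or> l = Suc j then x else 0) = (2 * of_nat N - 1) * x"
proof -
  have "(\<Sum>j<N. \<Sum>l<N. if l = j \<or> l = Suc j then x else 0)
      = (\<Sum>j<N. x + (if Suc j < N then x else 0))"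
  proof (rule sum.cong[OF refl])
    fix j assume j: "j \<in> {..<N}"
    have "(\<Sum>l<N. if l = j \<or> l = Suc j then x else 0)
        = (\<Sum>l<N. (if l = j then x else 0) + (if l = Suc j then x else 0))"
      by (rule sum.cong) auto
    thus "(\<Sum>l<N. if l = j \<or> l = Suc j then x else 0) = x + (if Suc j < N then x else 0)"
      using j by (simp add: sum.distrib)
  qed
  also have "\<dots> = of_nat N * x + (\<Sum>j<N. if Suc j < N then x else 0)"
    by (simp add: sum.distrib)
  also have "(\<Sum>j<N. if Suc j < N then x else 0) = (of_nat N - 1) * x"
  proof -
    obtain M where N: "N = Suc M" using assms gr0_implies_Suc by blast
    have "(\<Sum>j<Suc M. if Suc j < Suc M then x else 0) = (\<Sum>j<M. x)" by simp
    thus ?thesis unfolding N by simp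
  qed
  finally show ?thesis by (simp add: algebra_simps)
qed

context disc_data
begin

text \<open>\<open>N\<close> times the Fejer kernel in \<open>\<eta>\<close>.\<close>

definition kern :: "nat \<Rightarrow> nat \<Rightarrow> complex \<Rightarrow> real" where
  "kern N n z = (cmod (\<Sum>j<N. rot n z ^ j))\<^sup>2"

lemma kern_nonneg: "0 \<le> kern N n z"
  by (simp add: kern_def)

lemma of_real_kern:
  "of_real (kern N n z) = (\<Sum>j<N. \<Sum>l<N. rot n z ^ j * cnj (rot n z) ^ l)"
  unfolding kern_def complex_norm_square cnj_sum complex_cnj_power sum_product ..

lemma kern_inverse:
  assumes "cmod z = 1"
  shows "kern N n (inverse z) = kern N n z"
proof -
  have "(\<Sum>j<N. rot n (inverse z) ^ j) = cnj (\<Sum>j<N. rot n z ^ j)"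
    by (simp add: rot_inverse[OF assms])
  thus ?thesis by (simp add: kern_def del: cnj_sum)
qed

lemma continuous_kern: "continuous_on (sphere 0 1) (kern N n)"
  unfolding kern_def by (intro continuous_intros continuous_circle)

text \<open>Expanding the square gives moments of \<open>rot\<close> of order \<open>j - l\<close>,
  negative orders being reflected to positive ones. Only the \<open>N\<close> diagonal terms survive
  in the limit, each with the value from \<open>mean_test_weight\<close>.\<close>

lemma mean_test_kern_tendsto:
  assumes a: "cmod a < 1"
  shows "(\<lambda>n. circle_mean 1 (\<lambda>z. test a z * weight z * kern N n z))
    \<longlonglongrightarrow> 2 * of_nat N * jac a * lim_fun a"
proof -
  define G where "G d = (\<lambda>n. circle_mean 1 (\<lambda>z. test a z * weight z * (rot n z ^ d * 1)))" for d
  have G0: "G 0 n = 2 * jac a * lim_fun a" for n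
    using mean_test_weight[OF a] by (simp add: G_def)
  have G: "G d \<longlonglongrightarrow> 0" if "0 < d" for d
  proof -
    have "cmod a < (1 + cmod a) / 2" "0 < (1 + cmod a) / 2" "(1 + cmod a) / 2 < 1"
      using a by (auto simp: add_pos_nonneg)
    thus ?thesis unfolding G_def using that
      by (rule mean_test_rot_tendsto_0[where C = 1]) auto
  qed
  have mom: "circle_mean 1 (\<lambda>z. test a z * weight z * (rot n z ^ j * cnj (rot n z) ^ l))
      = G (if l \<le> j then j - l else l - j) n" for j l n
  proof (cases "l \<le> j")
    case True
    thus ?thesis unfolding G_def
      by (intro circle_mean_cong) (simp_all add: unimodular_power_cnj norm_rot)
  next
    case False
    let ?h = "\<lambda>z. test a z * weight z * (rot n z ^ (l - j) * 1)"
    have "circle_mean 1 (\<lambda>z. test a z * weight z * (rot n z ^ j * cnj (rot n z) ^ l))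
        = circle_mean 1 (\<lambda>z. ?h (inverse z))"
      using False a
      by (intro circle_mean_cong)
         (simp_all add: unimodular_power_cnj norm_rot rot_inverse test_inverse weight_inverse)
    also have "\<dots> = circle_mean 1 ?h" by (rule circle_mean_inverse)
    finally show ?thesis using False by (simp add: G_def)
  qed
  have "circle_mean 1 (\<lambda>z. test a z * weight z * kern N n z)
     = (\<Sum>j<N. \<Sum>l<N. G (if l \<le> j then j - l else l - j) n)" for n
  proof -
    have "circle_mean 1 (\<lambda>z. test a z * weight z * kern N n z)
      = circle_mean 1 (\<lambda>z. \<Sum>j<N. \<Sum>l<N. test a z * weight z * (rot n z ^ j * cnj (rot n z) ^ l))"
      by (simp add: of_real_kern sum_distrib_left)
    also have "\<dots> = (\<Sum>j<N. \<Sum>l<N. circle_mean 1 (\<lambda>z. test a z * weight z * (rot n z ^ j * cnj (rot n z) ^ l)))"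
      using a by (subst circle_mean_sum) (auto intro!: sum.cong circle_mean_sum continuous_intros continuous_circle)
    finally show ?thesis unfolding mom .
  qed
  moreover have "(\<lambda>n. \<Sum>j<N. \<Sum>l<N. G (if l \<le> j then j - l else l - j) n)
     \<longlonglongrightarrow> (\<Sum>j<N. \<Sum>l<N. if l = j then 2 * jac a * lim_fun a else 0)"
  proof (intro tendsto_sum)
    fix j l :: nat
    show "(\<lambda>n. G (if l \<le> j then j - l else l - j) n)
      \<longlonglongrightarrow> (if l = j then 2 * jac a * lim_fun a else 0)"
      using G[of "j - l"] G[of "l - j"] by (cases l j rule: linorder_cases) (auto simp: G0)
  qed
  moreover have "(\<Sum>j<N. \<Sum>l<N. if l = j then 2 * jac a * lim_fun a else 0)
      = 2 * of_nat N * jac a * lim_fun a"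
    by simp
  ultimately show ?thesis by (simp add: mult_ac)
qed

end

context disc_sequence
begin

text \<open>As \<open>X cnj \<eta>\<close> is the reflection of \<open>X\<close>, the diagonals \<open>l = j\<close> and \<open>l = j + 1\<close> of the kernel both
  contribute \<open>f n a\<close>, whence the factor \<open>2N - 1\<close> against \<open>2N\<close> in \<open>mean_test_kern_tendsto\<close>.\<close>

lemma mean_test_kern_rotated:
  assumes a: "cmod a < 1" and N: "0 < N"
  shows "(\<lambda>n. circle_mean 1 (\<lambda>z. test a z * weight z * (kern N n z * rotated n z))
    - (2 * of_nat N - 1) * (jac a * f n a)) \<longlonglongrightarrow> 0"
proof -
  define G where "G d = (\<lambda>n. circle_mean 1 (\<lambda>z. test a z * weight z * (rot n z ^ d * rotated n z)))" for d
  have G0: "G 0 n = jac a * f n a" for n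
    using mean_test[OF f_analytic a] by (simp add: G_def rotated_def)
  have G: "G d \<longlonglongrightarrow> 0" if "0 < d" for d
    using mean_rotated_rot_tendsto_0[OF a that] by (simp add: G_def)
  \<comment> \<open>For negative order the reflection also acts on \<open>rotated\<close>, which
    absorbs one factor \<open>cnj (rot n z)\<close>; hence \<open>l - Suc j\<close> in place of
    \<open>l - j\<close>.\<close>
  have mom: "circle_mean 1 (\<lambda>z. test a z * weight z * (rot n z ^ j * cnj (rot n z) ^ l * rotated n z))
      = G (if l \<le> j then j - l else l - Suc j) n" for j l n
  proof (cases "l \<le> j")
    case True
    thus ?thesis unfolding G_def
      by (intro circle_mean_cong) (simp_all add: unimodular_power_cnj norm_rot)
  next
    case False
    let ?h = "\<lambda>z. test a z * weight z * (rot n z ^ (l - Suc j) * rotated n z)"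
    have "circle_mean 1 (\<lambda>z. test a z * weight z * (rot n z ^ j * cnj (rot n z) ^ l * rotated n z))
        = circle_mean 1 (\<lambda>z. ?h (inverse z))"
    proof (rule circle_mean_cong)
      fix z :: complex assume z: "cmod z = 1"
      have "l - j = Suc (l - Suc j)" using False by simp
      hence "rot n z ^ j * cnj (rot n z) ^ l = cnj (rot n z) ^ (l - Suc j) * cnj (rot n z)"
        using False unimodular_power_cnj(2)[OF norm_rot[OF z], of j l n] by simp
      thus "test a z * weight z * (rot n z ^ j * cnj (rot n z) ^ l * rotated n z) = ?h (inverse z)"
        using z a by (simp add: rot_inverse rotated_inverse test_inverse weight_inverse)
    qed simp
    also have "\<dots> = circle_mean 1 ?h" by (rule circle_mean_inverse)
    finally show ?thesis using False by (simp add: G_def)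
  qed
  have eq: "circle_mean 1 (\<lambda>z. test a z * weight z * (kern N n z * rotated n z))
      - (2 * of_nat N - 1) * (jac a * f n a)
     = (\<Sum>j<N. \<Sum>l<N. G (if l \<le> j then j - l else l - Suc j) n
          - (if l = j \<or> l = Suc j then jac a * f n a else 0))" for n
  proof -
    have "circle_mean 1 (\<lambda>z. test a z * weight z * (kern N n z * rotated n z))
      = circle_mean 1 (\<lambda>z. \<Sum>j<N. \<Sum>l<N. test a z * weight z * (rot n z ^ j * cnj (rot n z) ^ l * rotated n z))"
      by (simp add: of_real_kern sum_distrib_left sum_distrib_right)
    also have "\<dots> = (\<Sum>j<N. \<Sum>l<N. circle_mean 1 (\<lambda>z. test a z * weight z * (rot n z ^ j * cnj (rot n z) ^ l * rotated n z)))"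
      using a by (subst circle_mean_sum)
        (auto intro!: sum.cong circle_mean_sum continuous_intros continuous_circle continuous_rotated)
    also have "\<dots> = (\<Sum>j<N. \<Sum>l<N. G (if l \<le> j then j - l else l - Suc j) n)"
      unfolding mom ..
    finally show ?thesis
      unfolding sum_subtractf sum_two_diagonals[OF N] by (rule arg_cong2[where f = "(-)"]) (rule refl)
  qed
  have "(\<lambda>n. \<Sum>j<N. \<Sum>l<N. G (if l \<le> j then j - l else l - Suc j) n
          - (if l = j \<or> l = Suc j then jac a * f n a else 0)) \<longlonglongrightarrow> (\<Sum>j<N. \<Sum>l<N. 0)"
  proof (intro tendsto_sum)
    fix j l :: nat
    consider "l < j" | "l = j" | "l = Suc j" | "Suc j < l" by linarith
    thus "(\<lambda>n. G (if l \<le> j then j - l else l - Suc j) n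
          - (if l = j \<or> l = Suc j then jac a * f n a else 0)) \<longlonglongrightarrow> 0"
      using G[of "j - l"] G[of "l - Suc j"] by cases (auto simp: G0)
  qed
  thus ?thesis unfolding eq by simp
qed

end

text \<open>\<open>|1 - q|^2 \<le> 2 (1 - Re q)\<close> in the unit disc, made linear in
  \<open>Re q\<close> by the inequality of the means with parameter \<open>d\<close>. In this form
  it can be integrated, and a small mean of \<open>1 - Re q\<close> controls the mean of
  \<open>|1 - q|\<close>.\<close>

lemma norm_one_minus_le:
  assumes "cmod q \<le> 1" "0 < d"
  shows "cmod (1 - q) \<le> d / 2 + (1 - Re q) / d"
proof -
  have "(cmod q)\<^sup>2 \<le> 1" using assms by (simp add: power_le_one)
  hence "(cmod (1 - q))\<^sup>2 \<le> 2 * (1 - Re q)"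
    unfolding cmod_power2 by (simp add: power2_eq_square algebra_simps)
  moreover have "2 * cmod (1 - q) * d \<le> d\<^sup>2 + (cmod (1 - q))\<^sup>2"
    using sum_squares_bound[of d "cmod (1 - q)"] by (simp add: mult_ac)
  ultimately have "2 * cmod (1 - q) * d \<le> d\<^sup>2 + 2 * (1 - Re q)" by linarith
  hence "cmod (1 - q) \<le> (d\<^sup>2 + 2 * (1 - Re q)) / (2 * d)"
    using assms by (simp add: field_simps)
  also have "\<dots> = d / 2 + (1 - Re q) / d"
    using assms by (simp add: field_simps power2_eq_square)
  finally show ?thesis .
qed

section \<open>Convergence from near extremality\<close>

context disc_data
begin

text \<open>The pole of \<open>weight * phase\<close>, in the application the coordinate of
  \<open>u0\<close>. The pole of the Green's function sits at \<open>c\<close> instead.\<close>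

definition pole :: complex where "pole = - (\<i> * \<tau>)"

lemma norm_pole: "cmod pole < 1"
  using norm_i_tau unfolding pole_def by simp

lemma tau_sq: "0 \<le> \<tau>\<^sup>2" "\<tau>\<^sup>2 < 1"
  using tau abs_square_less_1[of \<tau>] by auto

lemma lim_fun_pole: "lim_fun pole = of_real ((1 + \<tau>\<^sup>2) / 2)"
proof -
  have nz: "1 + (complex_of_real \<tau>)\<^sup>2 \<noteq> 0"
    using factor_nonzero(3)[of 1] by simp
  have eq: "1 + \<i> * \<tau> * pole = 1 + (complex_of_real \<tau>)\<^sup>2"
    by (simp add: pole_def power2_eq_square algebra_simps)
  have "x\<^sup>2 / (2 * x) = x / 2" if "x \<noteq> 0" for x :: complex
    using that by (simp add: power2_eq_square)
  hence "lim_fun pole = (1 + (complex_of_real \<tau>)\<^sup>2) / 2"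
    unfolding lim_fun_def eq using nz by blast
  thus ?thesis by simp
qed

lemma jac_pole: "\<exists>j>0. jac pole = of_real j"
proof (intro exI conjI)
  have "\<tau>\<^sup>2 * \<tau>\<^sup>2 < 1" using tau_sq by (metis mult_less_cancel_left2 mult_eq_0_iff order_le_less
     less_trans mult_1_right mult_strict_mono zero_less_one)
  thus "0 < 1 / ((1 + \<tau>\<^sup>2) * (1 - \<tau>\<^sup>2 * \<tau>\<^sup>2))" using tau_sq by (simp add: add_pos_nonneg)
  show "jac pole = of_real (1 / ((1 + \<tau>\<^sup>2) * (1 - \<tau>\<^sup>2 * \<tau>\<^sup>2)))"
    by (simp add: jac_def pole_def power_mult_distrib)
qed

lemma jac_nonzero: "cmod a < 1 \<Longrightarrow> jac a \<noteq> 0"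
  using one_minus_square_nonzero[of a] factor_nonzero(3)[of a] by (simp add: jac_def)

end

context disc_sequence
begin

text \<open>It stands in for \<open>rotated\<close> in all means against the kernel, since
  \<open>test\<close>, \<open>weight\<close> and \<open>kern\<close> are even.\<close>

definition even_part :: "nat \<Rightarrow> complex \<Rightarrow> complex" where
  "even_part n z = (rotated n z + rotated n (inverse z)) / 2"

lemma continuous_even_part: "continuous_on (sphere 0 1) (even_part n)"
  unfolding even_part_def
  by (intro continuous_intros continuous_rotated continuous_circle_inverse) auto

lemma norm_even_part: 
  assumes "cmod z = 1"
  shows "cmod (even_part n z) \<le> 1"
  using norm_rotated[OF assms, of n] norm_rotated[of "inverse z" n] assms
    norm_triangle_ineq[of "rotated n z" "rotated n (inverse z)"]
  by (simp add: even_part_def norm_divide norm_inverse)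

lemmas cont_intros = continuous_intros continuous_circle continuous_kern continuous_rotated
  continuous_even_part continuous_circle_inverse

lemma mean_kern_even_part:
  assumes a: "cmod a < 1"
  shows "circle_mean 1 (\<lambda>z. test a z * weight z * (kern N n z * even_part n z))
       = circle_mean 1 (\<lambda>z. test a z * weight z * (kern N n z * rotated n z))"
proof -
  let ?h = "\<lambda>z. test a z * weight z * (kern N n z * rotated n z)"
  have "circle_mean 1 (\<lambda>z. test a z * weight z * (kern N n z * even_part n z))
     = circle_mean 1 (\<lambda>z. 1 / 2 * ?h z + 1 / 2 * ?h (inverse z))"
    using a by (intro circle_mean_cong)
      (auto simp: test_inverse weight_inverse kern_inverse even_part_def add_divide_distrib distrib_left)
  also have "\<dots> = circle_mean 1 (\<lambda>z. 1 / 2 * ?h z) + circle_mean 1 (\<lambda>z. 1 / 2 * ?h (inverse z))"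
    using a by (intro circle_mean_add cont_intros) auto
  also have "\<dots> = circle_mean 1 ?h"
    unfolding circle_mean_cmult using circle_mean_inverse[of ?h] by simp
  finally show ?thesis .
qed

text \<open>At \<open>pole\<close>, where \<open>test\<close> is \<open>1\<close>, the measure
  \<open>weight * kern\<close> has mass of order \<open>N\<close>, but the mean of
  \<open>1 - Re (even_part n z)\<close> against it is asymptotically at most a constant independent
  of \<open>N\<close>. By \<open>norm_one_minus_le\<close> the same comparison with
  \<open>test a\<close> costs at most order \<open>sqrt N\<close>, while its main term is
  \<open>2 N jac a (f n a - lim_fun a)\<close>. So the upper limit of the error is of order
  \<open>1 / sqrt N\<close> for every \<open>N\<close>.\<close>

theorem tendsto_lim_fun:
  assumes r: "\<And>n. f n pole = of_real (r n)"
    and e: "e \<longlonglongrightarrow> 0" and low: "\<And>n. (1 + \<tau>\<^sup>2) / 2 - e n \<le> r n"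
    and a: "cmod a < 1"
  shows "(\<lambda>n. f n a) \<longlonglongrightarrow> lim_fun a"
proof -
  define M where "M = (1 + \<tau>\<^sup>2) / 2"
  obtain j where j: "0 < j" "jac pole = of_real j" using jac_pole by blast
  \<comment> \<open>\<open>A\<close> is the kernel mean of \<open>rotated\<close>, \<open>D\<close>
    the one it would have if \<open>rotated\<close> were replaced by \<open>1\<close>.\<close>
  define A D where "A b N n = circle_mean 1 (\<lambda>z. test b z * weight z * (kern N n z * rotated n z))"
    and "D b N n = circle_mean 1 (\<lambda>z. test b z * weight z * kern N n z)" for b N n
  have test_pole': "test pole z = 1" if "cmod z = 1" for z
    using test_pole[OF that] unfolding pole_def .
  from bounded_on_circle[OF continuous_circle(5)[OF a]] obtain Ct
    where Ct: "0 < Ct" "\<forall>z. cmod z = 1 \<longrightarrow> cmod (test a z) \<le> Ct" by blast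
  have DA: "D b N n - A b N n
      = circle_mean 1 (\<lambda>z. test b z * weight z * (kern N n z * (1 - even_part n z)))"
    if b: "cmod b < 1" for b N n
  proof -
    have "D b N n - A b N n = circle_mean 1 (\<lambda>z. test b z * weight z * kern N n z
       - test b z * weight z * (kern N n z * even_part n z))"
      unfolding A_def D_def mean_kern_even_part[OF b, symmetric]
      using b by (intro circle_mean_diff[symmetric] cont_intros) auto
    thus ?thesis by (simp add: algebra_simps)
  qed
  have ReDA: "Re (D pole N n - A pole N n)
      = circle_mean 1 (\<lambda>z. real_weight z * kern N n z * (1 - Re (even_part n z)))" for N n
  proof -
    have "Re (D pole N n - A pole N n)
       = circle_mean 1 (\<lambda>z. Re (test pole z * weight z * (kern N n z * (1 - even_part n z))))"
      unfolding DA[OF norm_pole] using norm_pole by (intro Re_circle_mean cont_intros) auto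
    also have "\<dots> = circle_mean 1 (\<lambda>z. real_weight z * kern N n z * (1 - Re (even_part n z)))"
      by (intro circle_mean_cong) (simp_all add: test_pole' weight_eq mult_ac)
    finally show ?thesis .
  qed
  have ReD: "Re (D pole N n) = circle_mean 1 (\<lambda>z. real_weight z * kern N n z)" for N n
  proof -
    have "Re (D pole N n) = circle_mean 1 (\<lambda>z. Re (test pole z * weight z * kern N n z))"
      unfolding D_def using norm_pole by (intro Re_circle_mean cont_intros) auto
    also have "\<dots> = circle_mean 1 (\<lambda>z. real_weight z * kern N n z)"
      by (intro circle_mean_cong) (simp_all add: test_pole' weight_eq mult_ac)
    finally show ?thesis .
  qed
  have bound: "cmod (D a N n - A a N n)
      \<le> Ct * (d / 2 * Re (D pole N n) + 1 / d * Re (D pole N n - A pole N n))"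
    if d: "0 < d" for d N n
  proof -
    have "cmod (D a N n - A a N n) \<le> circle_mean 1 (\<lambda>z.
        Ct * (d / 2 * (real_weight z * kern N n z)
          + 1 / d * (real_weight z * kern N n z * (1 - Re (even_part n z)))))"
      unfolding DA[OF a]
    proof (rule circle_mean_norm_le)
      fix z :: complex assume z: "cmod z = 1"
      have "cmod (test a z * weight z * (kern N n z * (1 - even_part n z)))
         = cmod (test a z) * (real_weight z * kern N n z * cmod (1 - even_part n z))"
        using real_weight_pos[OF z] kern_nonneg[of N n z]
        by (simp add: norm_mult weight_eq[OF z] del: of_real_mult)
      also have "\<dots> \<le> Ct * (real_weight z * kern N n z * (d / 2 + (1 - Re (even_part n z)) / d))"
        using Ct z real_weight_pos[OF z] kern_nonneg[of N n z] norm_even_part[OF z, of n] d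
        by (intro mult_mono norm_one_minus_le mult_nonneg_nonneg) auto
      also have "\<dots> = Ct * (d / 2 * (real_weight z * kern N n z)
          + 1 / d * (real_weight z * kern N n z * (1 - Re (even_part n z))))"
        by (simp add: algebra_simps diff_divide_distrib)
      finally show "cmod (test a z * weight z * (kern N n z * (1 - even_part n z)))
        \<le> Ct * (d / 2 * (real_weight z * kern N n z)
          + 1 / d * (real_weight z * kern N n z * (1 - Re (even_part n z))))" .
    qed (use a d in \<open>auto intro!: cont_intros\<close>)
    also have "\<dots> = Ct * (d / 2 * Re (D pole N n) + 1 / d * Re (D pole N n - A pole N n))"
    proof -
      have "circle_mean 1 (\<lambda>z. d / 2 * (real_weight z * kern N n z)
          + 1 / d * (real_weight z * kern N n z * (1 - Re (even_part n z))))
        = circle_mean 1 (\<lambda>z. d / 2 * (real_weight z * kern N n z))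
          + circle_mean 1 (\<lambda>z. 1 / d * (real_weight z * kern N n z * (1 - Re (even_part n z))))"
        using d by (intro circle_mean_add cont_intros) auto
      thus ?thesis unfolding ReD ReDA by (simp only: circle_mean_cmult)
    qed
    finally show ?thesis .
  qed
  define T where "T b N n = A b N n - (2 * of_nat N - 1) * (jac b * f n b)" for b N n
  have T: "(\<lambda>n. T b N n) \<longlonglongrightarrow> 0" if "cmod b < 1" "0 < N" for b N
    unfolding T_def A_def by (rule mean_test_kern_rotated[OF that])
  have D: "(\<lambda>n. D b N n) \<longlonglongrightarrow> 2 * of_nat N * jac b * lim_fun b" if "cmod b < 1" for b N
    unfolding D_def by (rule mean_test_kern_tendsto[OF that])
  \<comment> \<open>Near extremality enters here: a large value at \<open>pole\<close> forces a
    large mean of \<open>rotated\<close>.\<close>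
  have ReA: "Re (T pole N n) + (2 * real N - 1) * j * (M - e n) \<le> Re (A pole N n)"
    if "0 < N" for N n
  proof -
    have "Re (A pole N n) = Re (T pole N n + (2 * of_nat N - 1) * (jac pole * f n pole))"
      by (simp add: T_def)
    also have "(2 * of_nat N - 1) * (jac pole * f n pole)
        = complex_of_real ((2 * real N - 1) * j * r n)"
      by (simp add: j r)
    also have "Re (T pole N n + complex_of_real ((2 * real N - 1) * j * r n))
        = Re (T pole N n) + (2 * real N - 1) * j * r n" by simp
    finally have "Re (A pole N n) = Re (T pole N n) + (2 * real N - 1) * j * r n" .
    moreover have "(2 * real N - 1) * j * (M - e n) \<le> (2 * real N - 1) * j * r n"
      using low[of n] j that unfolding M_def by (intro mult_left_mono) auto
    ultimately show ?thesis by simp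
  qed
  define K where "K = cmod (jac a)"
  have K: "0 < K" using jac_nonzero[OF a] by (simp add: K_def)
  \<comment> \<open>Both terms of \<open>norm_one_minus_le\<close> contribute
    \<open>Ct * j * M * sqrt N\<close> in the limit.\<close>
  define C where "C = 2 * Ct * j * M"
  \<comment> \<open>This is \<open>bound\<close> for \<open>d = 1 / sqrt N\<close>, which balances
    \<open>d / 2\<close> times the mass \<open>2 N j M\<close> against \<open>1 / d\<close> times
    the defect \<open>j M\<close>, together with two errors that vanish as \<open>n\<close>
    grows.\<close>
  define h where "h N n = Ct * (inverse (sqrt N) / 2 * Re (D pole N n)
        + sqrt N * (Re (D pole N n) - (Re (T pole N n) + (2 * real N - 1) * j * (M - e n))))
      + cmod (T a N n) + cmod (D a N n - 2 * of_nat N * jac a * lim_fun a)" for N n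
  have h_lim: "(\<lambda>n. h N n) \<longlonglongrightarrow> C * sqrt N" if N: "0 < N" for N
  proof -
    have "Re (2 * of_nat N * jac pole * lim_fun pole) = 2 * N * j * M"
      unfolding j lim_fun_pole M_def by simp
    hence rd: "(\<lambda>n. Re (D pole N n)) \<longlonglongrightarrow> 2 * N * j * M"
      using tendsto_Re[OF D[OF norm_pole, of N]] by simp
    have rt: "(\<lambda>n. Re (T pole N n)) \<longlonglongrightarrow> 0"
      using tendsto_Re[OF T[OF norm_pole N]] by simp
    have "(\<lambda>n. h N n) \<longlonglongrightarrow> Ct * (inverse (sqrt N) / 2 * (2 * N * j * M)
        + sqrt N * (2 * N * j * M - (0 + (2 * real N - 1) * j * (M - 0))))
      + cmod 0 + cmod (2 * of_nat N * jac a * lim_fun a - 2 * of_nat N * jac a * lim_fun a)"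
      unfolding h_def by (intro tendsto_intros rd rt e T[OF a N] D[OF a]) 
    also have "inverse (sqrt N) / 2 * (2 * N * j * M) = sqrt N * (j * M)"
      using N by (simp add: field_simps)
    also have "2 * N * j * M - (0 + (2 * real N - 1) * j * (M - 0)) = j * M"
      by (simp add: algebra_simps)
    finally show ?thesis by (simp add: C_def algebra_simps)
  qed
  have main: "cmod (f n a - lim_fun a) \<le> (h N n + K) / (2 * N * K)" if N: "0 < N" for N n
  proof -
    have "0 < sqrt N" using N by simp
    have "cmod (D a N n - A a N n)
       \<le> Ct * (inverse (sqrt N) / 2 * Re (D pole N n) + sqrt N * (Re (D pole N n) - Re (A pole N n)))"
      using bound[of "inverse (sqrt N)" N n] N by (simp add: inverse_eq_divide)
    also have "\<dots> \<le> Ct * (inverse (sqrt N) / 2 * Re (D pole N n)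
        + sqrt N * (Re (D pole N n) - (Re (T pole N n) + (2 * real N - 1) * j * (M - e n))))"
      using Ct ReA[OF N, of n] by (intro mult_left_mono add_left_mono) auto
    finally have 1: "cmod (D a N n - A a N n) + cmod (T a N n)
        + cmod (D a N n - 2 * of_nat N * jac a * lim_fun a) \<le> h N n"
      unfolding h_def by simp
    \<comment> \<open>The lone \<open>jac a * f n a\<close> makes up the difference between
      \<open>2 N\<close> and \<open>2 N - 1\<close> diagonal terms; it is bounded by
      \<open>K\<close>.\<close>
    have "2 * of_nat N * jac a * (f n a - lim_fun a)
        = jac a * f n a - (D a N n - A a N n) - T a N n
          + (D a N n - 2 * of_nat N * jac a * lim_fun a)"
      unfolding T_def by (simp add: algebra_simps)
    hence "cmod (2 * of_nat N * jac a * (f n a - lim_fun a))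
       \<le> cmod (jac a * f n a) + cmod (D a N n - A a N n) + cmod (T a N n)
          + cmod (D a N n - 2 * of_nat N * jac a * lim_fun a)"
      by (simp only:) (intro order_trans[OF norm_triangle_ineq] order_trans[OF norm_triangle_ineq4]
          add_mono order_refl)
    also have "\<dots> \<le> h N n + K"
    proof -
      have "cmod (jac a * f n a) \<le> K"
        using f_norm_le[of a n] a by (simp add: norm_mult K_def mult_left_le)
      thus ?thesis using 1 by linarith
    qed
    finally have "2 * N * K * cmod (f n a - lim_fun a) \<le> h N n + K"
      by (simp add: norm_mult K_def)
    thus ?thesis using N K by (simp add: pos_le_divide_eq mult.commute)
  qed
  have bnd: "(C * sqrt N + K) / (2 * N * K)
      = C / (2 * K) * inverse (sqrt N) + 1 / 2 * inverse N" if "0 < N" for N :: nat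
  proof -
    have "real N = sqrt N * sqrt N" by simp
    thus ?thesis using K that by (simp add: field_simps)
  qed
  have "(\<lambda>N. C / (2 * K) * inverse (sqrt (real N)) + 1 / 2 * inverse (real N))
     \<longlonglongrightarrow> C / (2 * K) * 0 + 1 / 2 * 0"
    by (intro tendsto_intros tendsto_inverse_0_at_top filterlim_real_sequentially
        filterlim_compose[OF sqrt_at_top filterlim_real_sequentially])
  hence small: "(\<lambda>N. C / (2 * K) * inverse (sqrt (real N)) + 1 / 2 * inverse (real N))
     \<longlonglongrightarrow> 0" by simp
  show ?thesis
  proof (rule LIMSEQ_I)
    fix \<epsilon> :: real assume "0 < \<epsilon>"
    \<comment> \<open>\<open>N\<close> is fixed before \<open>n\<close>, because the convergence of
      \<open>h N n\<close> is known for each \<open>N\<close> separately.\<close>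
    have "eventually (\<lambda>N. 0 < N \<and>
        C / (2 * K) * inverse (sqrt (real N)) + 1 / 2 * inverse (real N) < \<epsilon>) sequentially"
      by (intro eventually_conj eventually_gt_at_top order_tendstoD(2)[OF small \<open>0 < \<epsilon>\<close>])
    from eventually_happens[OF this] obtain N where N: "0 < N"
      "C / (2 * K) * inverse (sqrt (real N)) + 1 / 2 * inverse (real N) < \<epsilon>" by auto
    have "(\<lambda>n. (h N n + K) / (2 * N * K)) \<longlonglongrightarrow> (C * sqrt N + K) / (2 * N * K)"
      using N K by (intro tendsto_intros h_lim) auto
    moreover have "(C * sqrt N + K) / (2 * N * K) < \<epsilon>" using bnd[OF N(1)] N(2) by simp
    ultimately have "eventually (\<lambda>n. (h N n + K) / (2 * N * K) < \<epsilon>) sequentially"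
      by (rule order_tendstoD)
    hence "eventually (\<lambda>n. norm (f n a - lim_fun a) < \<epsilon>) sequentially"
    proof eventually_elim
      case (elim n)
      thus ?case using main[OF N(1), of n] by simp
    qed
    thus "\<exists>n0. \<forall>n\<ge>n0. norm (f n a - lim_fun a) < \<epsilon>"
      unfolding eventually_sequentially .
  qed
qed

end

section \<open>Trial polynomials\<close>

lemma deriv_bound_ball:
  assumes "f holomorphic_on ball 0 1" "\<And>z. cmod z < 1 \<Longrightarrow> cmod (f z) \<le> 1" "cmod z \<le> r" "r < 1"
  shows "cmod (deriv f z) \<le> 2 / (1 - r)"
proof -
  define d where "d = (1 - r) / 2"
  have d: "0 < d" using assms by (simp add: d_def)
  have sub: "cball z d \<subseteq> ball 0 1"
  proof
    fix x assume "x \<in> cball z d"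
    hence "cmod x \<le> r + d"
      using assms(3) norm_triangle_ineq2[of x z] by (simp add: dist_norm norm_minus_commute)
    thus "x \<in> ball 0 1" using assms(4) by (simp add: d_def field_simps)
  qed
  have "cmod ((deriv ^^ 1) f z) \<le> fact 1 * 1 / d ^ 1"
  proof (rule Cauchy_inequality)
    show "continuous_on (cball z d) f" "f holomorphic_on ball z d"
      using assms(1) sub holomorphic_on_subset holomorphic_on_imp_continuous_on ball_subset_cball
      by (metis, metis order_trans)
    fix x assume "cmod (z - x) = d"
    hence "x \<in> cball z d" by (simp add: dist_norm)
    thus "cmod (f x) \<le> 1" using assms(2) sub by auto
  qed (rule d)
  thus ?thesis by (simp add: d_def)
qed

text \<open>Cauchy's estimate gives a common Lipschitz constant \<open>L\<close> on the smaller
  disc, inherited by the limit. On a finite net of mesh \<open>e / (4 L)\<close> pointwise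
  convergence is already uniform.\<close>

lemma bounded_pointwise_imp_uniform_limit:
  fixes f :: "nat \<Rightarrow> complex \<Rightarrow> complex"
  assumes hol: "\<And>n. f n holomorphic_on ball 0 1"
    and bound: "\<And>n z. cmod z < 1 \<Longrightarrow> cmod (f n z) \<le> 1"
    and lim: "\<And>z. cmod z < 1 \<Longrightarrow> (\<lambda>n. f n z) \<longlonglongrightarrow> g z"
    and r: "r < 1"
  shows "uniform_limit (cball 0 r) f g sequentially"
proof (rule uniform_limitI)
  fix e :: real assume e: "0 < e"
  define L where "L = 2 / (1 - r)"
  have L: "0 < L" using r by (simp add: L_def)
  have lip: "cmod (f n x - f n y) \<le> L * cmod (x - y)" if "x \<in> cball 0 r" "y \<in> cball 0 r" for n x y
  proof (rule field_differentiable_bound[where S = "cball 0 r" and f' = "deriv (f n)"])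
    fix z :: complex assume z: "z \<in> cball 0 r"
    hence "z \<in> ball 0 1" using r by auto
    thus "(f n has_field_derivative deriv (f n) z) (at z within cball 0 r)"
      using holomorphic_derivI[OF hol open_ball] by blast
    show "cmod (deriv (f n) z) \<le> L"
      unfolding L_def by (rule deriv_bound_ball[OF hol bound]) (use z r in auto)
  qed (use that in auto)
  have lip': "cmod (g x - g y) \<le> L * cmod (x - y)" if "x \<in> cball 0 r" "y \<in> cball 0 r" for x y
  proof (rule LIMSEQ_le_const2)
    show "(\<lambda>n. cmod (f n x - f n y)) \<longlonglongrightarrow> cmod (g x - g y)"
      using that r by (intro tendsto_intros lim) auto
  qed (use lip that in blast)
  define d where "d = e / (4 * L)"
  have d: "0 < d" using e L by (simp add: d_def)
  have "seq_compact (cball (0::complex) r)" by (simp add: compact_imp_seq_compact)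
  from seq_compact_imp_totally_bounded[OF this, rule_format, OF d]
  obtain k :: "complex set" where k: "finite k" "k \<subseteq> cball 0 r" "cball 0 r \<subseteq> (\<Union>x\<in>k. ball x d)" by auto
  have "eventually (\<lambda>n. \<forall>x\<in>k. dist (f n x) (g x) < e / 4) sequentially"
    using k r e by (intro eventually_ball_finite ballI tendstoD[OF lim]) auto
  thus "eventually (\<lambda>n. \<forall>x\<in>cball 0 r. dist (f n x) (g x) < e) sequentially"
  proof eventually_elim
    case (elim n)
    show ?case
    proof
      fix x :: complex assume x: "x \<in> cball 0 r"
      then obtain y where y: "y \<in> k" "cmod (y - x) < d" using k(3) by (auto simp: dist_norm)
      hence yr: "y \<in> cball 0 r" using k by blast
      have "L * cmod (x - y) \<le> L * d"
        using y(2) L by (intro mult_left_mono) (auto simp: norm_minus_commute)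
      hence Ld: "L * cmod (x - y) \<le> e / 4" using L by (simp add: d_def)
      have "dist (f n x) (g x) \<le> cmod (f n x - f n y) + cmod (f n y - g y) + cmod (g y - g x)"
        unfolding dist_norm
        using norm_triangle_ineq[of "f n x - f n y" "f n y - g x"]
          norm_triangle_ineq[of "f n y - g y" "g y - g x"] by simp
      also have "\<dots> < e"
      proof -
        have "cmod (f n x - f n y) \<le> e / 4" using lip[OF x yr, of n] Ld by linarith
        moreover have "cmod (g y - g x) \<le> e / 4"
          using lip'[OF x yr] Ld norm_minus_commute[of "g x" "g y"] by linarith
        moreover have "cmod (f n y - g y) < e / 4" using elim y(1) by (simp add: dist_norm)
        ultimately show ?thesis using e by linarith
      qed
      finally show "dist (f n x) (g x) < e" .
    qed
  qed
qed

text \<open>\<open>\<Phi>\<close> is the map from the disc coordinate to \<open>u\<close>, an even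
  rational function of degree two with poles at \<open>c\<close> and its reflection. The even
  functions with at most these simple poles form a two-dimensional space, spanned by
  \<open>1\<close> and \<open>\<Phi>\<close>; this is the assumption \<open>affine\<close>.\<close>

locale arc_param = disc_data +
  fixes \<Phi> :: "complex \<Rightarrow> complex"
  assumes affine: "\<exists>A B. \<forall>z. (z - c) * (1 - c * z) \<noteq> 0 \<longrightarrow>
      (x * (1 + z\<^sup>2) + y * z) / ((z - c) * (1 - c * z)) = A + B * \<Phi> z"
begin

definition dom :: "complex set" where "dom = {z. z - c \<noteq> 0 \<and> 1 - c * z \<noteq> 0}"

definition poly_fun :: "nat \<Rightarrow> (complex \<Rightarrow> complex) \<Rightarrow> bool" where
  "poly_fun d g \<longleftrightarrow> (\<exists>Q. degree Q \<le> d \<and> (\<forall>z\<in>dom. g z = poly Q (\<Phi> z)))"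

lemma poly_fun_const: "poly_fun d (\<lambda>z. k)"
  unfolding poly_fun_def by (intro exI[of _ "[:k:]"]) auto

lemma poly_fun_mono: "poly_fun d g \<Longrightarrow> d \<le> d' \<Longrightarrow> poly_fun d' g"
  unfolding poly_fun_def using order_trans by blast

lemma poly_fun_cong: "poly_fun d g \<Longrightarrow> (\<And>z. z \<in> dom \<Longrightarrow> h z = g z) \<Longrightarrow> poly_fun d h"
  unfolding poly_fun_def by fastforce

lemma poly_fun_add:
  assumes "poly_fun d g" "poly_fun d h"
  shows "poly_fun d (\<lambda>z. g z + h z)"
proof -
  from assms obtain Q R where "degree Q \<le> d" "\<forall>z\<in>dom. g z = poly Q (\<Phi> z)"
    "degree R \<le> d" "\<forall>z\<in>dom. h z = poly R (\<Phi> z)" unfolding poly_fun_def by blast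
  thus ?thesis unfolding poly_fun_def by (intro exI[of _ "Q + R"]) (auto intro: degree_add_le)
qed

lemma poly_fun_mult:
  assumes "poly_fun d g" "poly_fun d' h"
  shows "poly_fun (d + d') (\<lambda>z. g z * h z)"
proof -
  from assms obtain Q R where *: "degree Q \<le> d" "\<forall>z\<in>dom. g z = poly Q (\<Phi> z)"
    "degree R \<le> d'" "\<forall>z\<in>dom. h z = poly R (\<Phi> z)" unfolding poly_fun_def by blast
  have "degree (Q * R) \<le> d + d'" using degree_mult_le[of Q R] * by linarith
  thus ?thesis unfolding poly_fun_def using * by (intro exI[of _ "Q * R"]) auto
qed

lemma poly_fun_cmult: "poly_fun d g \<Longrightarrow> poly_fun d (\<lambda>z. k * g z)"
  using poly_fun_mult[OF poly_fun_const[of 0 k]] by simp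

lemma poly_fun_diff:
  assumes "poly_fun d g" "poly_fun d h"
  shows "poly_fun d (\<lambda>z. g z - h z)"
  using poly_fun_add[OF assms(1) poly_fun_cmult[OF assms(2), of "-1"]] by simp

lemma poly_fun_quadratic:
  assumes "\<And>z. z \<in> dom \<Longrightarrow> g z = (x * (1 + z\<^sup>2) + y * z) / ((z - c) * (1 - c * z))"
  shows "poly_fun 1 g"
proof -
  obtain A B where AB: "\<And>z. (z - c) * (1 - c * z) \<noteq> 0 \<Longrightarrow>
      (x * (1 + z\<^sup>2) + y * z) / ((z - c) * (1 - c * z)) = A + B * \<Phi> z"
    using affine[of x y] by blast
  have "g z = poly [:A, B:] (\<Phi> z)" if "z \<in> dom" for z
    using assms[OF that] AB[of z] that by (simp add: dom_def)
  moreover have "degree [:A, B:] \<le> 1" by simp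
  ultimately show ?thesis unfolding poly_fun_def by blast
qed

text \<open>\<open>x1\<close> is the reciprocal of the Blaschke factor, \<open>xi1 = z (x1 - x1(\<infinity>))\<close> with \<open>x1(\<infinity>) = - cnj c\<close>,
  and \<open>x2\<close>, \<open>xi2\<close> are their reflections. Unlike \<open>z x1\<close>, the function \<open>xi1\<close> has no pole at infinity.\<close>

definition x1 :: "complex \<Rightarrow> complex" where "x1 z = (1 - cnj c * z) / (z - c)"
definition x2 :: "complex \<Rightarrow> complex" where "x2 z = (z - cnj c) / (1 - c * z)"
definition nu :: complex where "nu = 1 - c * cnj c"
definition xi1 :: "complex \<Rightarrow> complex" where "xi1 z = nu * z / (z - c)"
definition xi2 :: "complex \<Rightarrow> complex" where "xi2 z = nu / (1 - c * z)"

text \<open>Inversion of \<open>z\<close> swaps \<open>x1\<close> with \<open>x2\<close> and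
  \<open>xi1\<close> with \<open>xi2\<close>. So each expression is even, and it has at most simple
  poles at \<open>c\<close> and its reflection.\<close>

lemma symmetric_functions:
  "poly_fun 1 (\<lambda>z. x1 z + x2 z)" "poly_fun 1 (\<lambda>z. x1 z * x2 z)"
  "poly_fun 1 (\<lambda>z. xi1 z + xi2 z)" "poly_fun 1 (\<lambda>z. xi1 z * xi2 z)"
  "poly_fun 1 (\<lambda>z. xi1 z * x2 z + xi2 z * x1 z)"
proof -
  show "poly_fun 1 (\<lambda>z. x1 z + x2 z)"
  proof (rule poly_fun_quadratic)
    show "x1 z + x2 z = ((1 + c * cnj c) * (1 + z\<^sup>2) + (- 2 * (c + cnj c)) * z) / ((z - c) * (1 - c * z))"
      if "z \<in> dom" for z
      using that unfolding dom_def x1_def x2_def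
      by (simp add: add_frac_eq) (simp add: algebra_simps power2_eq_square)
  qed
  show "poly_fun 1 (\<lambda>z. x1 z * x2 z)"
  proof (rule poly_fun_quadratic)
    show "x1 z * x2 z = ((- cnj c) * (1 + z\<^sup>2) + (1 + cnj c * cnj c) * z) / ((z - c) * (1 - c * z))"
      if "z \<in> dom" for z
      unfolding x1_def x2_def times_divide_times_eq
      by (rule arg_cong2[where f = "(/)"]) (simp_all add: algebra_simps power2_eq_square)
  qed
  show "poly_fun 1 (\<lambda>z. xi1 z + xi2 z)"
  proof (rule poly_fun_quadratic)
    show "xi1 z + xi2 z = ((- nu * c) * (1 + z\<^sup>2) + (2 * nu) * z) / ((z - c) * (1 - c * z))"
      if "z \<in> dom" for z
      using that unfolding dom_def xi1_def xi2_def
      by (simp add: add_frac_eq) (simp add: algebra_simps power2_eq_square)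
  qed
  show "poly_fun 1 (\<lambda>z. xi1 z * xi2 z)"
  proof (rule poly_fun_quadratic)
    show "xi1 z * xi2 z = (0 * (1 + z\<^sup>2) + (nu * nu) * z) / ((z - c) * (1 - c * z))"
      if "z \<in> dom" for z
      unfolding xi1_def xi2_def times_divide_times_eq
      by (rule arg_cong2[where f = "(/)"]) (simp_all add: algebra_simps power2_eq_square)
  qed
  show "poly_fun 1 (\<lambda>z. xi1 z * x2 z + xi2 z * x1 z)"
  proof (rule poly_fun_quadratic)
    show "xi1 z * x2 z + xi2 z * x1 z
       = (nu * (1 + z\<^sup>2) + (- 2 * nu * cnj c) * z) / ((z - c) * (1 - c * z))"
      if "z \<in> dom" for z
    proof -
      have "xi1 z * x2 z + xi2 z * x1 z
        = (nu * z * (z - cnj c) + nu * (1 - cnj c * z)) / ((z - c) * (1 - c * z))"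
        unfolding xi1_def xi2_def x1_def x2_def times_divide_times_eq add_divide_distrib
        by (simp add: mult.commute)
      thus ?thesis by (simp add: algebra_simps power2_eq_square)
    qed
  qed
qed

text \<open>The recurrence \<open>s (j + 2) = (x1 + x2) s (j + 1) - x1 x2 s j\<close> of power sums,
  whose coefficients have degree at most one in \<open>u\<close>.\<close>

lemma poly_fun_power_sum:
  assumes "poly_fun d (\<lambda>z. y1 z + y2 z)" "poly_fun (d + 1) (\<lambda>z. y1 z * x1 z + y2 z * x2 z)"
  shows "poly_fun (d + j) (\<lambda>z. y1 z * x1 z ^ j + y2 z * x2 z ^ j)"
proof (induction j rule: induct_nat_012)
  case (ge2 j)
  have "poly_fun (1 + (d + Suc j)) (\<lambda>z. (x1 z + x2 z) * (y1 z * x1 z ^ Suc j + y2 z * x2 z ^ Suc j))"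
    by (intro poly_fun_mult symmetric_functions ge2)
  moreover have "poly_fun (1 + (d + j)) (\<lambda>z. (x1 z * x2 z) * (y1 z * x1 z ^ j + y2 z * x2 z ^ j))"
    by (intro poly_fun_mult symmetric_functions ge2)
  hence "poly_fun (1 + (d + Suc j)) (\<lambda>z. (x1 z * x2 z) * (y1 z * x1 z ^ j + y2 z * x2 z ^ j))"
    by (rule poly_fun_mono) simp
  ultimately have "poly_fun (1 + (d + Suc j)) (\<lambda>z.
      (x1 z + x2 z) * (y1 z * x1 z ^ Suc j + y2 z * x2 z ^ Suc j)
      - (x1 z * x2 z) * (y1 z * x1 z ^ j + y2 z * x2 z ^ j))"
    by (rule poly_fun_diff)
  thus ?case by (rule poly_fun_cong[THEN poly_fun_mono]) (simp_all add: algebra_simps)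
qed (use assms in simp_all)

lemma xi_first_moment: "poly_fun 2 (\<lambda>z. xi1 z * x1 z + xi2 z * x2 z)"
proof -
  have "poly_fun (1 + 1) (\<lambda>z. (xi1 z + xi2 z) * (x1 z + x2 z))"
    by (intro poly_fun_mult symmetric_functions)
  moreover have "poly_fun (1 + 1) (\<lambda>z. xi1 z * x2 z + xi2 z * x1 z)"
    by (rule poly_fun_mono[OF symmetric_functions(5)]) simp
  ultimately have "poly_fun (1 + 1) (\<lambda>z. (xi1 z + xi2 z) * (x1 z + x2 z) - (xi1 z * x2 z + xi2 z * x1 z))"
    by (rule poly_fun_diff)
  thus ?thesis by (rule poly_fun_cong[THEN poly_fun_mono]) (simp_all add: algebra_simps)
qed

lemma power_sums:
  "poly_fun j (\<lambda>z. x1 z ^ j + x2 z ^ j)"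
  "poly_fun (1 + j) (\<lambda>z. xi1 z * x1 z ^ j + xi2 z * x2 z ^ j)"
  "poly_fun (2 + j) (\<lambda>z. (xi1 z)\<^sup>2 * x1 z ^ j + (xi2 z)\<^sup>2 * x2 z ^ j)"
proof -
  show "poly_fun j (\<lambda>z. x1 z ^ j + x2 z ^ j)"
    using poly_fun_power_sum[of 0 "\<lambda>z. 1" "\<lambda>z. 1" j] poly_fun_const symmetric_functions(1) by simp
  show "poly_fun (1 + j) (\<lambda>z. xi1 z * x1 z ^ j + xi2 z * x2 z ^ j)"
    using symmetric_functions(3) xi_first_moment
    by (intro poly_fun_power_sum) (simp_all add: numeral_2_eq_2)
  have 1: "poly_fun (1 + 1) (\<lambda>z. (xi1 z + xi2 z) * (xi1 z + xi2 z))"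
    by (intro poly_fun_mult symmetric_functions)
  have 2: "poly_fun (1 + 1) (\<lambda>z. 2 * (xi1 z * xi2 z))"
    by (rule poly_fun_mono[OF poly_fun_cmult[OF symmetric_functions(4)]]) simp
  have 3: "poly_fun 2 (\<lambda>z. (xi1 z)\<^sup>2 + (xi2 z)\<^sup>2)"
    by (rule poly_fun_cong[THEN poly_fun_mono, OF poly_fun_diff[OF 1 2]])
      (simp_all add: algebra_simps power2_eq_square)
  have 4: "poly_fun (2 + 1) (\<lambda>z. (xi1 z * x1 z + xi2 z * x2 z) * (xi1 z + xi2 z))"
    by (intro poly_fun_mult symmetric_functions xi_first_moment)
  have 5: "poly_fun (2 + 1) (\<lambda>z. (xi1 z * xi2 z) * (x1 z + x2 z))"
    by (rule poly_fun_mono[OF poly_fun_mult[OF symmetric_functions(4,1)]]) simp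
  have 6: "poly_fun (2 + 1) (\<lambda>z. (xi1 z)\<^sup>2 * x1 z + (xi2 z)\<^sup>2 * x2 z)"
    by (rule poly_fun_cong[THEN poly_fun_mono, OF poly_fun_diff[OF 4 5]])
      (simp_all add: algebra_simps power2_eq_square)
  show "poly_fun (2 + j) (\<lambda>z. (xi1 z)\<^sup>2 * x1 z ^ j + (xi2 z)\<^sup>2 * x2 z ^ j)"
    by (rule poly_fun_power_sum[OF 3 6])
qed


text \<open>First and second order difference quotients of \<open>x ^ n\<close> at \<open>x = - cnj c\<close>, see \<open>quot1_eq\<close> and \<open>quot2_eq\<close>.\<close>

primrec quot1 :: "nat \<Rightarrow> complex \<Rightarrow> complex" where
  "quot1 0 x = 0"
| "quot1 (Suc n) x = x ^ n + (- cnj c) * quot1 n x"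

primrec quot2 :: "nat \<Rightarrow> complex \<Rightarrow> complex" where
  "quot2 0 x = 0"
| "quot2 (Suc n) x = quot1 n x + (- cnj c) * quot2 n x"

lemma quot1_eq: "(x + cnj c) * quot1 n x = x ^ n - (- cnj c) ^ n"
proof (induction n)
  case (Suc n)
  have "(x + cnj c) * quot1 (Suc n) x = (x + cnj c) * x ^ n + (- cnj c) * ((x + cnj c) * quot1 n x)"
    by (simp add: algebra_simps)
  thus ?case unfolding Suc by (simp add: algebra_simps)
qed simp

lemma quot2_eq:
  "(x + cnj c)\<^sup>2 * quot2 n x = x ^ n - (- cnj c) ^ n - of_nat n * (- cnj c) ^ (n - 1) * (x + cnj c)"
proof (induction n)
  case (Suc n)
  have p: "of_nat n * (- cnj c) ^ (n - 1) * (- cnj c) = of_nat n * (- cnj c) ^ n"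
    by (cases n) (simp_all add: algebra_simps)
  have "(x + cnj c)\<^sup>2 * quot2 (Suc n) x
     = (x + cnj c) * ((x + cnj c) * quot1 n x) + (- cnj c) * ((x + cnj c)\<^sup>2 * quot2 n x)"
    by (simp add: algebra_simps power2_eq_square)
  also have "\<dots> = (x + cnj c) * (x ^ n - (- cnj c) ^ n) + (- cnj c) * (x ^ n - (- cnj c) ^ n)
     - of_nat n * (- cnj c) ^ (n - 1) * (- cnj c) * (x + cnj c)"
    unfolding Suc quot1_eq by (simp add: algebra_simps)
  also have "\<dots> = x ^ Suc n - (- cnj c) ^ Suc n - of_nat (Suc n) * (- cnj c) ^ n * (x + cnj c)"
    unfolding p by (simp add: algebra_simps)
  finally show ?case by simp
qed simp

text \<open>A factor \<open>xi\<close> raises the degree by one and a difference quotient lowers it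
  by one, so the sums that occur in \<open>trial\<close> stay within degree \<open>n\<close>. The
  second sum serves the induction for the third.\<close>

lemma poly_fun_quot:
  "poly_fun n (\<lambda>z. xi1 z * quot1 n (x1 z) + xi2 z * quot1 n (x2 z))"
  "poly_fun (n + 1) (\<lambda>z. (xi1 z)\<^sup>2 * quot1 n (x1 z) + (xi2 z)\<^sup>2 * quot1 n (x2 z))"
  "poly_fun n (\<lambda>z. (xi1 z)\<^sup>2 * quot2 n (x1 z) + (xi2 z)\<^sup>2 * quot2 n (x2 z))"
proof -
  show "poly_fun n (\<lambda>z. xi1 z * quot1 n (x1 z) + xi2 z * quot1 n (x2 z))"
  proof (induction n)
    case (Suc n)
    have "poly_fun (Suc n) (\<lambda>z. (xi1 z * x1 z ^ n + xi2 z * x2 z ^ n)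
       + (- cnj c) * (xi1 z * quot1 n (x1 z) + xi2 z * quot1 n (x2 z)))"
      by (rule poly_fun_add[OF poly_fun_mono[OF power_sums(2)]
            poly_fun_mono[OF poly_fun_cmult[OF Suc]]]) auto
    thus ?case by (rule poly_fun_cong) (simp add: algebra_simps)
  qed (simp add: poly_fun_const)
  show *: "poly_fun (n + 1) (\<lambda>z. (xi1 z)\<^sup>2 * quot1 n (x1 z) + (xi2 z)\<^sup>2 * quot1 n (x2 z))" for n
  proof (induction n)
    case (Suc n)
    have "poly_fun (Suc n + 1) (\<lambda>z. ((xi1 z)\<^sup>2 * x1 z ^ n + (xi2 z)\<^sup>2 * x2 z ^ n)
       + (- cnj c) * ((xi1 z)\<^sup>2 * quot1 n (x1 z) + (xi2 z)\<^sup>2 * quot1 n (x2 z)))"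
      by (rule poly_fun_add[OF poly_fun_mono[OF power_sums(3)]
            poly_fun_mono[OF poly_fun_cmult[OF Suc]]]) auto
    thus ?case by (rule poly_fun_cong) (simp add: algebra_simps)
  qed (simp add: poly_fun_const)
  show "poly_fun n (\<lambda>z. (xi1 z)\<^sup>2 * quot2 n (x1 z) + (xi2 z)\<^sup>2 * quot2 n (x2 z))"
  proof (induction n)
    case (Suc n)
    have "poly_fun (Suc n) (\<lambda>z. ((xi1 z)\<^sup>2 * quot1 n (x1 z) + (xi2 z)\<^sup>2 * quot1 n (x2 z))
       + (- cnj c) * ((xi1 z)\<^sup>2 * quot2 n (x1 z) + (xi2 z)\<^sup>2 * quot2 n (x2 z)))"
      by (rule poly_fun_add[OF poly_fun_mono[OF *] poly_fun_mono[OF poly_fun_cmult[OF Suc]]]) auto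
    thus ?case by (rule poly_fun_cong) (simp add: algebra_simps)
  qed (simp add: poly_fun_const)
qed

text \<open>For \<open>x = x1 z\<close> and \<open>y = xi1 z\<close> this is \<open>lim_fun z * x1 z ^ n\<close> with the principal part at infinity removed.\<close>

definition trial :: "nat \<Rightarrow> complex \<Rightarrow> complex \<Rightarrow> complex" where
  "trial n x y = (x ^ n + 2 * \<i> * \<tau> * (y * quot1 n x) - (of_real \<tau>)\<^sup>2 * (y\<^sup>2 * quot2 n x))
      / (2 * (1 + (of_real \<tau>)\<^sup>2))"

text \<open>The coefficients of \<open>z\<close> and \<open>z^2\<close> in \<open>lim_fun\<close>
  multiply the Taylor polynomials of \<open>x ^ n\<close> at \<open>- cnj c\<close> of order zero
  and one: as much as has to be subtracted to compensate the growth of \<open>z\<close> and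
  \<open>z^2\<close> at infinity.\<close>

definition trial_error :: "nat \<Rightarrow> complex \<Rightarrow> complex \<Rightarrow> complex" where
  "trial_error n x y = (2 * \<i> * \<tau> * y * (- cnj c) ^ n
      - (of_real \<tau>)\<^sup>2 * y\<^sup>2 * ((- cnj c) ^ n + of_nat n * (- cnj c) ^ (n - 1) * (x + cnj c)))
      / (2 * (1 + (of_real \<tau>)\<^sup>2))"

lemma poly_fun_trial: "poly_fun n (\<lambda>z. trial n (x1 z) (xi1 z) + trial n (x2 z) (xi2 z))"
proof -
  let ?k = "1 / (2 * (1 + (complex_of_real \<tau>)\<^sup>2))"
  have "poly_fun n (\<lambda>z. ?k * ((x1 z ^ n + x2 z ^ n)
     + (2 * \<i> * \<tau>) * (xi1 z * quot1 n (x1 z) + xi2 z * quot1 n (x2 z))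
     - (of_real \<tau>)\<^sup>2 * ((xi1 z)\<^sup>2 * quot2 n (x1 z) + (xi2 z)\<^sup>2 * quot2 n (x2 z))))"
    by (intro poly_fun_cmult poly_fun_add poly_fun_diff power_sums poly_fun_quot)
  thus ?thesis
    by (rule poly_fun_cong) (simp add: trial_def add_divide_distrib diff_divide_distrib ring_distribs)
qed

text \<open>The factors \<open>x + cnj c\<close> cancel the denominators of the difference
  quotients; by \<open>xi_eq\<close> the arguments in use have this shape, with \<open>y = z\<close>
  or \<open>y = 1/z\<close>.\<close>

lemma trial_eq: "trial n x ((x + cnj c) * y) = lim_fun y * x ^ n - trial_error n x y"
proof -
  have "trial n x ((x + cnj c) * y) = (x ^ n + 2 * \<i> * \<tau> * (y * ((x + cnj c) * quot1 n x))
      - (of_real \<tau>)\<^sup>2 * (y\<^sup>2 * ((x + cnj c)\<^sup>2 * quot2 n x))) / (2 * (1 + (of_real \<tau>)\<^sup>2))"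
    unfolding trial_def by (simp add: power_mult_distrib mult_ac)
  also have "\<dots> = ((1 + \<i> * \<tau> * y)\<^sup>2 * x ^ n - (2 * \<i> * \<tau> * y * (- cnj c) ^ n
      - (of_real \<tau>)\<^sup>2 * y\<^sup>2 * ((- cnj c) ^ n + of_nat n * (- cnj c) ^ (n - 1) * (x + cnj c))))
      / (2 * (1 + (of_real \<tau>)\<^sup>2))"
    unfolding quot1_eq quot2_eq
    by (rule arg_cong2[where f = "(/)"]) (simp_all add: algebra_simps power2_eq_square)
  finally show ?thesis by (simp add: lim_fun_def trial_error_def diff_divide_distrib)
qed

lemma xi_eq:
  assumes "z \<in> dom" "z \<noteq> 0"
  shows "xi1 z = (x1 z + cnj c) * z" "xi2 z = (x2 z + cnj c) * inverse z"
proof -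
  have "x1 z + cnj c = nu / (z - c)" "x2 z + cnj c = nu * z / (1 - c * z)"
    using assms unfolding dom_def x1_def x2_def nu_def by (simp_all add: field_simps)
  thus "xi1 z = (x1 z + cnj c) * z" "xi2 z = (x2 z + cnj c) * inverse z"
    using assms by (simp_all add: xi1_def xi2_def)
qed

end

lemma times_power_pred_tendsto_0:
  fixes x :: "'a::{real_normed_field, banach}"
  assumes "norm x < 1"
  shows "(\<lambda>n. of_nat n * x ^ (n - 1)) \<longlonglongrightarrow> 0"
proof -
  have "(\<lambda>n. of_nat n * x ^ n + x ^ n) \<longlonglongrightarrow> 0 + 0"
    using assms by (intro tendsto_add powser_times_n_limit_0 LIMSEQ_power_zero)
  hence "(\<lambda>n. of_nat (Suc n) * x ^ (Suc n - 1)) \<longlonglongrightarrow> 0"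
    by (simp add: algebra_simps)
  thus ?thesis by (rule LIMSEQ_imp_Suc)
qed

context arc_param
begin

lemma norm_cnj_c: "cmod (- cnj c) < 1"
  using c by simp

lemma trial_error_tendsto_0: "(\<lambda>n. trial_error n x y) \<longlonglongrightarrow> 0"
proof -
  have "2 * (1 + (complex_of_real \<tau>)\<^sup>2) \<noteq> 0"
    using factor_nonzero(3)[of 1] by (metis mult_eq_0_iff norm_one order_refl power_one mult_1_right zero_neq_numeral)
  hence "(\<lambda>n. trial_error n x y) \<longlonglongrightarrow> (2 * \<i> * \<tau> * y * 0
      - (of_real \<tau>)\<^sup>2 * y\<^sup>2 * (0 + 0 * (x + cnj c))) / (2 * (1 + (of_real \<tau>)\<^sup>2))"
    unfolding trial_error_def
    by (intro tendsto_intros LIMSEQ_power_zero times_power_pred_tendsto_0 norm_cnj_c)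
  thus ?thesis by simp
qed

text \<open>Of the three powers of \<open>cmod c\<close>, two come from the linear and one from the
  quadratic term of \<open>trial_error\<close>; the last summand uses
  \<open>|x + cnj c| \<le> 2\<close>.\<close>

definition error_bound :: "nat \<Rightarrow> real" where
  "error_bound n = 3 * cmod c ^ n + 2 * (of_nat n * cmod c ^ (n - 1))"

lemma error_bound_nonneg: "0 \<le> error_bound n"
  by (simp add: error_bound_def)

lemma error_bound_tendsto_0: "error_bound \<longlonglongrightarrow> 0"
proof -
  have "error_bound \<longlonglongrightarrow> 3 * 0 + 2 * 0"
    unfolding error_bound_def[abs_def] using c
    by (intro tendsto_intros LIMSEQ_power_zero times_power_pred_tendsto_0) auto
  thus ?thesis by simp
qed

lemma norm_trial_error:
  assumes "cmod x = 1" "cmod y = 1"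
  shows "cmod (trial_error n x y) \<le> error_bound n"
proof -
  have "cmod (x + cnj c) \<le> 2" using norm_triangle_ineq[of x "cnj c"] assms c by simp
  hence "of_nat n * cmod c ^ (n - 1) * cmod (x + cnj c) \<le> of_nat n * cmod c ^ (n - 1) * 2"
    by (intro mult_left_mono) auto
  moreover have "cmod ((- cnj c) ^ n + of_nat n * (- cnj c) ^ (n - 1) * (x + cnj c))
     \<le> cmod c ^ n + of_nat n * cmod c ^ (n - 1) * cmod (x + cnj c)"
    by (rule order_trans[OF norm_triangle_ineq]) (simp add: norm_mult norm_power)
  ultimately have 1: "cmod ((- cnj c) ^ n + of_nat n * (- cnj c) ^ (n - 1) * (x + cnj c))
     \<le> cmod c ^ n + 2 * (of_nat n * cmod c ^ (n - 1))" by simp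
  let ?A = "2 * \<i> * \<tau> * y * (- cnj c) ^ n" and ?X = "(- cnj c) ^ n + of_nat n * (- cnj c) ^ (n - 1) * (x + cnj c)"
  have "cmod ?A \<le> 2 * cmod c ^ n"
    using tau assms by (simp add: norm_mult norm_power mult_left_le_one_le)
  moreover have "cmod ((of_real \<tau>)\<^sup>2 * y\<^sup>2 * ?X) \<le> cmod ?X"
    using tau_sq assms by (simp add: norm_mult norm_power mult_left_le_one_le)
  ultimately have num: "cmod (?A - (of_real \<tau>)\<^sup>2 * y\<^sup>2 * ?X) \<le> error_bound n"
    using 1 norm_triangle_ineq4[of ?A "(of_real \<tau>)\<^sup>2 * y\<^sup>2 * ?X"] unfolding error_bound_def by linarith
  have "2 * (1 + (complex_of_real \<tau>)\<^sup>2) = of_real (2 * (1 + \<tau>\<^sup>2))" by simp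
  hence "cmod (2 * (1 + (complex_of_real \<tau>)\<^sup>2)) = \<bar>2 * (1 + \<tau>\<^sup>2)\<bar>" by (metis norm_of_real)
  hence den: "1 \<le> cmod (2 * (1 + (complex_of_real \<tau>)\<^sup>2))" using tau_sq by simp
  have "cmod (trial_error n x y)
     = cmod (?A - (of_real \<tau>)\<^sup>2 * y\<^sup>2 * ?X) / cmod (2 * (1 + (complex_of_real \<tau>)\<^sup>2))"
    unfolding trial_error_def norm_divide ..
  also have "\<dots> \<le> error_bound n / 1"
    using num den by (intro frac_le error_bound_nonneg) auto
  finally show ?thesis by simp
qed

text \<open>On the circle the modulus of \<open>lim_fun\<close> is affine in \<open>Im z\<close>,
  and inversion changes the sign of \<open>Im z\<close>.\<close>

lemma norm_lim_fun:
  assumes "cmod z = 1"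
  shows "cmod (lim_fun z) + cmod (lim_fun (inverse z)) = 1"
proof -
  have sq: "(cmod (1 + \<i> * \<tau> * v))\<^sup>2 = 1 + \<tau>\<^sup>2 - 2 * \<tau> * Im v" if "cmod v = 1" for v
  proof -
    have "(Re v)\<^sup>2 + (Im v)\<^sup>2 = 1" using that cmod_power2[of v] by simp
    hence "\<tau>\<^sup>2 * (Re v)\<^sup>2 + \<tau>\<^sup>2 * (Im v)\<^sup>2 = \<tau>\<^sup>2" by (metis distrib_left mult_1_right)
    thus ?thesis unfolding cmod_power2 by (simp add: power2_eq_square algebra_simps)
  qed
  have n: "cmod (lim_fun v) = (1 + \<tau>\<^sup>2 - 2 * \<tau> * Im v) / (2 * (1 + \<tau>\<^sup>2))" if "cmod v = 1" for v
  proof -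
    have "2 * (1 + (complex_of_real \<tau>)\<^sup>2) = of_real (2 * (1 + \<tau>\<^sup>2))" by simp
    hence "cmod (2 * (1 + (complex_of_real \<tau>)\<^sup>2)) = \<bar>2 * (1 + \<tau>\<^sup>2)\<bar>" by (metis norm_of_real)
    thus ?thesis using sq[OF that] tau_sq unfolding lim_fun_def norm_divide norm_power by simp
  qed
  have "0 < 1 + \<tau>\<^sup>2" using tau_sq by linarith
  thus ?thesis using assms n[OF assms] n[of "inverse z"]
    by (simp add: norm_inverse inverse_eq_cnj add_divide_distrib[symmetric])
qed

text \<open>By \<open>norm_lim_fun\<close> the symmetrized trial function exceeds one on the circle
  by at most two error terms. Dividing by this bound makes it admissible without changing the limit
  at \<open>pole\<close>.\<close>

lemma near_optimal_polynomials:
  assumes tau0: "\<tau> \<noteq> 0" and pc: "pole \<noteq> c"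
  shows "\<exists>Q. (\<forall>n. degree (Q n) \<le> n) \<and> (\<forall>n z. cmod z = 1 \<longrightarrow> cmod (poly (Q n) (\<Phi> z)) \<le> 1)
    \<and> (\<lambda>n. blaschke c pole ^ n * poly (Q n) (\<Phi> pole)) \<longlonglongrightarrow> lim_fun pole"
proof -
  define T where "T n z = trial n (x1 z) (xi1 z) + trial n (x2 z) (xi2 z)" for n z
  have "\<exists>R. \<forall>n. degree (R n) \<le> n \<and> (\<forall>z\<in>dom. T n z = poly (R n) (\<Phi> z))"
    using poly_fun_trial unfolding poly_fun_def T_def by (intro choice allI) 
  then obtain R where R: "\<And>n. degree (R n) \<le> n" "\<And>n z. z \<in> dom \<Longrightarrow> T n z = poly (R n) (\<Phi> z)"
    by blast
  have T_eq: "T n z = lim_fun z * x1 z ^ n - trial_error n (x1 z) z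
      + (lim_fun (inverse z) * x2 z ^ n - trial_error n (x2 z) (inverse z))"
    if "z \<in> dom" "z \<noteq> 0" for n z
    unfolding T_def xi_eq[OF that] trial_eq ..
  define Q where "Q n = smult (of_real (1 / (1 + 2 * error_bound n))) (R n)" for n
  have d1: "1 \<le> 1 + 2 * error_bound n" for n using error_bound_nonneg[of n] by simp
  have degree: "degree (Q n) \<le> n" for n
    unfolding Q_def using R(1)[of n] degree_smult_le order_trans by blast
  have norm: "cmod (poly (Q n) (\<Phi> z)) \<le> 1" if z: "cmod z = 1" for n z
  proof -
    have zd: "z \<in> dom" "z \<noteq> 0" using blaschke_nonzero[OF z] z by (auto simp: dom_def)
    have x: "cmod (x1 z) = 1" "cmod (x2 z) = 1" "cmod (inverse z) = 1"
      using norm_blaschke_eq_1[OF c z] norm_blaschke_eq_1[of "cnj c" z] c z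
      by (auto simp: x1_def x2_def blaschke_def norm_divide norm_inverse divide_simps split: if_splits)
    have "cmod (T n z) \<le> cmod (lim_fun z * x1 z ^ n) + cmod (trial_error n (x1 z) z)
        + (cmod (lim_fun (inverse z) * x2 z ^ n) + cmod (trial_error n (x2 z) (inverse z)))"
      unfolding T_eq[OF zd]
      by (intro order_trans[OF norm_triangle_ineq] add_mono norm_triangle_ineq4)
    also have "\<dots> \<le> 1 + 2 * error_bound n"
      using norm_lim_fun[OF z] norm_trial_error[OF x(1) z, of n] norm_trial_error[OF x(2,3), of n]
      by (simp add: norm_mult norm_power x)
    finally have "cmod (poly (R n) (\<Phi> z)) \<le> 1 + 2 * error_bound n" using R(2)[OF zd(1), of n] by simp
    thus ?thesis using d1[of n] unfolding Q_def poly_smult norm_mult norm_of_real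
      by (simp add: divide_simps)
  qed
  have lim: "(\<lambda>n. blaschke c pole ^ n * poly (Q n) (\<Phi> pole)) \<longlonglongrightarrow> lim_fun pole"
  proof -
    have p0: "pole \<noteq> 0" using tau0 by (simp add: pole_def)
    have pd: "pole \<in> dom" using pc one_minus_mult_nonzero[OF c, of pole] norm_pole by (simp add: dom_def)
    \<comment> \<open>The double zero of \<open>lim_fun\<close> is the reflection of
      \<open>pole\<close>, so the mirror image contributes nothing to the main term there.\<close>
    have l0: "lim_fun (inverse pole) = 0"
      using tau0 by (simp add: lim_fun_def pole_def field_simps)
    have bx: "blaschke c pole * x1 pole = 1"
      using pd one_minus_mult_nonzero[of "cnj c" pole] c norm_pole
      by (simp add: blaschke_def x1_def dom_def)
    let ?E = "\<lambda>n. trial_error n (x1 pole) pole + trial_error n (x2 pole) (inverse pole)"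
    have "?E \<longlonglongrightarrow> 0 + 0" by (intro tendsto_add trial_error_tendsto_0)
    hence nE: "(\<lambda>n. cmod (?E n)) \<longlonglongrightarrow> 0" by (intro tendsto_norm_zero) simp
    have "(\<lambda>n. blaschke c pole ^ n * ?E n) \<longlonglongrightarrow> 0"
    proof (rule Lim_null_comparison[OF always_eventually nE], rule allI)
      fix n
      have "cmod (blaschke c pole) ^ n \<le> 1"
        using norm_blaschke_less_1[OF c norm_pole] by (intro power_le_one) auto
      thus "cmod (blaschke c pole ^ n * ?E n) \<le> cmod (?E n)"
        by (simp only: norm_mult norm_power) (rule mult_left_le_one_le, auto)
    qed
    hence "(\<lambda>n. lim_fun pole - blaschke c pole ^ n * ?E n) \<longlonglongrightarrow> lim_fun pole - 0"
      by (intro tendsto_intros)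
    moreover have "lim_fun pole - blaschke c pole ^ n * ?E n = blaschke c pole ^ n * T n pole" for n
    proof -
      have "blaschke c pole ^ n * T n pole
         = lim_fun pole * (blaschke c pole * x1 pole) ^ n - blaschke c pole ^ n * ?E n"
        unfolding T_eq[OF pd p0] l0 by (simp add: algebra_simps power_mult_distrib)
      thus ?thesis unfolding bx by simp
    qed
    ultimately have "(\<lambda>n. blaschke c pole ^ n * T n pole) \<longlonglongrightarrow> lim_fun pole" by simp
    moreover have "(\<lambda>n. complex_of_real (1 / (1 + 2 * error_bound n))) \<longlonglongrightarrow> of_real (1 / (1 + 2 * 0))"
      by (intro tendsto_intros error_bound_tendsto_0) simp
    ultimately have "(\<lambda>n. complex_of_real (1 / (1 + 2 * error_bound n)) * (blaschke c pole ^ n * T n pole))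
        \<longlonglongrightarrow> of_real (1 / (1 + 2 * 0)) * lim_fun pole"
      by (intro tendsto_mult)
    thus ?thesis by (simp add: Q_def R(2)[OF pd, symmetric] mult_ac)
  qed
  show ?thesis using degree norm lim by blast
qed

end

section \<open>Uniformization of the complement of the arc\<close>

lemma csqrt_eqI: "0 < Re s \<Longrightarrow> csqrt (s\<^sup>2) = s"
  by (rule csqrt_square) simp

lemma square_not_nonpos:
  assumes "0 < Re s"
  shows "s\<^sup>2 \<notin> \<real>\<^sub>\<le>\<^sub>0"
proof
  assume "s\<^sup>2 \<in> \<real>\<^sub>\<le>\<^sub>0"
  hence "Re s * Im s = 0" "Re s * Re s \<le> Im s * Im s"
    by (auto simp: complex_nonpos_Reals_iff power2_eq_square)
  thus False using mult_pos_pos[OF assms assms] by auto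
qed

lemma Re_csqrt_pos:
  assumes "w \<notin> \<real>\<^sub>\<le>\<^sub>0"
  shows "0 < Re (csqrt w)"
proof (rule ccontr)
  assume "\<not> 0 < Re (csqrt w)"
  hence "Re (csqrt w) = 0" using csqrt_principal[of w] by auto
  hence "(csqrt w)\<^sup>2 \<in> \<real>\<^sub>\<le>\<^sub>0" by (simp add: complex_nonpos_Reals_iff power2_eq_square)
  thus False using assms by simp
qed

lemma add_of_real_nonzero: "0 < Re s \<Longrightarrow> 0 < m \<Longrightarrow> s + of_real m \<noteq> 0"
  by (auto simp: complex_eq_iff)

lemma cmod_diff_less_add:
  assumes "0 < Re (s * cnj t)"
  shows "cmod (s - t) < cmod (s + t)"
proof (rule power_less_imp_less_base)
  show "(cmod (s - t))\<^sup>2 < (cmod (s + t))\<^sup>2"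
    unfolding cmod_power2 using assms by (simp add: power2_eq_square algebra_simps)
qed simp

text \<open>Replaces the condition on \<open>Arg\<close> by one on the real part, which algebra with
  \<open>mob\<close> can decide.\<close>

lemma mem_arc_set_iff:
  assumes "0 < \<alpha>" "\<alpha> < pi"
  shows "u \<in> arc_set \<alpha> \<longleftrightarrow> cmod u = 1 \<and> cos \<alpha> \<le> Re u"
proof -
  have "(- \<alpha> \<le> Arg u \<and> Arg u \<le> \<alpha>) \<longleftrightarrow> cos \<alpha> \<le> Re u" if "cmod u = 1"
  proof -
    have "u = rcis 1 (Arg u)" using rcis_cmod_Arg[of u] that by simp
    have "\<bar>Arg u\<bar> \<le> pi" using Arg_bounded[of u] by linarith
    have "Re u = cos (Arg u)" using \<open>u = rcis 1 (Arg u)\<close> by (metis Re_rcis mult_1)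
    also have "\<dots> = cos \<bar>Arg u\<bar>" by simp
    finally have "cos \<alpha> \<le> Re u \<longleftrightarrow> \<bar>Arg u\<bar> \<le> \<alpha>"
      using assms cos_mono_le_eq[of \<alpha> "\<bar>Arg u\<bar>"] \<open>\<bar>Arg u\<bar> \<le> pi\<close> by simp
    thus ?thesis by linarith
  qed
  thus ?thesis unfolding arc_set_def by blast
qed

locale arc =
  fixes \<alpha> :: real
  assumes alpha: "0 < \<alpha>" "\<alpha> < pi"
begin

definition endpt :: complex where "endpt = cis \<alpha>"
text \<open>The value of \<open>lam\<close> squared at infinity.\<close>

definition half :: complex where "half = cis (\<alpha> / 2)"

text \<open>The base of the fourth root in \<open>lam\<close>. Its matrix has trace zero, so it is
  an involution: the same formula takes the arc to the nonpositive half-line and back.\<close>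

definition mob :: "complex \<Rightarrow> complex" where
  "mob u = (u * endpt - 1) / (u - endpt)"

lemma half_square: "half\<^sup>2 = endpt"
  unfolding half_def endpt_def by (simp add: power2_eq_square cis_mult)

lemma Re_half: "0 < Re half"
  unfolding half_def using alpha by (simp add: cos_gt_zero)

lemma endpt_facts: "cmod endpt = 1" "Re endpt = cos \<alpha>" "Im endpt = sin \<alpha>" "0 < sin \<alpha>"
  "endpt * cnj endpt = 1"
  using alpha by (auto simp: endpt_def sin_gt_zero cis_cnj cis_mult)

lemma endpt_square: "endpt\<^sup>2 \<noteq> 1"
proof
  assume "endpt\<^sup>2 = 1"
  hence "endpt = 1 \<or> endpt = -1" by (simp add: power2_eq_1_iff)
  thus False using endpt_facts by auto
qed

lemma endpt_in_arc: "endpt \<in> arc_set \<alpha>"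
  using endpt_facts by (simp add: mem_arc_set_iff[OF alpha])

lemma mob_ne: "v \<noteq> endpt \<Longrightarrow> mob v \<noteq> endpt"
  using endpt_square by (auto simp: mob_def field_simps power2_eq_square)

lemma mob_mob:
  assumes "v \<noteq> endpt"
  shows "mob (mob v) = v"
proof -
  have 1: "mob v - endpt = (endpt\<^sup>2 - 1) / (v - endpt)"
    using assms by (simp add: mob_def field_simps power2_eq_square)
  have 2: "mob v * endpt - 1 = v * (endpt\<^sup>2 - 1) / (v - endpt)"
    using assms by (simp add: mob_def field_simps power2_eq_square)
  show ?thesis
    unfolding mob_def[of "mob v"] 1 2 using assms endpt_square by simp
qed

lemma mob_nonpos_in_arc:
  assumes "0 \<le> t"
  shows "mob (- of_real t) \<in> arc_set \<alpha>"
proof -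
  define a b where "a = of_real t * endpt + 1" and "b = of_real t + endpt"
  have "mob (- of_real t) = (- a) / (- b)" unfolding mob_def a_def b_def by simp
  hence eq: "mob (- of_real t) = a / b" by simp
  \<comment> \<open>Numerator and denominator thus have equal modulus, which puts the quotient on
    the unit circle.\<close>
  have "a = endpt * cnj b" using endpt_facts(5) by (simp add: a_def b_def algebra_simps)
  hence ab: "cmod a = cmod b" using endpt_facts by (simp add: norm_mult del: complex_cnj_add)
  have "Im b \<noteq> 0" using endpt_facts by (simp add: b_def)
  hence b0: "b \<noteq> 0" by auto
  have cos2: "(cos \<alpha>)\<^sup>2 \<le> 1" by (simp add: abs_square_le_1)
  have "(Re b)\<^sup>2 + (Im b)\<^sup>2 = t\<^sup>2 + 1 + 2 * t * cos \<alpha>"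
  proof -
    have "(Re b)\<^sup>2 + (Im b)\<^sup>2 = t\<^sup>2 + 2 * t * cos \<alpha> + ((cos \<alpha>)\<^sup>2 + (sin \<alpha>)\<^sup>2)"
      using endpt_facts by (simp add: b_def power2_eq_square algebra_simps)
    thus ?thesis by simp
  qed
  moreover have "Re a * Re b + Im a * Im b = (t\<^sup>2 + 1) * cos \<alpha> + 2 * t"
  proof -
    have "t * (cos \<alpha> * cos \<alpha>) + t * (sin \<alpha> * sin \<alpha>) = t"
      by (metis distrib_left mult_1_right sin_cos_squared_add3)
    thus ?thesis
      using endpt_facts by (simp add: a_def b_def power2_eq_square algebra_simps)
  qed
  moreover have "cos \<alpha> * (t\<^sup>2 + 1 + 2 * t * cos \<alpha>) \<le> (t\<^sup>2 + 1) * cos \<alpha> + 2 * t"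
    using mult_left_mono[OF cos2 assms] by (simp add: algebra_simps power2_eq_square)
  moreover have "0 < (Re b)\<^sup>2 + (Im b)\<^sup>2" using b0 by (simp add: complex_neq_0)
  ultimately have "cos \<alpha> \<le> Re (a / b)" by (simp add: Re_divide pos_le_divide_eq)
  thus ?thesis unfolding eq mem_arc_set_iff[OF alpha] using ab b0 by (simp add: norm_divide)
qed

lemma mob_arc:
  assumes "u \<in> arc_set \<alpha>" "u \<noteq> endpt"
  shows "mob u \<in> \<real>\<^sub>\<le>\<^sub>0"
proof -
  have u: "cmod u = 1" "cos \<alpha> \<le> Re u" using assms(1) by (auto simp: mem_arc_set_iff[OF alpha])
  have uu: "u * cnj u = 1" using u by (simp add: complex_norm_square[symmetric])
  have "mob u = (u * endpt - 1) * cnj (u - endpt) / of_real ((cmod (u - endpt))\<^sup>2)"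
    unfolding mob_def complex_norm_square using assms(2) by simp
  also have "(u * endpt - 1) * cnj (u - endpt)
     = (u * cnj u) * endpt - u * (endpt * cnj endpt) - cnj u + cnj endpt"
    by (simp add: algebra_simps)
  also have "\<dots> = of_real (2 * cos \<alpha> - 2 * Re u)"
    unfolding uu endpt_facts(5) using endpt_facts by (simp add: complex_eq_iff)
  finally have eq: "mob u = of_real ((2 * cos \<alpha> - 2 * Re u) / (cmod (u - endpt))\<^sup>2)" by simp
  have "(2 * cos \<alpha> - 2 * Re u) / (cmod (u - endpt))\<^sup>2 \<le> 0"
    using u by (intro divide_nonpos_nonneg) auto
  thus ?thesis unfolding eq nonpos_Reals_of_real_iff by blast
qed

lemma not_arc:
  assumes "u \<notin> arc_set \<alpha>"
  shows "u \<noteq> endpt" "mob u \<notin> \<real>\<^sub>\<le>\<^sub>0" "0 < Re (csqrt (mob u))"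
proof -
  show e: "u \<noteq> endpt" using assms endpt_in_arc by auto
  show "mob u \<notin> \<real>\<^sub>\<le>\<^sub>0"
  proof
    assume "mob u \<in> \<real>\<^sub>\<le>\<^sub>0"
    then obtain t where "t \<le> 0" "mob u = of_real t" by (auto elim: nonpos_Reals_cases)
    hence "mob u = - of_real (- t)" "0 \<le> - t" by auto
    hence "mob (mob u) \<in> arc_set \<alpha>" using mob_nonpos_in_arc[of "-t"] by simp
    thus False using assms mob_mob[OF e] by simp
  qed
  thus "0 < Re (csqrt (mob u))" by (rule Re_csqrt_pos)
qed

lemma mob_tendsto: "(mob \<longlongrightarrow> endpt) at_infinity"
proof -
  have "((\<lambda>u. (endpt - inverse u) / (1 - endpt * inverse u)) \<longlongrightarrow> (endpt - 0) / (1 - endpt * 0)) at_infinity"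
    by (intro tendsto_intros tendsto_inverse_0) simp
  moreover have "eventually (\<lambda>u. (endpt - inverse u) / (1 - endpt * inverse u) = mob u) at_infinity"
  proof -
    have "eventually (\<lambda>u::complex. 1 \<le> norm u) at_infinity"
      by (auto simp: eventually_at_infinity)
    thus ?thesis
    proof eventually_elim
      case (elim u)
      hence "u \<noteq> 0" by auto
      hence "endpt - inverse u = (u * endpt - 1) / u" "1 - endpt * inverse u = (u - endpt) / u"
        by (simp_all add: field_simps)
      thus ?case using \<open>u \<noteq> 0\<close> by (simp add: mob_def)
    qed
  qed
  ultimately show ?thesis by (simp add: tendsto_cong)
qed

end

text \<open>\<open>m\<close> will be the modulus of \<open>lam\<close> squared at \<open>u0\<close>;
  this scale sends \<open>u0\<close> to the imaginary axis of the disc.\<close>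

locale scaled_arc = arc +
  fixes m :: real
  assumes m: "0 < m"
begin

definition to_disc :: "complex \<Rightarrow> complex" where
  "to_disc u = (csqrt (mob u) - m) / (csqrt (mob u) + m)"

definition centre :: complex where "centre = (half - m) / (half + m)"

text \<open>\<open>numer / denom\<close> is \<open>mob (s^2)\<close> for
  \<open>s = m (1 + z) / (1 - z)\<close>, the inverse Cayley transform, cleared of fractions so that
  \<open>z = 1\<close>, the preimage of \<open>endpt\<close>, is covered as well.\<close>

definition numer :: "complex \<Rightarrow> complex" where
  "numer z = (of_real m)\<^sup>2 * (1 + z)\<^sup>2 * endpt - (1 - z)\<^sup>2"
definition denom :: "complex \<Rightarrow> complex" where
  "denom z = (of_real m)\<^sup>2 * (1 + z)\<^sup>2 - endpt * (1 - z)\<^sup>2"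
definition of_disc :: "complex \<Rightarrow> complex" where
  "of_disc z = numer z / denom z"

lemma norm_centre: "cmod centre < 1"
proof -
  have "cmod (half - m) < cmod (half + m)"
    using Re_half m by (intro cmod_diff_less_add) simp
  thus ?thesis unfolding centre_def norm_divide
    by (metis divide_less_eq_1_pos norm_ge_zero order_le_less_trans)
qed

lemma half_m: "half + of_real m \<noteq> 0"
  using Re_half m by (rule add_of_real_nonzero)

text \<open>The denominator vanishes where \<open>u\<close> is infinite, that is for
  \<open>s = half\<close> and \<open>s = - half\<close>; these are \<open>centre\<close> and its
  reflection.\<close>

lemma denom_eq: "denom z = (half + m)\<^sup>2 * ((z - centre) * (1 - centre * z))"
proof -
  have 1: "(half + m) * (z - centre) = m * (1 + z) - half * (1 - z)"
    "(half + m) * (1 - centre * z) = m * (1 + z) + half * (1 - z)"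
    using half_m by (simp_all add: centre_def field_simps)
  have "(half + m)\<^sup>2 * ((z - centre) * (1 - centre * z))
     = ((half + m) * (z - centre)) * ((half + m) * (1 - centre * z))"
    by (simp add: power2_eq_square mult_ac)
  also have "\<dots> = (of_real m)\<^sup>2 * (1 + z)\<^sup>2 - half\<^sup>2 * (1 - z)\<^sup>2"
    unfolding 1 by (simp add: power2_eq_square algebra_simps)
  finally show ?thesis unfolding half_square denom_def by simp
qed

lemma of_disc_mob:
  fixes z :: complex
  assumes "z \<noteq> 1"
  shows "of_disc z = mob ((m * (1 + z) / (1 - z))\<^sup>2)"
proof -
  have nz: "(1 - z)\<^sup>2 \<noteq> 0" using assms by simp
  have "(m * (1 + z) / (1 - z))\<^sup>2 * endpt - 1 = numer z / (1 - z)\<^sup>2"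
    "(m * (1 + z) / (1 - z))\<^sup>2 - endpt = denom z / (1 - z)\<^sup>2"
    unfolding numer_def denom_def power_divide power_mult_distrib using nz
    by (simp_all add: diff_divide_distrib)
  thus ?thesis unfolding of_disc_def mob_def using nz by simp
qed

lemma of_disc_inverse: 
  assumes "z \<noteq> 0"
  shows "of_disc (inverse z) = of_disc z"
proof -
  have "1 + inverse z = (1 + z) / z" "1 - inverse z = (z - 1) / z"
    using assms by (simp_all add: field_simps)
  hence sq: "(1 + inverse z)\<^sup>2 = (1 + z)\<^sup>2 / z\<^sup>2" "(1 - inverse z)\<^sup>2 = (1 - z)\<^sup>2 / z\<^sup>2"
    by (simp_all only: power_divide power2_commute[of z 1])
  have "numer (inverse z) = numer z / z\<^sup>2" "denom (inverse z) = denom z / z\<^sup>2"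
    unfolding numer_def denom_def sq by (simp_all add: diff_divide_distrib)
  thus ?thesis unfolding of_disc_def using assms by simp
qed

text \<open>The circle corresponds to imaginary \<open>s\<close>, so \<open>s^2\<close> is
  nonpositive and \<open>mob\<close> takes it to the arc.\<close>

lemma of_disc_circle:
  assumes "cmod z = 1"
  shows "of_disc z \<in> arc_set \<alpha>"
proof (cases "z = 1")
  case True
  hence "of_disc z = endpt" using m by (simp add: of_disc_def numer_def denom_def)
  thus ?thesis using endpt_in_arc by simp
next
  case False
  define v where "v = (1 + z) / (1 - z)"
  have zz: "z * cnj z = 1" using assms by (simp add: complex_norm_square[symmetric])
  have z0: "z \<noteq> 0" using assms by auto
  have cz: "cnj z = 1 / z" using zz z0 by (simp add: field_simps)
  have "cnj v = - v"
    unfolding v_def using False z0 by (simp add: cz field_simps)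
  hence "v * cnj v = - v\<^sup>2" by (simp add: power2_eq_square)
  hence "v\<^sup>2 = - of_real ((cmod v)\<^sup>2)" unfolding complex_norm_square by simp
  hence "(m * (1 + z) / (1 - z))\<^sup>2 = - of_real (m\<^sup>2 * (cmod v)\<^sup>2)"
    unfolding v_def by (simp add: power_mult_distrib flip: times_divide_eq_right)
  thus ?thesis unfolding of_disc_mob[OF False] by (metis mob_nonpos_in_arc mult_nonneg_nonneg zero_le_power2)
qed

lemma to_disc_arc:
  assumes "u \<notin> arc_set \<alpha>"
  shows "cmod (to_disc u) < 1" "of_disc (to_disc u) = u" "to_disc u \<noteq> centre"
proof -
  note na = not_arc[OF assms]
  define s where "s = csqrt (mob u)"
  have s: "0 < Re s" "s\<^sup>2 = mob u" using na by (simp_all add: s_def)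
  have sm: "s + of_real m \<noteq> 0" using s(1) m by (rule add_of_real_nonzero)
  have t: "to_disc u = (s - m) / (s + m)" by (simp add: to_disc_def s_def)
  have "cmod (s - m) < cmod (s + m)"
    using s m by (intro cmod_diff_less_add) simp
  thus n: "cmod (to_disc u) < 1" unfolding t norm_divide
    by (metis divide_less_eq_1_pos norm_ge_zero order_le_less_trans)
  hence t1: "to_disc u \<noteq> 1" by auto
  have "m * (1 + to_disc u) / (1 - to_disc u) = s"
  proof -
    have "1 + to_disc u = 2 * s / (s + m)" "1 - to_disc u = 2 * m / (s + m)"
      unfolding t using sm by (simp_all add: field_simps)
    thus ?thesis using sm m by simp
  qed
  thus od: "of_disc (to_disc u) = u"
    unfolding of_disc_mob[OF t1] by (simp add: s(2) mob_mob[OF na(1)])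
  show "to_disc u \<noteq> centre"
  proof
    assume "to_disc u = centre"
    hence "(s - m) * (half + m) = (half - m) * (s + m)"
      unfolding t centre_def using sm half_m by (simp add: field_simps)
    hence "of_real (2 * m) * (s - half) = 0" by (simp add: algebra_simps)
    hence "s = half" using m by simp
    hence "mob u = endpt" using s half_square by simp
    thus False using mob_ne[OF na(1)] by simp
  qed
qed

lemma of_disc_ball:
  assumes "cmod z < 1" "z \<noteq> centre"
  shows "of_disc z \<notin> arc_set \<alpha>" "to_disc (of_disc z) = z"
proof -
  define s where "s = m * (1 + z) / (1 - z)"
  have z1: "z \<noteq> 1" using assms by auto
  have "s = of_real m * ((1 + z) * cnj (1 - z)) / of_real ((cmod (1 - z))\<^sup>2)"
    unfolding s_def complex_norm_square using z1 by simp
  moreover have "Re (of_real m * X / of_real r) = m * Re X / r" for X r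
    by (simp add: Re_divide_of_real)
  ultimately have "Re s = m * Re ((1 + z) * cnj (1 - z)) / (cmod (1 - z))\<^sup>2" by metis
  also have "Re ((1 + z) * cnj (1 - z)) = 1 - (cmod z)\<^sup>2"
    unfolding cmod_power2 by (simp add: power2_eq_square algebra_simps)
  finally have "Re s = m * (1 - (cmod z)\<^sup>2) / (cmod (1 - z))\<^sup>2" .
  moreover have "(cmod z)\<^sup>2 < 1" using assms by (simp add: abs_square_less_1)
  ultimately have Re_s: "0 < Re s" using m z1 by simp
  have cayley: "(s - m) / (s + m) = z"
  proof -
    have "s - m = 2 * m * z / (1 - z)" "s + m = 2 * m / (1 - z)"
      unfolding s_def using z1 by (simp_all add: field_simps)
    thus ?thesis using m z1 by simp
  qed
  have se: "s\<^sup>2 \<noteq> endpt"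
  proof
    assume "s\<^sup>2 = endpt"
    hence "s = half" using csqrt_eqI[OF Re_s] csqrt_eqI[OF Re_half] half_square by simp
    thus False using cayley assms(2) by (simp add: centre_def)
  qed
  have od: "of_disc z = mob (s\<^sup>2)" unfolding of_disc_mob[OF z1] s_def ..
  have mo: "mob (of_disc z) = s\<^sup>2" unfolding od by (rule mob_mob[OF se])
  show "of_disc z \<notin> arc_set \<alpha>"
  proof
    assume "of_disc z \<in> arc_set \<alpha>"
    moreover have "of_disc z \<noteq> endpt" unfolding od by (rule mob_ne[OF se])
    ultimately have "s\<^sup>2 \<in> \<real>\<^sub>\<le>\<^sub>0" using mob_arc mo by metis
    thus False using square_not_nonpos[OF Re_s] by simp
  qed
  show "to_disc (of_disc z) = z"
    unfolding to_disc_def mo csqrt_eqI[OF Re_s] by (rule cayley)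
qed

lemma to_disc_tendsto: "(to_disc \<longlongrightarrow> centre) at_infinity"
proof -
  have c: "csqrt endpt = half" using csqrt_eqI[OF Re_half] half_square by simp
  have "endpt \<notin> \<real>\<^sub>\<le>\<^sub>0" using endpt_facts by (auto simp: complex_nonpos_Reals_iff)
  hence "((\<lambda>u. csqrt (mob u)) \<longlongrightarrow> csqrt endpt) at_infinity"
    using continuous_at_csqrt by (intro isCont_tendsto_compose[OF _ mob_tendsto])
  hence "((\<lambda>u. csqrt (mob u)) \<longlongrightarrow> half) at_infinity" unfolding c .
  thus ?thesis unfolding to_disc_def centre_def by (intro tendsto_intros half_m)
qed

lemma to_disc_holomorphic: "to_disc holomorphic_on - arc_set \<alpha>"
proof -
  have "csqrt (mob u) + m \<noteq> 0" if "u \<in> - arc_set \<alpha>" for u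
    using not_arc(3)[of u] that m by (intro add_of_real_nonzero) auto
  thus ?thesis
    unfolding to_disc_def[abs_def]
    using not_arc unfolding mob_def by (intro holomorphic_intros) auto
qed

lemma numer_centre: "numer centre \<noteq> 0"
proof -
  have "of_real m * (1 + centre) = half * (1 - centre)"
    using half_m by (simp add: centre_def field_simps)
  hence eq: "(of_real m)\<^sup>2 * (1 + centre)\<^sup>2 = endpt * (1 - centre)\<^sup>2"
    by (metis power_mult_distrib half_square)
  have "numer centre = endpt * (1 - centre)\<^sup>2 * endpt - (1 - centre)\<^sup>2"
    unfolding numer_def eq ..
  hence "numer centre = (endpt\<^sup>2 - 1) * (1 - centre)\<^sup>2"
    by (simp add: left_diff_distrib power2_eq_square[of endpt] mult_ac)
  moreover have "centre \<noteq> 1" using norm_centre by auto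
  ultimately show ?thesis using endpt_square by simp
qed

text \<open>The simple zero of the Blaschke factor at \<open>centre\<close> cancels against the
  simple pole of \<open>of_disc\<close> there.\<close>

lemma blaschke_pole_limit:
  "\<exists>k. k \<noteq> 0 \<and> ((\<lambda>u. u * blaschke centre (to_disc u)) \<longlongrightarrow> k) at_infinity"
proof -
  let ?g = "\<lambda>z. numer z / ((half + m)\<^sup>2 * (1 - centre * z)) / (1 - cnj centre * z)"
  have nz: "1 - centre * z \<noteq> 0" "1 - cnj centre * z \<noteq> 0" if "cmod z < 1" for z
    using one_minus_mult_nonzero[of centre z] one_minus_mult_nonzero[of "cnj centre" z] that norm_centre
    by auto
  have "isCont ?g centre"
    unfolding numer_def[abs_def] using nz[OF norm_centre] half_m by (intro continuous_intros) auto
  hence "((\<lambda>u. ?g (to_disc u)) \<longlongrightarrow> ?g centre) at_infinity"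
    by (rule isCont_tendsto_compose[OF _ to_disc_tendsto])
  moreover have "eventually (\<lambda>u. ?g (to_disc u) = u * blaschke centre (to_disc u)) at_infinity"
  proof -
    have "eventually (\<lambda>u::complex. 2 \<le> norm u) at_infinity"
      by (auto simp: eventually_at_infinity)
    thus ?thesis
    proof eventually_elim
      case (elim u)
      hence "u \<notin> arc_set \<alpha>" by (auto simp: arc_set_def)
      note t = to_disc_arc[OF this]
      have "u = numer (to_disc u) / ((half + m)\<^sup>2 * ((to_disc u - centre) * (1 - centre * to_disc u)))"
        using t(2) unfolding of_disc_def denom_eq by simp
      hence "u * (to_disc u - centre) = numer (to_disc u) / ((half + m)\<^sup>2 * (1 - centre * to_disc u))"
        using t(3) half_m nz[OF t(1)] by (simp add: divide_simps mult_ac)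
      thus ?case unfolding blaschke_def by simp
    qed
  qed
  ultimately have "((\<lambda>u. u * blaschke centre (to_disc u)) \<longlongrightarrow> ?g centre) at_infinity"
    by (simp add: tendsto_cong)
  moreover have "?g centre \<noteq> 0" using numer_centre half_m nz[OF norm_centre] by simp
  ultimately show ?thesis by blast
qed

text \<open>\<open>numer\<close> and \<open>denom\<close> are linearly independent in the span of
  \<open>1 + z^2\<close> and \<open>z\<close>, because \<open>endpt^2 \<noteq> 1\<close>; so they
  express every numerator of this form.\<close>

lemma of_disc_affine:
  "\<exists>A B. \<forall>z. (z - centre) * (1 - centre * z) \<noteq> 0 \<longrightarrow>
      (x * (1 + z\<^sup>2) + y * z) / ((z - centre) * (1 - centre * z)) = A + B * of_disc z"
proof -
  define M where "M = (complex_of_real m)\<^sup>2"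
  define d where "d = 2 * M * (endpt\<^sup>2 - 1) * 2"
  have d: "d \<noteq> 0" using endpt_square m by (simp add: d_def M_def)
  define n1 n2 d1 d2 where "n1 = M * endpt - 1" and "n2 = 2 * (M * endpt + 1)"
    and "d1 = M - endpt" and "d2 = 2 * (M + endpt)"
  have num: "numer z = n1 * (1 + z\<^sup>2) + n2 * z" and den: "denom z = d1 * (1 + z\<^sup>2) + d2 * z" for z
    by (simp_all add: numer_def denom_def M_def n1_def n2_def d1_def d2_def power2_eq_square algebra_simps)
  have det: "n1 * d2 - n2 * d1 = d"
    by (simp add: d_def n1_def n2_def d1_def d2_def power2_eq_square algebra_simps)
  \<comment> \<open>Cramer's rule with the determinant \<open>d\<close>.\<close>
  define p q where "p = (n1 * y - n2 * x) / d" and "q = (x * d2 - y * d1) / d"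
  have "p * d1 + q * n1 = x * ((n1 * d2 - n2 * d1) / d)" "p * d2 + q * n2 = y * ((n1 * d2 - n2 * d1) / d)"
    unfolding p_def q_def using d by (simp_all add: field_simps)
  hence pq: "p * d1 + q * n1 = x" "p * d2 + q * n2 = y" using det d by simp_all
  have comb: "x * (1 + z\<^sup>2) + y * z = p * denom z + q * numer z" for z
    unfolding num den pq[symmetric] by (simp add: algebra_simps)
  let ?h = "(half + m)\<^sup>2"
  show ?thesis
  proof (intro exI allI impI)
    fix z assume nz: "(z - centre) * (1 - centre * z) \<noteq> 0"
    let ?D = "(z - centre) * (1 - centre * z)"
    have h: "?h \<noteq> 0" using half_m by simp
    have "(x * (1 + z\<^sup>2) + y * z) / ?D = p * (denom z / ?D) + q * (numer z / ?D)"
      unfolding comb by (simp add: add_divide_distrib)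
    also have "denom z / ?D = ?h" unfolding denom_eq using nz by simp
    also have "numer z / ?D = ?h * of_disc z" unfolding of_disc_def denom_eq using nz h by simp
    finally show "(x * (1 + z\<^sup>2) + y * z) / ?D = p * ?h + (q * ?h) * of_disc z" by simp
  qed
qed

end

section \<open>The complex Green's function\<close>

text \<open>Locally this is the real part of a logarithm of \<open>f\<close>. Its partial
  derivatives are \<open>Re l\<close> and \<open>- Im l\<close> for the holomorphic
  \<open>l = f' / f\<close>, and the Cauchy-Riemann equations for \<open>l\<close> make the
  Laplacian vanish.\<close>

lemma harmonic_on_ln_norm:
  assumes f: "f holomorphic_on S" and S: "open S" and nz: "\<And>z. z \<in> S \<Longrightarrow> f z \<noteq> 0"
  shows "harmonic_on (\<lambda>z. ln (cmod (f z))) S"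
proof -
  define l where "l z = deriv f z / f z" for z
  have l: "l holomorphic_on S"
    unfolding l_def[abs_def] by (intro holomorphic_intros f S nz)
  have dl: "deriv l holomorphic_on S" by (rule holomorphic_deriv[OF l S])
  hence cont: "continuous_on S (deriv l)" by (rule holomorphic_on_imp_continuous_on)
  have der_l: "(l has_derivative (\<lambda>h. deriv l z * h)) (at z)" if "z \<in> S" for z
    using holomorphic_derivI[OF l S that] by (simp add: has_field_derivative_def)
  have "((\<lambda>z. ln (cmod (f z))) has_derivative (\<lambda>h. Re (l z) * Re h + - Im (l z) * Im h)) (at z)"
    if z: "z \<in> S" for z
  proof -
    \<comment> \<open>Division by the constant \<open>f z\<close> keeps the argument of
      \<open>Ln\<close> close to \<open>1\<close>, away from the branch cut.\<close>
    have "((\<lambda>x. Ln (f x / f z)) has_field_derivative l z) (at z)"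
      using holomorphic_derivI[OF f S z] nz[OF z]
      by (auto intro!: derivative_eq_intros simp: l_def)
    hence "((\<lambda>x. Ln (f x / f z)) has_derivative (\<lambda>h. l z * h)) (at z)"
      by (simp add: has_field_derivative_def)
    hence "((\<lambda>x. Re (Ln (f x / f z)) + ln (cmod (f z))) has_derivative (\<lambda>h. Re (l z * h) + 0)) (at z)"
      by (intro derivative_intros)
    moreover have "Re (Ln (f x / f z)) + ln (cmod (f z)) = ln (cmod (f x))" if "x \<in> S" for x
      using nz[OF that] nz[OF z] by (simp add: norm_divide ln_div)
    ultimately have "((\<lambda>x. ln (cmod (f x))) has_derivative (\<lambda>h. Re (l z * h) + 0)) (at z)"
      by (rule has_derivative_transform_within_open[OF _ S z])
    thus ?thesis by simp
  qed
  moreover have "((\<lambda>z. Re (l z)) has_derivative (\<lambda>h. Re (deriv l z) * Re h + - Im (deriv l z) * Im h)) (at z)"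
    if z: "z \<in> S" for z
    using bounded_linear.has_derivative[OF bounded_linear_Re der_l[OF z]] by simp
  moreover have "((\<lambda>z. - Im (l z)) has_derivative (\<lambda>h. - Im (deriv l z) * Re h + - Re (deriv l z) * Im h)) (at z)"
    if z: "z \<in> S" for z
    using has_derivative_minus[OF bounded_linear.has_derivative[OF bounded_linear_Im der_l[OF z]]]
    by (simp add: algebra_simps)
  ultimately show ?thesis
    unfolding harmonic_on_def
    by (intro exI[of _ "\<lambda>z. Re (l z)"] exI[of _ "\<lambda>z. - Im (l z)"] exI[of _ "\<lambda>z. Re (deriv l z)"]
        exI[of _ "\<lambda>z. - Im (deriv l z)"] exI[of _ "\<lambda>z. - Re (deriv l z)"])
      (auto intro!: continuous_intros cont)
qed

lemma open_vimage_Some: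
  assumes "openin riemann_sphere U"
  shows "open (Some -` U)"
  using openin_continuous_map_preimage[OF continuous_map_Some assms]
  by (simp add: vimage_def)

context arc
begin

lemma closed_arc: "closed (arc_set \<alpha>)"
proof -
  have "arc_set \<alpha> = {u. cmod u = 1} \<inter> {u. cos \<alpha> \<le> Re u}"
    using mem_arc_set_iff[OF alpha] by blast
  moreover have "closed {u. cmod u = 1}" "closed {u. cos \<alpha> \<le> Re u}"
    by (intro closed_Collect_eq closed_Collect_le continuous_intros)+
  ultimately show ?thesis by (metis closed_Int)
qed

lemma open_arc_compl: "open (- arc_set \<alpha>)"
  using closed_arc by (simp add: open_Compl)

lemma vimage_Some_arc_domain: "Some -` (arc_domain \<alpha> - {None}) = - arc_set \<alpha>"
  by (auto simp: arc_domain_def)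

lemma vimage_inf_chart_arc_domain:
  "inf_chart -` (arc_domain \<alpha> - {None}) = {w. w \<noteq> 0 \<and> inverse w \<in> - arc_set \<alpha>}"
  by (auto simp: arc_domain_def inf_chart_def split: if_splits)

lemma open_vimage_inf_chart: "open (inf_chart -` (arc_domain \<alpha> - {None}))"
proof -
  have "inf_chart -` (arc_domain \<alpha> - {None}) = (- {0}) \<inter> inverse -` (- arc_set \<alpha>)"
    unfolding vimage_inf_chart_arc_domain by auto
  moreover have "open ((- {0}) \<inter> inverse -` (- arc_set \<alpha>) :: complex set)"
    by (intro continuous_open_preimage open_arc_compl continuous_intros) auto
  ultimately show ?thesis by simp
qed

end

context scaled_arc
begin

lemma blaschke_to_disc:
  assumes "u \<notin> arc_set \<alpha>"
  shows "blaschke centre (to_disc u) \<noteq> 0" "cmod (blaschke centre (to_disc u)) < 1"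
  using to_disc_arc[OF assms] one_minus_mult_nonzero[of "cnj centre" "to_disc u"] norm_centre
    norm_blaschke_less_1[OF norm_centre]
  by (auto simp: blaschke_def)

lemma blaschke_to_disc_holomorphic: "(\<lambda>u. blaschke centre (to_disc u)) holomorphic_on - arc_set \<alpha>"
proof -
  have "1 - cnj centre * to_disc u \<noteq> 0" if "u \<in> - arc_set \<alpha>" for u
    using to_disc_arc[of u] that one_minus_mult_nonzero[of "cnj centre" "to_disc u"] norm_centre by auto
  thus ?thesis unfolding blaschke_def by (intro holomorphic_intros to_disc_holomorphic)
qed

text \<open>A competitor for the minimality of the given Green's function. The default
  \<open>0\<close> at infinity agrees with \<open>inverse 0 = 0\<close>, so composition with
  \<open>inf_chart\<close> is one formula for all arguments.\<close>

definition green :: "complex option \<Rightarrow> real" where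
  "green p = ln (cmod (1 / blaschke centre (to_disc (case p of None \<Rightarrow> 0 | Some u \<Rightarrow> u))))"

lemma green_positive_harmonic: "positive_harmonic_with_log_pole (arc_domain \<alpha>) None green"
proof -
  let ?F = "\<lambda>u. 1 / blaschke centre (to_disc u)"
  have F: "?F holomorphic_on - arc_set \<alpha>"
    using blaschke_to_disc(1) by (intro holomorphic_intros blaschke_to_disc_holomorphic) auto
  have nz: "?F u \<noteq> 0" if "u \<in> - arc_set \<alpha>" for u using blaschke_to_disc(1)[of u] that by simp
  have "green \<circ> Some = (\<lambda>u. ln (cmod (?F u)))" by (simp add: green_def fun_eq_iff)
  hence 1: "harmonic_on (green \<circ> Some) (Some -` (arc_domain \<alpha> - {None}))"
    unfolding vimage_Some_arc_domain using harmonic_on_ln_norm[OF F open_arc_compl nz] by simp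
  have G: "(\<lambda>w. ?F (inverse w)) holomorphic_on inf_chart -` (arc_domain \<alpha> - {None})"
  proof -
    have "inverse holomorphic_on {w. w \<noteq> 0 \<and> inverse w \<in> - arc_set \<alpha>}"
      by (intro holomorphic_intros) auto
    hence "(?F \<circ> inverse) holomorphic_on {w. w \<noteq> 0 \<and> inverse w \<in> - arc_set \<alpha>}"
      by (rule holomorphic_on_compose_gen[OF _ F]) auto
    thus ?thesis unfolding vimage_inf_chart_arc_domain by (simp only: o_def)
  qed
  have "green \<circ> inf_chart = (\<lambda>w. ln (cmod (?F (inverse w))))"
    by (auto simp: green_def inf_chart_def fun_eq_iff)
  moreover have "harmonic_on (\<lambda>w. ln (cmod (?F (inverse w)))) (inf_chart -` (arc_domain \<alpha> - {None}))"
  proof (rule harmonic_on_ln_norm[OF G open_vimage_inf_chart])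
    fix w assume "w \<in> inf_chart -` (arc_domain \<alpha> - {None})"
    hence "inverse w \<in> - arc_set \<alpha>" unfolding vimage_inf_chart_arc_domain by simp
    thus "?F (inverse w) \<noteq> 0" by (rule nz)
  qed
  ultimately have 2: "harmonic_on (green \<circ> inf_chart) (inf_chart -` (arc_domain \<alpha> - {None}))" by simp
  have 3: "0 < green z" if z: "z \<in> arc_domain \<alpha> - {None}" for z
  proof -
    obtain u where u: "z = Some u" "u \<notin> arc_set \<alpha>" using z by (cases z) (auto simp: arc_domain_def)
    show ?thesis using blaschke_to_disc[OF u(2)] by (simp add: u(1) green_def norm_divide)
  qed
  obtain k where k: "k \<noteq> 0" "((\<lambda>u. u * blaschke centre (to_disc u)) \<longlongrightarrow> k) at_infinity"
    using blaschke_pole_limit by blast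
  have "((\<lambda>u. - ln (cmod (u * blaschke centre (to_disc u)))) \<longlongrightarrow> - ln (cmod k)) at_infinity"
    using k by (intro tendsto_intros) auto
  moreover have "eventually (\<lambda>u. - ln (cmod (u * blaschke centre (to_disc u)))
      = green (Some u) - ln (cmod u)) at_infinity"
  proof -
    have "eventually (\<lambda>u::complex. 2 \<le> norm u) at_infinity"
      by (auto simp: eventually_at_infinity)
    thus ?thesis
    proof eventually_elim
      case (elim u)
      hence u: "u \<notin> arc_set \<alpha>" "u \<noteq> 0" by (auto simp: arc_set_def)
      thus ?case using blaschke_to_disc(1)[OF u(1)]
        by (simp add: green_def norm_mult norm_divide ln_mult ln_div)
    qed
  qed
  ultimately have "((\<lambda>u. green (Some u) - ln (cmod u)) \<longlongrightarrow> - ln (cmod k)) at_infinity"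
    by (rule Lim_transform_eventually)
  hence "has_log_pole green None" unfolding has_log_pole_def by auto
  thus ?thesis
    unfolding positive_harmonic_with_log_pole_def sphere_harmonic_on_def using 1 2 3 by blast
qed

lemma of_disc_tendsto: "filterlim of_disc at_infinity (at centre)"
proof -
  have nz: "1 - centre * z \<noteq> 0" if "cmod z < 1" for z
    using one_minus_mult_nonzero[of centre z] that norm_centre by auto
  have "(numer \<longlongrightarrow> numer centre) (at centre)"
    unfolding numer_def[abs_def] by (intro tendsto_intros)
  moreover have "filterlim denom (at 0) (at centre)"
  proof (rule filterlim_atI)
    have "(denom \<longlongrightarrow> denom centre) (at centre)"
      unfolding denom_def[abs_def] by (intro tendsto_intros)
    thus "(denom \<longlongrightarrow> 0) (at centre)" by (simp add: denom_eq)
    have "eventually (\<lambda>z. z \<in> ball 0 1 - {centre}) (at centre)"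
      using norm_centre by (intro eventually_at_in_open) auto
    thus "eventually (\<lambda>z. denom z \<noteq> 0) (at centre)"
      by eventually_elim (use nz half_m in \<open>auto simp: denom_eq\<close>)
  qed
  ultimately show ?thesis
    unfolding of_disc_def[abs_def] using numer_centre
    by (rule filterlim_divide_at_infinity)
qed

lemma of_disc_holomorphic: "of_disc holomorphic_on ball 0 1 - {centre}"
proof -
  have "denom z \<noteq> 0" if "z \<in> ball 0 1 - {centre}" for z
    using that one_minus_mult_nonzero[of centre z] norm_centre half_m by (auto simp: denom_eq)
  moreover have "numer holomorphic_on S" "denom holomorphic_on S" for S
    unfolding numer_def[abs_def] denom_def[abs_def] by (intro holomorphic_intros)+
  ultimately show ?thesis unfolding of_disc_def[abs_def] by (intro holomorphic_intros)
qed

text \<open>Minimality of the Green's function gives \<open>|b| \<ge> |z|\<close> in the disc coordinate centred at infinity,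
  and \<open>|b| < 1\<close> gives the converse inequality by the Schwarz lemma.\<close>

theorem complex_green_function_eq:
  assumes b: "is_complex_green_function (arc_domain \<alpha>) None b"
    and lim: "((\<lambda>u. u * b (Some u)) \<longlongrightarrow> k) at_infinity"
  shows "\<exists>w. cmod w = 1 \<and> (\<forall>u. u \<notin> arc_set \<alpha> \<longrightarrow> b (Some u) = w * blaschke centre (to_disc u))"
proof -
  from b obtain g where g: "is_green_function (arc_domain \<alpha>) None g"
    and loc: "\<forall>z\<in>arc_domain \<alpha> - {None}. \<exists>U v. openin riemann_sphere U \<and> z \<in> U \<and> U \<subseteq> arc_domain \<alpha> - {None} \<and>
           harmonic_conjugate_on v g U \<and>
           (\<forall>x\<in>U. b x = exp (- (of_real (g x) + \<i> * of_real (v x))))"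
    unfolding is_complex_green_function_def by blast
  have gpos: "0 < g (Some u)" if "u \<notin> arc_set \<alpha>" for u
    using g that unfolding is_green_function_def positive_harmonic_with_log_pole_def
    by (auto simp: arc_domain_def)
  have gmin: "g (Some u) \<le> green (Some u)" if "u \<notin> arc_set \<alpha>" for u
    using g green_positive_harmonic that unfolding is_green_function_def
    by (auto simp: arc_domain_def)
  \<comment> \<open>The conjugate and its neighbourhood vary with \<open>u\<close>, but
    differentiability and modulus are local.\<close>
  have local: "(\<lambda>u. b (Some u)) field_differentiable at u \<and> cmod (b (Some u)) = exp (- g (Some u))"
    if u: "u \<notin> arc_set \<alpha>" for u
  proof -
    have "Some u \<in> arc_domain \<alpha> - {None}" using u by (auto simp: arc_domain_def)
    with loc obtain U v where U: "openin riemann_sphere U" "Some u \<in> U"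
      and conj: "harmonic_conjugate_on v g U"
      and bx: "\<forall>x\<in>U. b x = exp (- (of_real (g x) + \<i> * of_real (v x)))" by meson
    have bU: "b (Some x) = exp (- (Complex (g (Some x)) (v (Some x))))" if "x \<in> Some -` U" for x
      using bx that by (simp add: Complex_eq)
    have "((\<lambda>z. Complex (g z) (v z)) \<circ> Some) holomorphic_on (Some -` U)"
      using conj unfolding harmonic_conjugate_on_def sphere_holomorphic_on_def by blast
    hence "(\<lambda>x. exp (- (Complex (g (Some x)) (v (Some x))))) holomorphic_on (Some -` U)"
      unfolding o_def by (intro holomorphic_intros)
    hence "(\<lambda>x. b (Some x)) holomorphic_on (Some -` U)"
      by (rule holomorphic_transform) (simp add: bU)
    hence "(\<lambda>u. b (Some u)) field_differentiable at u"
      using open_vimage_Some[OF U(1)] U(2)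
      by (simp add: holomorphic_on_imp_differentiable_at)
    moreover have "cmod (b (Some u)) = exp (- g (Some u))"
      using bU[of u] U(2) by (simp add: Complex_eq)
    ultimately show ?thesis by blast
  qed
  have b_hol: "(\<lambda>u. b (Some u)) holomorphic_on - arc_set \<alpha>"
    using local open_arc_compl by (auto simp: holomorphic_on_open field_differentiable_def)
  have b_lower: "cmod (blaschke centre (to_disc u)) \<le> cmod (b (Some u))" if u: "u \<notin> arc_set \<alpha>" for u
  proof -
    have "exp (- green (Some u)) = cmod (blaschke centre (to_disc u))"
      using blaschke_to_disc(1)[OF u] by (simp add: green_def norm_divide ln_div)
    thus ?thesis using local[OF u] gmin[OF u] by (metis exp_le_cancel_iff neg_le_iff_le)
  qed
  have b_upper: "cmod (b (Some u)) < 1" if u: "u \<notin> arc_set \<alpha>" for u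
    using local[OF u] gpos[OF u] by simp
  have b_inf: "((\<lambda>u. b (Some u)) \<longlongrightarrow> 0) at_infinity"
  proof -
    have "((\<lambda>u. inverse u * (u * b (Some u))) \<longlongrightarrow> 0 * k) at_infinity"
      by (intro tendsto_intros lim tendsto_inverse_0)
    moreover have "eventually (\<lambda>u::complex. 1 \<le> norm u) at_infinity"
      by (auto simp: eventually_at_infinity)
    hence "eventually (\<lambda>u. inverse u * (u * b (Some u)) = b (Some u)) at_infinity"
    proof eventually_elim
      case (elim u)
      hence "u \<noteq> 0" by auto
      thus ?case by simp
    qed
    ultimately show ?thesis by (auto intro: Lim_transform_eventually)
  qed
  define M where "M = Moebius_function 0 (- centre)"
  have M_hol: "M holomorphic_on ball 0 1"
    unfolding M_def using norm_centre by (intro Moebius_function_holomorphic) simp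
  have M1: "cmod (M x) < 1" if "cmod x < 1" for x
    unfolding M_def using norm_centre that by (intro Moebius_function_norm_lt_1) auto
  have M_inv: "blaschke centre (M x) = x" if "cmod x < 1" for x
    unfolding M_def blaschke_Moebius using norm_centre that by (intro Moebius_function_compose) auto
  have M_inv': "M (blaschke centre x) = x" if "cmod x < 1" for x
    unfolding M_def blaschke_Moebius using norm_centre that by (intro Moebius_function_compose) auto
  have M0: "M 0 = centre" by (simp add: M_def Moebius_function_of_zero)
  have M_ne: "M x \<noteq> centre" if "cmod x < 1" "x \<noteq> 0" for x
    using M_inv[OF that(1)] that(2) by (auto simp: blaschke_def)
  \<comment> \<open>\<open>M\<close> inverts the Blaschke factor, so \<open>B\<close> is
    \<open>b\<close> in a disc coordinate that vanishes at infinity. The value \<open>0\<close>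
    there is the limit of \<open>b\<close>, which makes the singularity removable.\<close>
  define B where "B x = (if x = 0 then 0 else b (Some (of_disc (M x))))" for x
  have Bsome: "of_disc (M x) \<notin> arc_set \<alpha>" "to_disc (of_disc (M x)) = M x" if "cmod x < 1" "x \<noteq> 0" for x
    using of_disc_ball[OF M1 M_ne] that by auto
  have "(\<lambda>x. b (Some (of_disc (M x)))) holomorphic_on ball 0 1 - {0}"
  proof -
    have "(of_disc \<circ> M) holomorphic_on ball 0 1 - {0}"
      using M1 M_ne M_hol
      by (intro holomorphic_on_compose_gen[OF _ of_disc_holomorphic]) (auto elim: holomorphic_on_subset)
    moreover have "(of_disc \<circ> M) ` (ball 0 1 - {0}) \<subseteq> - arc_set \<alpha>" using Bsome by auto
    ultimately have "((\<lambda>u. b (Some u)) \<circ> (of_disc \<circ> M)) holomorphic_on ball 0 1 - {0}"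
      by (rule holomorphic_on_compose_gen[OF _ b_hol])
    thus ?thesis by (simp add: o_def)
  qed
  hence B_hol': "B holomorphic_on ball 0 1 - {0}"
    by (rule holomorphic_transform) (auto simp: B_def)
  have B_lim: "(B \<longlongrightarrow> B 0) (at 0 within ball 0 1)"
  proof -
    have "isCont M 0"
      using M_hol by (intro continuous_on_interior[OF holomorphic_on_imp_continuous_on]) auto
    hence "(M \<longlongrightarrow> centre) (at 0)" using M0 by (metis isCont_def)
    moreover have "eventually (\<lambda>x. M x \<noteq> centre) (at 0)"
    proof -
      have "eventually (\<lambda>x::complex. x \<in> ball 0 1 - {0}) (at 0)" by (intro eventually_at_in_open) auto
      thus ?thesis by eventually_elim (use M_ne in auto)
    qed
    ultimately have "filterlim M (at centre) (at 0)" by (rule filterlim_atI)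
    hence "((\<lambda>x. b (Some (of_disc (M x)))) \<longlongrightarrow> 0) (at 0)"
      by (intro filterlim_compose[OF b_inf] filterlim_compose[OF of_disc_tendsto])
    moreover have "eventually (\<lambda>x. b (Some (of_disc (M x))) = B x) (at 0)"
      by (auto simp: B_def eventually_at_filter)
    ultimately have "(B \<longlongrightarrow> 0) (at 0)" by (rule Lim_transform_eventually)
    moreover have "B 0 = 0" by (simp add: B_def)
    ultimately show ?thesis by (simp add: Lim_at_imp_Lim_at_within)
  qed
  have B_hol: "B holomorphic_on ball 0 1"
  proof (rule no_isolated_singularity'[where K = "{0}"])
    fix z :: complex assume "z \<in> {0}"
    thus "(B \<longlongrightarrow> B z) (at z within ball 0 1)" using B_lim by simp
  qed (use B_hol' in auto)
  have B0: "B 0 = 0" by (simp add: B_def)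
  have B1: "cmod (B x) < 1" if "cmod x < 1" for x
    using b_upper Bsome[OF that] by (auto simp: B_def)
  have Blow: "cmod x \<le> cmod (B x)" if "cmod x < 1" for x
    using b_lower[of "of_disc (M x)"] Bsome[OF that] M_inv[OF that]
    by (cases "x = 0") (simp_all add: B_def)
  \<comment> \<open>Equality in the Schwarz lemma at a single nonzero point already makes
    \<open>B\<close> a rotation.\<close>
  have "cmod (B (1 / 2)) = cmod (1 / 2 :: complex)"
    using Schwarz_Lemma(1)[OF B_hol B0 B1, of "1 / 2"] Blow[of "1 / 2"] by simp
  hence "\<exists>z. cmod z < 1 \<and> z \<noteq> 0 \<and> cmod (B z) = cmod z"
    by (intro exI[of _ "1 / 2"]) auto
  with Schwarz_Lemma(3)[OF B_hol B0 B1, of 0]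
  obtain w where w: "\<forall>z. cmod z < 1 \<longrightarrow> B z = w * z" "cmod w = 1" by auto
  have "b (Some u) = w * blaschke centre (to_disc u)" if u: "u \<notin> arc_set \<alpha>" for u
  proof -
    note bl = blaschke_to_disc[OF u] and td = to_disc_arc[OF u]
    have "B (blaschke centre (to_disc u)) = b (Some u)"
      using bl(1) M_inv'[OF td(1)] td(2) by (simp add: B_def)
    thus ?thesis using w(1) bl(2) by metis
  qed
  thus ?thesis using w(2) by blast
qed

end

section \<open>The limit theorem\<close>

text \<open>The factors of the limit that vanish at its removable singularities cancel, since
  \<open>s\<^sup>2 - |s\<^sub>0|\<^sup>2 + s (s\<^sub>0 - cnj s\<^sub>0) = (s + s\<^sub>0) (s - cnj s\<^sub>0)\<close>.\<close>

lemma limit_expr_eq: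
  assumes l: "l\<^sup>2 = s" "l0\<^sup>2 = s0" "0 < Re s" "Im s0 \<noteq> 0"
    and ne: "s \<noteq> of_real (cmod s0)" "s \<noteq> cnj s0"
  shows "limit_expr l l0 = 1 / 2 * ((s + s0) / (s + of_real (cmod s0)))\<^sup>2"
proof -
  define m where "m = complex_of_real (cmod s0)"
  have s0: "s0 \<noteq> 0" using assms(4) by auto
  have mm: "m * m = s0 * cnj s0"
    using complex_norm_square[of s0] by (simp add: m_def power2_eq_square)
  have sm: "s + m \<noteq> 0"
    using add_of_real_nonzero[of s "cmod s0"] l(3) s0 by (simp add: m_def)
  have n1: "complex_of_real ((cmod l0)\<^sup>2) = m" using l(2) by (simp add: m_def flip: norm_power of_real_power)
  have n2: "(cnj l0)\<^sup>2 = cnj s0" using l(2) by (simp flip: complex_cnj_power)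
  have d: "s0 - cnj s0 \<noteq> 0" using assms(4) by (auto simp: complex_eq_iff)
  have nz: "s - m \<noteq> 0" "s - cnj s0 \<noteq> 0" using ne by (auto simp: m_def)
  have "h_fun l0 l0 = s0 / (s0 * s0 - m * m)"
    unfolding h_fun_def n1 l by (simp add: algebra_simps)
  also have "\<dots> = s0 / (s0 * (s0 - cnj s0))" unfolding mm by (simp add: algebra_simps)
  also have "\<dots> = 1 / (s0 - cnj s0)" using s0 by simp
  finally have h0: "h_fun l0 l0 = 1 / (s0 - cnj s0)" .
  have h: "h_fun l l0 = s / ((s - m) * (s + m))" unfolding h_fun_def n1 l ..
  have frac: "1 + x / y / (1 / v) = (y + x * v) / y" if "y \<noteq> 0" for x y v :: complex
    using that by (simp add: add_divide_distrib)
  have "1 + h_fun l l0 / h_fun l0 l0 = ((s - m) * (s + m) + s * (s0 - cnj s0)) / ((s - m) * (s + m))"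
    unfolding h h0 by (rule frac) (use nz sm in simp)
  also have "(s - m) * (s + m) + s * (s0 - cnj s0) = s * s - m * m + s * (s0 - cnj s0)"
    by (simp add: algebra_simps)
  also have "\<dots> = (s + s0) * (s - cnj s0)" unfolding mm by (simp add: algebra_simps)
  finally have 1: "1 + h_fun l l0 / h_fun l0 l0 = (s + s0) * (s - cnj s0) / ((s - m) * (s + m))" .
  have "limit_expr l l0 = 1 / 2 * ((s + s0) * (s - cnj s0) / ((s - m) * (s + m)))
       * ((s - m) / (s + m)) * ((s + s0) / (s - cnj s0))"
    unfolding limit_expr_def 1 n1 n2 l ..
  also have "\<dots> = 1 / 2 * ((s + s0) / (s + m))\<^sup>2"
    using nz sm by (simp add: power2_eq_square)
  finally show ?thesis unfolding m_def .
qed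

lemma eventually_notin_finite_at:
  fixes z :: "'a::t1_space"
  assumes "finite X"
  shows "eventually (\<lambda>v. v \<notin> X) (at z)"
proof -
  have "eventually (\<lambda>v. v \<in> - (X - {z}) - {z}) (at z)"
    by (rule eventually_at_in_open[OF open_Compl[OF finite_imp_closed[OF finite_Diff[OF assms]]]]) simp
  thus ?thesis by eventually_elim auto
qed

lemma eventually_notin_bounded_at_infinity:
  fixes X :: "'a::real_normed_vector set"
  assumes "bounded X"
  shows "eventually (\<lambda>v. v \<notin> X) at_infinity"
proof -
  obtain B where "\<forall>x\<in>X. norm x \<le> B" using assms by (auto simp: bounded_iff)
  thus ?thesis unfolding eventually_at_infinity by (intro exI[of _ "B + 1"]) force
qed

context arc
begin

text \<open>This places \<open>lam\<close> squared at \<open>u0\<close> strictly below the real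
  axis, so \<open>\<tau>\<close> is positive and \<open>h_fun\<close> at
  \<open>lam \<alpha> u0\<close> has a nonzero denominator.\<close>

lemma Im_mob_neg:
  assumes "cmod u < 1"
  shows "Im (mob u) < 0"
proof -
  have ne: "u \<noteq> endpt" using assms endpt_facts(1) by auto
  have eq: "mob u = (u * endpt - 1) * cnj (u - endpt) / of_real ((cmod (u - endpt))\<^sup>2)"
    unfolding mob_def complex_norm_square using ne by simp
  have "(u * endpt - 1) * cnj (u - endpt)
     = (u * cnj u) * endpt - u * (endpt * cnj endpt) - cnj u + cnj endpt"
    by (simp add: algebra_simps)
  also have "\<dots> = of_real ((cmod u)\<^sup>2) * endpt - (u + cnj u) + cnj endpt"
    unfolding endpt_facts(5) complex_norm_square by simp
  finally have "Im ((u * endpt - 1) * cnj (u - endpt)) = ((cmod u)\<^sup>2 - 1) * sin \<alpha>"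
    using endpt_facts by (simp only: Im_complex_of_real) (simp add: algebra_simps)
  moreover have "((cmod u)\<^sup>2 - 1) * sin \<alpha> < 0"
    using assms endpt_facts by (intro mult_neg_pos) (auto simp: abs_square_less_1)
  moreover have "Im (mob u) = Im ((u * endpt - 1) * cnj (u - endpt)) / (cmod (u - endpt))\<^sup>2"
    unfolding eq Im_divide_of_real ..
  ultimately show ?thesis using ne by (simp add: divide_neg_pos)
qed

lemma lam_square:
  assumes "u \<notin> arc_set \<alpha>"
  shows "(lam \<alpha> u)\<^sup>2 = csqrt (mob u)"
proof -
  have "mob u \<noteq> 0" using not_arc(2)[OF assms] by auto
  moreover have "lam \<alpha> u = mob u powr (1 / 4)"
    by (simp add: lam_def mob_def endpt_def cis_conv_exp)
  ultimately show ?thesis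
    by (simp add: powr_def csqrt_exp_Ln exp_double[symmetric] flip: exp_of_nat_mult)
qed

end

context scaled_arc
begin

text \<open>The continuation of \<open>(w b)\<^sup>n P\<close> through the removable singularity at \<open>centre\<close>, the image of infinity.\<close>

definition lifted :: "complex \<Rightarrow> nat \<Rightarrow> complex poly \<Rightarrow> complex \<Rightarrow> complex" where
  "lifted w n P z = w ^ n / (1 - cnj centre * z) ^ n *
     (\<Sum>k\<le>n. coeff P k * numer z ^ k * (z - centre) ^ (n - k) / ((half + m)\<^sup>2 * (1 - centre * z)) ^ k)"

lemma disc_factor_nonzero:
  assumes "cmod z \<le> 1"
  shows "1 - cnj centre * z \<noteq> 0" "1 - centre * z \<noteq> 0" "(half + m)\<^sup>2 * (1 - centre * z) \<noteq> 0"
  using one_minus_mult_nonzero[of centre z] one_minus_mult_nonzero[of "cnj centre" z] assms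
    norm_centre half_m by auto

lemma lifted_eq:
  assumes "degree P \<le> n" "cmod z \<le> 1" "z \<noteq> centre"
  shows "lifted w n P z = w ^ n * blaschke centre z ^ n * poly P (of_disc z)"
proof -
  note nz = disc_factor_nonzero[OF assms(2)]
  define q where "q = (half + m)\<^sup>2 * (1 - centre * z)"
  have od: "of_disc z = numer z / (q * (z - centre))"
    unfolding of_disc_def denom_eq q_def by (simp add: mult_ac)
  have "poly P x = (\<Sum>k\<le>n. coeff P k * x ^ k)" for x
    unfolding poly_altdef using assms(1)
    by (intro sum.mono_neutral_left) (auto simp: coeff_eq_0)
  hence "(z - centre) ^ n * poly P (of_disc z)
      = (\<Sum>k\<le>n. (z - centre) ^ n * (coeff P k * of_disc z ^ k))"
    by (simp add: sum_distrib_left)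
  also have "\<dots> = (\<Sum>k\<le>n. coeff P k * numer z ^ k * (z - centre) ^ (n - k) / q ^ k)"
  proof (rule sum.cong[OF refl])
    fix k assume "k \<in> {..n}"
    hence "(z - centre) ^ n = (z - centre) ^ (n - k) * (z - centre) ^ k"
      by (simp flip: power_add)
    moreover have "a * x * (d * (N / (v * x))) = d * N * a / v" if "x \<noteq> 0" for a x d N v :: complex
      using that by simp
    moreover have "(z - centre) ^ k \<noteq> 0" using assms(3) by simp
    ultimately show "(z - centre) ^ n * (coeff P k * of_disc z ^ k)
        = coeff P k * numer z ^ k * (z - centre) ^ (n - k) / q ^ k"
      unfolding od power_divide power_mult_distrib by metis
  qed
  finally show ?thesis
    unfolding lifted_def q_def[symmetric] blaschke_def power_divide by simp
qed

lemma lifted_analytic: "lifted w n P analytic_on cball 0 1"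
  unfolding lifted_def[abs_def] numer_def using disc_factor_nonzero
  by (intro analytic_intros) auto

text \<open>Surjectivity transfers bounds for trial polynomials from the circle to the arc.\<close>

lemma arc_subset_of_disc_circle:
  assumes "u \<in> arc_set \<alpha>"
  shows "\<exists>z. cmod z = 1 \<and> of_disc z = u"
proof (cases "u = endpt")
  case True
  have "of_disc 1 = endpt" using m by (simp add: of_disc_def numer_def denom_def)
  thus ?thesis using True by (intro exI[of _ 1]) simp
next
  case False
  obtain t where t: "t \<le> 0" "mob u = of_real t"
    using mob_arc[OF assms False] by (auto elim: nonpos_Reals_cases)
  \<comment> \<open>One of the two imaginary square roots of \<open>mob u\<close>; the choice of
    sign corresponds to a side of the arc.\<close>
  define s where "s = \<i> * of_real (sqrt (- t))"
  define z where "z = (s - m) / (s + m)"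
  have ss: "s\<^sup>2 = mob u"
    using t by (simp add: s_def power_mult_distrib flip: of_real_power)
  have sm: "s + m \<noteq> 0" using m by (auto simp: s_def complex_eq_iff)
  have "cmod (s - m) = cmod (s + m)" by (simp add: s_def cmod_def)
  hence z1: "cmod z = 1" using sm by (simp add: z_def norm_divide)
  have z: "1 + z = 2 * s / (s + m)" "1 - z = 2 * m / (s + m)"
    unfolding z_def using sm by (simp_all add: field_simps)
  have "z \<noteq> 1" using z(2) m sm by auto
  hence "of_disc z = mob ((m * (1 + z) / (1 - z))\<^sup>2)" by (rule of_disc_mob)
  also have "m * (1 + z) / (1 - z) = s" unfolding z using m sm by simp
  finally show ?thesis using z1 by (intro exI[of _ z]) (simp add: ss mob_mob[OF False])
qed

section \<open>Compact sets and limits on the sphere in the disc coordinate\<close>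

definition disc_point :: "complex option \<Rightarrow> complex" where
  "disc_point p = (case p of None \<Rightarrow> centre | Some u \<Rightarrow> to_disc u)"

lemma norm_disc_point: "p \<in> arc_domain \<alpha> \<Longrightarrow> cmod (disc_point p) < 1"
  using norm_centre to_disc_arc(1) by (auto simp: disc_point_def arc_domain_def split: option.splits)

text \<open>The assumption on \<open>r\<close> puts infinity into the set. The complement in the
  plane is closed, and bounded because \<open>to_disc\<close> tends to \<open>centre\<close>, as the
  topology of the sphere requires.\<close>

lemma openin_disc_point:
  assumes r: "cmod centre < r"
  shows "openin riemann_sphere {p \<in> arc_domain \<alpha>. cmod (disc_point p) < r}"
proof -
  define V where "V = {u \<in> - arc_set \<alpha>. to_disc u \<in> ball 0 r}"
  have "open V" unfolding V_def
    using continuous_open_preimage[OF holomorphic_on_imp_continuous_on[OF to_disc_holomorphic]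
        open_arc_compl open_ball[of 0 r]]
    by (simp add: vimage_def Int_def conj_commute)
  have "eventually (\<lambda>u. cmod (to_disc u) < r) at_infinity"
    using order_tendstoD(2)[OF tendsto_norm[OF to_disc_tendsto] r] .
  moreover have "eventually (\<lambda>u::complex. 2 \<le> norm u) at_infinity"
    by (auto simp: eventually_at_infinity)
  ultimately have "eventually (\<lambda>u. u \<in> V) at_infinity"
    by eventually_elim (auto simp: V_def arc_set_def)
  then obtain B where "\<forall>u. B \<le> cmod u \<longrightarrow> u \<in> V" unfolding eventually_at_infinity by blast
  hence "bounded (- V)" unfolding bounded_iff by (intro exI[of _ B]) force
  hence "compact (- V)" using \<open>open V\<close> by (simp add: compact_eq_bounded_closed closed_Compl)
  moreover have "{p \<in> arc_domain \<alpha>. cmod (disc_point p) < r} = insert None (Some ` (topspace euclidean - (- V)))"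
  proof (rule set_eqI)
    fix p
    show "p \<in> {p \<in> arc_domain \<alpha>. cmod (disc_point p) < r}
        \<longleftrightarrow> p \<in> insert None (Some ` (topspace euclidean - (- V)))"
      using r by (cases p) (auto simp: V_def disc_point_def arc_domain_def)
  qed
  ultimately show ?thesis
    unfolding openin_Alexandroff_compactification
    by (intro disjI2 exI[of _ "- V"]) (simp add: closed_Compl \<open>open V\<close>)
qed

lemma compactin_disc_point:
  assumes K: "compactin riemann_sphere K" "K \<subseteq> arc_domain \<alpha>"
  shows "\<exists>r<1. \<forall>p\<in>K. cmod (disc_point p) \<le> r"
proof -
  define U where "U r = {p \<in> arc_domain \<alpha>. cmod (disc_point p) < r}" for r
  let ?I = "{r. cmod centre < r \<and> r < 1}"
  have "K \<subseteq> \<Union> (U ` ?I)"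
  proof
    fix p assume p: "p \<in> K"
    define r where "r = (max (cmod centre) (cmod (disc_point p)) + 1) / 2"
    have "cmod (disc_point p) < 1" using norm_disc_point p K(2) by blast
    hence "r \<in> ?I" "cmod (disc_point p) < r" using norm_centre by (auto simp: r_def max_def)
    thus "p \<in> \<Union> (U ` ?I)" using p K(2) by (auto simp: U_def)
  qed
  moreover have "\<forall>V\<in>U ` ?I. openin riemann_sphere V"
    using openin_disc_point by (auto simp: U_def)
  ultimately obtain F where F: "finite F" "F \<subseteq> U ` ?I" "K \<subseteq> \<Union> F"
    using K(1) unfolding compactin_def by meson
  then obtain R where R: "finite R" "R \<subseteq> ?I" "F = U ` R" by (meson finite_subset_image)
  \<comment> \<open>The inserted element keeps the set nonempty when \<open>K\<close> is
    empty.\<close>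
  define r where "r = Max (insert (cmod centre) R)"
  have "r < 1" using R norm_centre by (auto simp: r_def)
  moreover have "cmod (disc_point p) \<le> r" if p: "p \<in> K" for p
  proof -
    obtain t where "t \<in> R" "cmod (disc_point p) < t" using F(3) R(3) p by (auto simp: U_def)
    moreover have "t \<le> r" using \<open>t \<in> R\<close> R(1) by (simp add: r_def)
    ultimately show ?thesis by simp
  qed
  ultimately show ?thesis by blast
qed

text \<open>\<open>X\<close> collects the removable singularities: off this finite set
  \<open>F\<close> agrees with a function continuous at the point, which determines the limit both
  at finite points and at infinity.\<close>

lemma sphere_extension_eq:
  assumes g: "isCont g (disc_point p)" and p: "p \<in> arc_domain \<alpha>" and X: "finite X"
    and F: "\<And>u. u \<notin> arc_set \<alpha> \<Longrightarrow> u \<notin> X \<Longrightarrow> F u = g (to_disc u)"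
  shows "sphere_extension F p = g (disc_point p)"
proof (cases p)
  case None
  have "((\<lambda>u. g (to_disc u)) \<longlongrightarrow> g centre) at_infinity"
    using g None by (intro isCont_tendsto_compose[OF _ to_disc_tendsto]) (simp add: disc_point_def)
  moreover have "eventually (\<lambda>u. g (to_disc u) = F u) at_infinity"
  proof -
    have "bounded (arc_set \<alpha>)" unfolding bounded_iff arc_set_def by (intro exI[of _ 1]) auto
    hence "eventually (\<lambda>u. u \<notin> arc_set \<alpha> \<union> X) at_infinity"
      using X by (intro eventually_notin_bounded_at_infinity) (simp add: finite_imp_bounded)
    thus ?thesis by eventually_elim (simp add: F)
  qed
  ultimately have "(F \<longlongrightarrow> g centre) at_infinity" by (rule Lim_transform_eventually)
  hence "Lim at_infinity F = g centre" by (intro tendsto_Lim trivial_limit_at_infinity)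
  thus ?thesis using None by (simp add: sphere_extension_def disc_point_def)
next
  case (Some u)
  have u: "u \<in> - arc_set \<alpha>" using p Some by (auto simp: arc_domain_def)
  have "isCont to_disc u"
    using to_disc_holomorphic open_arc_compl u
    by (intro continuous_on_interior[OF holomorphic_on_imp_continuous_on]) (auto simp: interior_open)
  hence "(to_disc \<longlongrightarrow> to_disc u) (at u)" by (simp add: isCont_def)
  hence "((\<lambda>v. g (to_disc v)) \<longlongrightarrow> g (to_disc u)) (at u)"
    using g Some by (intro isCont_tendsto_compose[of _ g]) (simp_all add: disc_point_def)
  moreover have "eventually (\<lambda>v. v \<in> - arc_set \<alpha> - {u}) (at u)"
    by (rule eventually_at_in_open[OF open_arc_compl u])
  hence "eventually (\<lambda>v. g (to_disc v) = F v) (at u)"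
    using eventually_notin_finite_at[OF X, of u] by eventually_elim (simp add: F)
  ultimately have "(F \<longlongrightarrow> g (to_disc u)) (at u)" by (rule Lim_transform_eventually)
  thus ?thesis using Some by (auto simp: sphere_extension_def disc_point_def)
qed

end

theorem theorem1p1:
  fixes \<alpha> :: real and u0 :: complex
    and b :: "complex option \<Rightarrow> complex" and P :: "nat \<Rightarrow> complex poly"
  assumes "0 < \<alpha>" and "\<alpha> < pi" and "cmod u0 < 1"
    and "is_complex_green_function (arc_domain \<alpha>) None b"
    and "\<exists>c::real. 0 < c \<and> ((\<lambda>u. u * b (Some u)) \<longlongrightarrow> of_real c) at_infinity"
    and "\<And>n. is_extremal_poly n \<alpha> u0 (P n)"
    and "\<And>n. \<exists>r::real. 0 < r \<and> b (Some u0) ^ n * poly (P n) u0 = of_real r"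
  shows "\<exists>\<phi>::real. \<forall>K. compactin riemann_sphere K \<and> K \<subseteq> arc_domain \<alpha> \<longrightarrow>
           uniform_limit K
             (\<lambda>n. sphere_extension (\<lambda>u. b (Some u) ^ n * poly (P n) u))
             (\<lambda>p. exp (\<i> * of_real \<phi>) * sphere_extension (\<lambda>u. limit_expr (lam \<alpha> u) (lam \<alpha> u0)) p)
             sequentially"
proof -
  interpret arc \<alpha> by unfold_locales (fact assms)+
  have u0: "u0 \<notin> arc_set \<alpha>" using assms(3) by (auto simp: arc_set_def)
  define s0 where "s0 = csqrt (mob u0)"
  have Re_s0: "0 < Re s0" using not_arc(3)[OF u0] by (simp add: s0_def)
  have "Im (s0\<^sup>2) < 0" using Im_mob_neg[OF assms(3)] by (simp add: s0_def)
  hence "Re s0 * Im s0 < 0" by (simp add: power2_eq_square mult.commute)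
  hence Im_s0: "Im s0 < 0" using Re_s0 by (simp add: mult_less_0_iff)
  define m where "m = cmod s0"
  have m: "0 < m" using Re_s0 by (auto simp: m_def)
  interpret scaled_arc \<alpha> m by unfold_locales (fact m)
  \<comment> \<open>The tangent of half the angle from \<open>s0\<close> up to the positive axis:
    for \<open>|s0| = m\<close> the Cayley transform of \<open>s0\<close> is \<open>\<i>\<close>
    times the tangent of half of \<open>Arg s0\<close>.\<close>
  define \<tau> where "\<tau> = - Im s0 / (m + Re s0)"
  have "\<bar>Im s0\<bar> \<le> m" using abs_Im_le_cmod by (simp add: m_def)
  hence tau01: "0 < \<tau>" "\<tau> < 1" using Im_s0 Re_s0 m by (auto simp: \<tau>_def field_simps)
  interpret arc_param \<tau> centre of_disc
    using tau01 norm_centre of_disc_affine by unfold_locales auto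
  have s0m: "s0 + m \<noteq> 0" by (rule add_of_real_nonzero[OF Re_s0 m])
  have to_disc_u0: "to_disc u0 = pole"
  proof -
    have mm: "complex_of_real m * m = s0 * cnj s0"
      using complex_norm_square[of s0] by (simp add: m_def power2_eq_square)
    have "(s0 - m) * (m + Re s0) = \<i> * Im s0 * (s0 + m)"
    proof -
      have "(Re s0)\<^sup>2 + (Im s0)\<^sup>2 = m\<^sup>2" by (simp add: m_def cmod_power2)
      thus ?thesis by (simp add: complex_eq_iff power2_eq_square algebra_simps)
    qed
    moreover have "complex_of_real m + complex_of_real (Re s0) \<noteq> 0"
      using m Re_s0 by (metis add_pos_pos less_irrefl of_real_add of_real_eq_0_iff)
    ultimately have "(s0 - m) / (s0 + m) = \<i> * Im s0 / (m + Re s0)"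
      using s0m by (simp add: frac_eq_eq)
    thus ?thesis unfolding to_disc_def s0_def[symmetric] pole_def by (simp add: \<tau>_def)
  qed
  have pole_centre: "pole \<noteq> centre" using to_disc_arc(3)[OF u0] to_disc_u0 by simp
  have of_disc_pole: "of_disc pole = u0" using to_disc_arc(2)[OF u0] to_disc_u0 by simp
  obtain w where bw: "cmod w = 1" "\<And>u. u \<notin> arc_set \<alpha> \<Longrightarrow> b (Some u) = w * blaschke centre (to_disc u)"
    using complex_green_function_eq assms(4,5) by metis
  have P: "degree (P n) \<le> n" "\<And>u. u \<in> arc_set \<alpha> \<Longrightarrow> cmod (poly (P n) u) \<le> 1"
    "\<And>Q. Q \<in> bounded_polys n \<alpha> \<Longrightarrow> cmod (poly Q u0) \<le> cmod (poly (P n) u0)" for n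
    using assms(6)[of n] by (auto simp: is_extremal_poly_def bounded_polys_def)
  define f where "f n = lifted w n (P n)" for n
  have f_eq: "f n (to_disc u) = b (Some u) ^ n * poly (P n) u" if u: "u \<notin> arc_set \<alpha>" for n u
    using lifted_eq[OF P(1), of "to_disc u" w n] to_disc_arc[OF u] bw(2)[OF u]
    by (simp add: f_def power_mult_distrib)
  interpret disc_sequence \<tau> centre f "\<lambda>n z. poly (P n) (of_disc z)" "\<lambda>n. w ^ n"
  proof unfold_locales
    fix n and z :: complex
    show "f n analytic_on cball 0 1" unfolding f_def by (rule lifted_analytic)
    show "cmod (w ^ n) = 1" using bw by (simp add: norm_power)
    assume z: "cmod z = 1"
    show "poly (P n) (of_disc (inverse z)) = poly (P n) (of_disc z)"
      using z by (subst of_disc_inverse) auto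
    show "cmod (poly (P n) (of_disc z)) \<le> 1" using P(2) of_disc_circle[OF z] by blast
    show "f n z = w ^ n * blaschke centre z ^ n * poly (P n) (of_disc z)"
      unfolding f_def using z norm_centre by (intro lifted_eq P) auto
  qed
  obtain r where r: "\<And>n. 0 < r n" "\<And>n. b (Some u0) ^ n * poly (P n) u0 = of_real (r n)"
    using assms(7) by metis
  have f_pole: "f n pole = of_real (r n)" for n
    using f_eq[OF u0] r(2) to_disc_u0 by simp
  have "\<tau> \<noteq> 0" using tau01 by simp
  from near_optimal_polynomials[OF this pole_centre]
  obtain Q where Q: "\<And>n. degree (Q n) \<le> n"
    "\<And>n z. cmod z = 1 \<Longrightarrow> cmod (poly (Q n) (of_disc z)) \<le> 1"
    "(\<lambda>n. blaschke centre pole ^ n * poly (Q n) (of_disc pole)) \<longlonglongrightarrow> lim_fun pole"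
    by auto
  \<comment> \<open>The amount by which the trial polynomial falls short of the limiting extremal
    value.\<close>
  define e where "e n = (1 + \<tau>\<^sup>2) / 2 - cmod (blaschke centre pole ^ n * poly (Q n) u0)" for n
  have cl: "cmod (lim_fun pole) = (1 + \<tau>\<^sup>2) / 2"
    using tau_sq unfolding lim_fun_pole norm_of_real by simp
  have e: "e \<longlonglongrightarrow> 0"
    using tendsto_diff[OF tendsto_const tendsto_norm[OF Q(3)], of "(1 + \<tau>\<^sup>2) / 2"]
    unfolding cl of_disc_pole e_def[abs_def] by simp
  \<comment> \<open>Extremality of \<open>P n\<close> against \<open>Q n\<close>; the constant
    \<open>w\<close> drops out of the modulus.\<close>
  have low: "(1 + \<tau>\<^sup>2) / 2 - e n \<le> r n" for n
  proof -
    have "cmod (poly (Q n) u) \<le> 1" if u: "u \<in> arc_set \<alpha>" for u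
      using Q(2) arc_subset_of_disc_circle[OF u] by metis
    hence "Q n \<in> bounded_polys n \<alpha>" using Q(1) by (simp add: bounded_polys_def)
    hence "cmod (b (Some u0) ^ n) * cmod (poly (Q n) u0) \<le> cmod (b (Some u0) ^ n) * cmod (poly (P n) u0)"
      by (intro mult_left_mono P) auto
    also have "\<dots> = r n" using r[of n] by (metis abs_of_pos norm_mult norm_of_real)
    finally show ?thesis
      using bw(1) bw(2)[OF u0] to_disc_u0 by (simp add: e_def norm_mult norm_power power_mult_distrib)
  qed
  have pointwise: "(\<lambda>n. f n z) \<longlonglongrightarrow> lim_fun z" if "cmod z < 1" for z
    using tendsto_lim_fun[OF f_pole e low that] .
  \<comment> \<open>\<open>limit_expr\<close> turns out to be \<open>lim_fun / \<omega>\<close>,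
    because \<open>1 + \<i> * \<tau> = 2 * m / (s0 + m)\<close>. So the argument of
    \<open>\<omega>\<close> is the required \<open>\<phi>\<close>.\<close>
  define \<omega> where "\<omega> = (1 + \<i> * \<tau>)\<^sup>2 / (1 + (of_real \<tau>)\<^sup>2)"
  have t1: "1 + \<i> * \<tau> \<noteq> 0" "1 + (complex_of_real \<tau>)\<^sup>2 \<noteq> 0"
    using factor_nonzero(1,3)[of 1] by simp_all
  have "cmod \<omega> = 1"
  proof -
    have "(cmod (1 + \<i> * \<tau>))\<^sup>2 = 1 + \<tau>\<^sup>2" by (simp add: cmod_power2)
    moreover have "1 + (complex_of_real \<tau>)\<^sup>2 = of_real (1 + \<tau>\<^sup>2)" by simp
    hence "cmod (1 + (complex_of_real \<tau>)\<^sup>2) = \<bar>1 + \<tau>\<^sup>2\<bar>" by (metis norm_of_real)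
    moreover have "0 < 1 + \<tau>\<^sup>2" using tau_sq by linarith
    ultimately show ?thesis by (simp add: \<omega>_def norm_divide norm_power)
  qed
  hence \<omega>: "exp (\<i> * of_real (Arg \<omega>)) = \<omega>"
    using rcis_cmod_Arg[of \<omega>] by (simp add: rcis_def cis_conv_exp)
  have limit: "exp (\<i> * of_real (Arg \<omega>)) * sphere_extension (\<lambda>u. limit_expr (lam \<alpha> u) (lam \<alpha> u0)) p
      = lim_fun (disc_point p)" if p: "p \<in> arc_domain \<alpha>" for p
  proof -
    have "sphere_extension (\<lambda>u. limit_expr (lam \<alpha> u) (lam \<alpha> u0)) p = lim_fun (disc_point p) / \<omega>"
    proof (rule sphere_extension_eq[where g = "\<lambda>z. lim_fun z / \<omega>"])
      show "isCont (\<lambda>z. lim_fun z / \<omega>) (disc_point p)"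
        using analytic_at_imp_isCont[OF lim_fun_analytic] \<open>cmod \<omega> = 1\<close>
        by (intro continuous_intros) auto
      \<comment> \<open>The points where \<open>lam\<close> squared equals \<open>|s0|\<close> or
        \<open>cnj s0\<close>, at which the formula for the limit divides by zero.\<close>
      show "finite {mob ((of_real m)\<^sup>2), mob ((cnj s0)\<^sup>2)}" by simp
      fix u assume u: "u \<notin> arc_set \<alpha>" "u \<notin> {mob ((of_real m)\<^sup>2), mob ((cnj s0)\<^sup>2)}"
      define s where "s = csqrt (mob u)"
      have us: "mob (s\<^sup>2) = u" using mob_mob not_arc(1)[OF u(1)] by (simp add: s_def)
      have Re_s: "0 < Re s" using not_arc(3)[OF u(1)] by (simp add: s_def)
      have sm: "s + m \<noteq> 0" by (rule add_of_real_nonzero[OF Re_s m])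
      have "limit_expr (lam \<alpha> u) (lam \<alpha> u0) = 1 / 2 * ((s + s0) / (s + of_real (cmod s0)))\<^sup>2"
      proof (rule limit_expr_eq)
        show "(lam \<alpha> u)\<^sup>2 = s" "(lam \<alpha> u0)\<^sup>2 = s0"
          using lam_square u(1) u0 by (simp_all add: s_def s0_def)
        show "s \<noteq> of_real (cmod s0)" "s \<noteq> cnj s0" using us u(2) by (auto simp: m_def)
      qed (use Re_s Im_s0 in auto)
      also have "(s + s0) / (s + of_real (cmod s0)) = (1 + \<i> * \<tau> * to_disc u) / (1 + \<i> * \<tau>)"
      proof -
        have z: "to_disc u = (s - m) / (s + m)" by (simp add: to_disc_def s_def)
        have z0: "\<i> * \<tau> = - ((s0 - m) / (s0 + m))"
          using to_disc_u0 by (simp add: to_disc_def s0_def pole_def)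
        have frac: "1 + - (x / y) * (v / t) = (y * t - x * v) / (y * t)"
          if "y \<noteq> 0" "t \<noteq> 0" for x y v t :: complex
          using that by (simp add: diff_divide_distrib)
        have "1 + \<i> * \<tau> * to_disc u = ((s0 + m) * (s + m) - (s0 - m) * (s - m)) / ((s0 + m) * (s + m))"
          unfolding z z0 by (rule frac[OF s0m sm])
        also have "(s0 + m) * (s + m) - (s0 - m) * (s - m) = 2 * m * (s + s0)"
          by (simp add: algebra_simps)
        finally have "1 + \<i> * \<tau> * to_disc u = 2 * m * (s + s0) / ((s0 + m) * (s + m))" .
        moreover have "1 + \<i> * \<tau> = 2 * m / (s0 + m)"
          unfolding z0 using s0m by (simp add: field_simps)
        ultimately show ?thesis using sm s0m m by (simp add: m_def)
      qed
      also have "1 / 2 * ((1 + \<i> * \<tau> * to_disc u) / (1 + \<i> * \<tau>))\<^sup>2 = lim_fun (to_disc u) / \<omega>"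
      proof -
        have "1 / 2 * (x / v) = x / (2 * y) / (v / y)" if "y \<noteq> 0" for x y v :: complex
          using that by simp
        thus ?thesis unfolding lim_fun_def \<omega>_def power_divide using t1(2) by blast
      qed
      finally show "limit_expr (lam \<alpha> u) (lam \<alpha> u0) = lim_fun (to_disc u) / \<omega>" .
    qed (rule p)
    thus ?thesis using \<omega> \<open>cmod \<omega> = 1\<close> by auto
  qed
  have left: "sphere_extension (\<lambda>u. b (Some u) ^ n * poly (P n) u) p = f n (disc_point p)"
    if p: "p \<in> arc_domain \<alpha>" for n p
  proof (rule sphere_extension_eq[where X = "{}", OF _ p])
    show "isCont (f n) (disc_point p)"
      using f_analytic[of n] norm_disc_point[OF p]
      by (intro analytic_at_imp_isCont) (auto elim: analytic_on_subset)
  qed (auto simp: f_eq)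
  show ?thesis
  proof (intro exI[of _ "Arg \<omega>"] allI impI)
    fix K assume K: "compactin riemann_sphere K \<and> K \<subseteq> arc_domain \<alpha>"
    then obtain R where R: "R < 1" "\<And>p. p \<in> K \<Longrightarrow> cmod (disc_point p) \<le> R"
      using compactin_disc_point[of K] by blast
    have "f n holomorphic_on ball 0 1" for n
      using f_analytic[of n] by (meson analytic_imp_holomorphic ball_subset_cball holomorphic_on_subset)
    hence "uniform_limit (cball 0 R) f lim_fun sequentially"
      using f_norm_le pointwise R(1) by (intro bounded_pointwise_imp_uniform_limit) auto
    hence "uniform_limit K (\<lambda>n p. f n (disc_point p)) (\<lambda>p. lim_fun (disc_point p)) sequentially"
      using R(2) unfolding uniform_limit_iff by (fastforce elim!: eventually_mono)
    moreover have "uniform_limit K (\<lambda>n. sphere_extension (\<lambda>u. b (Some u) ^ n * poly (P n) u))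
         (\<lambda>p. exp (\<i> * of_real (Arg \<omega>)) * sphere_extension (\<lambda>u. limit_expr (lam \<alpha> u) (lam \<alpha> u0)) p)
         sequentially
       \<longleftrightarrow> uniform_limit K (\<lambda>n p. f n (disc_point p)) (\<lambda>p. lim_fun (disc_point p)) sequentially"
      using K left limit by (intro uniform_limit_cong') blast+
    ultimately show "uniform_limit K (\<lambda>n. sphere_extension (\<lambda>u. b (Some u) ^ n * poly (P n) u))
       (\<lambda>p. exp (\<i> * of_real (Arg \<omega>)) * sphere_extension (\<lambda>u. limit_expr (lam \<alpha> u) (lam \<alpha> u0)) p)
       sequentially" by blast
  qed
qed

end
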